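(* Let $\mathbb F$ be an algebraically closed field and let $q\in\mathbb F$ be nonzero and not a root of unity. Let $A,B$ denote a Leonard pair over $\mathbb F$ of $q$-Racah type, with feasible sequence $(a,b,c,d)$, $d\ge 1$. Define $t=abc^{-1}$. Then the following (i)--(iii) hold. (i) The underlying vector space $V$ supports a unique $t$-evaluation module for $\boxtimes_q$ (that is, a unique $\boxtimes_q$-module structure that makes $V$ an evaluation module with evaluation parameter $t$) such that on $V$, $$A=ax_{01}+a^{-1}x_{12},\qquad B=bx_{23}+b^{-1}x_{30}.$$ (ii) The element $\mathbf C=cx_{30}+c^{-1}x_{01}+ab^{-1}\frac{[x_{30},x_{01}]}{q-q^{-1}}$ of $\boxtimes_q$ acts on $V$ as the $\mathbb Z_3$-symmetric completion of $A,B$. (iii) The element $\mathbf C'=cx_{12}+c^{-1}x_{23}+ba^{-1}\frac{[x_{12},x_{23}]}{q-q^{-1}}$ of $\boxtimes_q$ acts on $V$ as the dual $\mathbb Z_3$-symmetric completion of $A,B$.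
   Context: Algebras are associative with 1. $[n]_q=(q^n-q^{-n})/(q-q^{-1})$, $\mathbb Z_4=\mathbb Z/4\mathbb Z$, and $[u,v]=uv-vu$. The $q$-tetrahedron algebra $\boxtimes_q$ is the $\mathbb F$-algebra with generators (called the standard generators) $\{x_{ij}\mid i,j\in\mathbb Z_4,\ j-i=1\text{ or }j-i=2\}$ and relations: (i) $x_{ij}x_{ji}=1$ if $j-i=2$; (ii) $\frac{qx_{ij}x_{jk}-q^{-1}x_{jk}x_{ij}}{q-q^{-1}}=1$ if $(j-i,k-j)$ is one of $(1,1),(1,2),(2,1)$; (iii) $x_{ij}^3x_{k\ell}-[3]_qx_{ij}^2x_{k\ell}x_{ij}+[3]_qx_{ij}x_{k\ell}x_{ij}^2-x_{k\ell}x_{ij}^3=0$ if $j-i=k-j=\ell-k=1$. Known fact: on a finite-dimensional irreducible $\boxtimes_q$-module $V$ there are $d\in\mathbb N$ (the diameter) and $\varepsilon\in\{1,-1\}$ (the type) such that each standard generator is diagonalizable with set of distinct eigenvalues $\{\varepsilon q^{d-2n}\mid 0\le n\le d\}$. If $V$ has type 1, the sequence of dimensions of the eigenspaces of $x_{ij}$ for eigenvalues $q^{d},q^{d-2},\dots,q^{-d}$ does not depend on $x_{ij}$; it is called the shape of $V$. The trivial $\boxtimes_q$-module is the one-dimensional module on which every standard generator acts as the identity. An evaluation module for $\boxtimes_q$ is a nontrivial finite-dimensional irreducible $\boxtimes_q$-module of type 1 and shape $(1,1,\dots,1)$ (so $d\ge1$ and $\dim V=d+1$). Matrices in ${\rm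 Mat}_{d+1}(\mathbb F)$ have rows and columns indexed by $0,\dots,d$; $M$ represents $A$ with respect to a basis $\{v_n\}_{n=0}^d$ when $Av_n=\sum_i M_{in}v_i$. Entries not mentioned below are $0$. A subscript $q^{-1}$ means that $q$ is replaced by $q^{-1}$ in the definition (and similarly $t^{-1}$ as argument). - $Z$: $(i,j)$-entry $\delta_{i+j,d}$. - $K_q$: diagonal, $(i,i)$-entry $q^{d-2i}$. - $E_q$: $(i,i)$-entry $q^{2i-d}$; $(i-1,i)$-entry $q^d-q^{2i-2-d}$. - $G_q(t)$: $(i,i)$-entry $q^{2i-d}$; $(i-1,i)$-entry $(q^d-q^{2i-2-d})(1-tq^{d-2i+1})$. - $L_q(t)$: $(i,i)$-entry $q^{2i-d}$; $(i-1,i)$-entry $(q^d-q^{2i-2-d})(1-tq^{d-2i+1})^{-1}$. - $S_q(t)$: $(i-1,i)$-entry $(q^d-q^{2i-d-2})(1-tq^{2i-d-1})$; $(i,i-1)$-entry $(q^{2i-d}-q^{-d})q^{2i-d-1}t$; $(i,i)$-entry $q^d-(q^{2i-d}-q^{-d})q^{2i-d-1}t-(q^d-q^{2i-d})(1-tq^{2i-d+1})$. For an integer $d\ge1$ and a nonzero $t\in\mathbb F$ not among $\{q^{d-2n+1}\}_{n=1}^d$, $\mathbf V_d(t)$ is the evaluation module for $\boxtimes_q$ having a basis with respect to which the standard generators are represented by: $x_{01}: ZS_{q^{-1}}(t^{-1})Z$, $x_{12}: E_q$, $x_{23}: K_q$, $x_{30}: ZG_{q^{-1}}(t)Z$, $x_{02}: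 L_q(t)$, $x_{13}: (ZE_{q^{-1}}Z)^{-1}$, $x_{20}: (L_q(t))^{-1}$, $x_{31}: ZE_{q^{-1}}Z$. Every evaluation module $V$ of diameter $d$ is isomorphic to $\mathbf V_d(t)$ for a unique such $t$, called the evaluation parameter of $V$. Leonard pairs. A Leonard pair on a finite-dimensional nonzero $\mathbb F$-vector space $V$ (the underlying vector space) is an ordered pair $A,B\in{\rm End}(V)$ such that there is a basis of $V$ in which $A$ is diagonal and $B$ is irreducible tridiagonal, and a basis in which $B$ is diagonal and $A$ is irreducible tridiagonal (irreducible: all subdiagonal and superdiagonal entries nonzero). For nonzero $a,b,c\in\mathbb F$ and an integer $d\ge1$, $(a,b,c,d)$ is feasible when: (i) neither of $a^2,b^2$ is among $q^{2d-2},q^{2d-4},\dots,q^{2-2d}$; (ii) none of $abc,a^{-1}bc,ab^{-1}c,abc^{-1}$ is among $q^{d-1},q^{d-3},\dots,q^{1-d}$. Put $\theta_n=aq^{2n-d}+a^{-1}q^{d-2n}$, $\theta^*_n=bq^{2n-d}+b^{-1}q^{d-2n}$ ($0\le n\le d$) and, for $1\le n\le d$, $\varphi_n=a^{-1}b^{-1}q^{d+1}(q^n-q^{-n})(q^{n-d-1}-q^{d-n+1})(q^{-n}-abcq^{n-d-1})(q^{-n}-abc^{-1}q^{n-d-1})$, $\phi_n=ab^{-1}q^{d+1}(q^n-q^{-n})(q^{n-d-1}-q^{d-n+1})(q^{-n}-a^{-1}bcq^{n-d-1})(q^{-n}-a^{-1}bc^{-1}q^{n-d-1})$. For feasible $(a,b,c,d)$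 there is (known) a Leonard pair $A,B$, unique up to isomorphism (simultaneous conjugation by a linear bijection), such that: in one basis $A$ is lower bidiagonal with $(n,n)$-entry $\theta_n$ and all subdiagonal entries $1$, and $B$ is upper bidiagonal with $(n,n)$-entry $\theta^*_n$ and $(n-1,n)$-entry $\varphi_n$; in another basis $A$ is lower bidiagonal with $(n,n)$-entry $\theta_{d-n}$ and all subdiagonal entries $1$, and $B$ is upper bidiagonal with $(n,n)$-entry $\theta_n^*$ and $(n-1,n)$-entry $\phi_n$. This Leonard pair (and any isomorphic one) is said to correspond to $(a,b,c,d)$, and $(a,b,c,d)$ is called a feasible sequence for it. Leonard pairs arising in this way are said to have $q$-Racah type. For a Leonard pair $A,B$ on $V$ of $q$-Racah type with feasible sequence $(a,b,c,d)$, the $\mathbb Z_3$-symmetric completion is the (known to exist) unique $C\in{\rm End}(V)$ with $A+\frac{qBC-q^{-1}CB}{q^2-q^{-2}}=\frac{(a+a^{-1})(q^{d+1}+q^{-d-1})+(b+b^{-1})(c+c^{-1})}{q+q^{-1}}$, $B+\frac{qCA-q^{-1}AC}{q^2-q^{-2}}=\frac{(b+b^{-1})(q^{d+1}+q^{-d-1})+(c+c^{-1})(a+a^{-1})}{q+q^{-1}}$, $C+\frac{qAB-q^{-1}BA}{q^2-q^{-2}}=\frac{(c+c^{-1})(q^{d+1}+q^{-d-1})+(a+a^{-1})(b+b^{-1})}{q+q^{-1}}$ (scalars mean multiples of $I$). The dual $\mathbb Z_3$-symmetric completion of $A,B$ is the $\mathbb Z_3$-symmetric completion of the Leonard pair $B,A$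 (which has $q$-Racah type with feasible sequence $(b,a,c,d)$). *)

theory Defs
  imports
    "HOL-Library.Poly_Mapping"
    "HOL-Library.FuncSet"
    "HOL-Library.Numeral_Type"
    "HOL-Computational_Algebra.Polynomial"
    "Jordan_Normal_Form.Gauss_Jordan_Elimination"
begin

section \<open>The free algebra and two-sided ideals\<close>

text \<open>
  The free unital associative algebra over \<open>'a\<close> on the set \<open>'g\<close> is the monoid algebra of the
  free monoid on \<open>'g\<close>, i.e. the finitely supported functions from words to \<open>'a\<close> under convolution.
  Poly_Mapping writes the index monoid additively, so concatenation of words is \<open>+\<close>.
\<close>

datatype 'g free_monoid = FM (letters: "'g list")

instantiation free_monoid :: (type) monoid_add
begin
definition zero_free_monoid :: "'a free_monoid" where
  "0 = FM []"
definition plus_free_monoid :: "'a free_monoid \<Rightarrow> 'a free_monoid \<Rightarrow> 'a free_monoid" where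
  "u + v = FM (letters u @ letters v)"
instance
  by standard (simp_all add: zero_free_monoid_def plus_free_monoid_def)
end

type_synonym ('g, 'a) free_alg = "'g free_monoid \<Rightarrow>\<^sub>0 'a"

definition fgen :: "'g \<Rightarrow> ('g, 'a::comm_ring_1) free_alg" where
  "fgen g = Poly_Mapping.single (FM [g]) 1"

definition fscal :: "'a::comm_ring_1 \<Rightarrow> ('g, 'a) free_alg" where
  "fscal r = Poly_Mapping.single 0 r"

inductive_set two_sided_ideal :: "'r::ring_1 set \<Rightarrow> 'r set" for S :: "'r set" where
  zero: "0 \<in> two_sided_ideal S"
| gen: "s \<in> S \<Longrightarrow> u * s * v \<in> two_sided_ideal S"
| add: "x \<in> two_sided_ideal S \<Longrightarrow> y \<in> two_sided_ideal S \<Longrightarrow> x + y \<in> two_sided_ideal S"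


section \<open>The $q$-tetrahedron algebra\<close>

text \<open>The numeral type \<open>4\<close> is the ring of integers modulo 4.\<close>

typedef qtet_gen = "{(i :: 4, j :: 4). j - i = 1 \<or> j - i = 2}"
  by (rule exI[of _ "(0, 1)"]) simp

type_synonym 'a qtet_free = "(qtet_gen, 'a) free_alg"

text \<open>Only meaningful when \<open>j - i\<close> is 1 or 2.\<close>

definition xg :: "4 \<Rightarrow> 4 \<Rightarrow> 'a::field qtet_free" where
  "xg i j = fgen (Abs_qtet_gen (i, j))"

definition qnum :: "'a::field \<Rightarrow> int \<Rightarrow> 'a" where
  "qnum q n = (q powi n - q powi (- n)) / (q - inverse q)"

definition qtet_relators :: "'a::field \<Rightarrow> 'a qtet_free set" where
  "qtet_relators q =
     {xg i j * xg j i - 1 | i j. j - i = 2}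
   \<union> {fscal (inverse (q - inverse q))
        * (fscal q * xg i j * xg j k - fscal (inverse q) * xg j k * xg i j) - 1 | i j k.
        (j - i, k - j) \<in> {(1, 1), (1, 2), (2, 1)}}
   \<union> {xg i j ^ 3 * xg k l - fscal (qnum q 3) * xg i j ^ 2 * xg k l * xg i j
        + fscal (qnum q 3) * xg i j * xg k l * xg i j ^ 2 - xg k l * xg i j ^ 3 | i j k l.
        j - i = 1 \<and> k - j = 1 \<and> l - k = 1}"

text \<open>
  The algebra itself is the quotient of the free algebra by the two-sided ideal generated by the
  relators; as it depends on the parameter \<open>q\<close>, it is a set of cosets rather than a type.
\<close>

definition qtet_class :: "'a::field \<Rightarrow> 'a qtet_free \<Rightarrow> 'a qtet_free set" where
  "qtet_class q u = {v. v - u \<in> two_sided_ideal (qtet_relators q)}"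

definition qtet_algebra :: "'a::field \<Rightarrow> 'a qtet_free set set" where
  "qtet_algebra q = range (qtet_class q)"

definition qtet_x :: "'a::field \<Rightarrow> 4 \<Rightarrow> 4 \<Rightarrow> 'a qtet_free set" where
  "qtet_x q i j = qtet_class q (xg i j)"


section \<open>The matrices defining the evaluation modules\<close>

definition Zmat :: "nat \<Rightarrow> 'a::field mat" where
  "Zmat d = mat (d + 1) (d + 1) (\<lambda>(i, j). if i + j = d then 1 else 0)"

definition Kmat :: "nat \<Rightarrow> 'a::field \<Rightarrow> 'a mat" where
  "Kmat d q = mat (d + 1) (d + 1) (\<lambda>(i, j). if i = j then q powi (int d - 2 * int i) else 0)"

definition Emat :: "nat \<Rightarrow> 'a::field \<Rightarrow> 'a mat" where
  "Emat d q = mat (d + 1) (d + 1) (\<lambda>(i, j).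
     if i = j then q powi (2 * int j - int d)
     else if i + 1 = j then q powi (int d) - q powi (2 * int j - 2 - int d)
     else 0)"

definition Gmat :: "nat \<Rightarrow> 'a::field \<Rightarrow> 'a \<Rightarrow> 'a mat" where
  "Gmat d q t = mat (d + 1) (d + 1) (\<lambda>(i, j).
     if i = j then q powi (2 * int j - int d)
     else if i + 1 = j then
       (q powi (int d) - q powi (2 * int j - 2 - int d)) * (1 - t * q powi (int d - 2 * int j + 1))
     else 0)"

definition Lmat :: "nat \<Rightarrow> 'a::field \<Rightarrow> 'a \<Rightarrow> 'a mat" where
  "Lmat d q t = mat (d + 1) (d + 1) (\<lambda>(i, j).
     if i = j then q powi (2 * int j - int d)
     else if i + 1 = j then
       (q powi (int d) - q powi (2 * int j - 2 - int d))
         * inverse (1 - t * q powi (int d - 2 * int j + 1))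
     else 0)"

definition Smat :: "nat \<Rightarrow> 'a::field \<Rightarrow> 'a \<Rightarrow> 'a mat" where
  "Smat d q t = mat (d + 1) (d + 1) (\<lambda>(i, j).
     if i + 1 = j then
       (q powi (int d) - q powi (2 * int j - int d - 2)) * (1 - t * q powi (2 * int j - int d - 1))
     else if i = j + 1 then
       (q powi (2 * int i - int d) - q powi (- int d)) * q powi (2 * int i - int d - 1) * t
     else if i = j then
       q powi (int d)
       - (q powi (2 * int i - int d) - q powi (- int d)) * q powi (2 * int i - int d - 1) * t
       - (q powi (int d) - q powi (2 * int i - int d)) * (1 - t * q powi (2 * int i - int d + 1))
     else 0)"


section \<open>Feasible sequences\<close>

definition feasible :: "'a::field \<Rightarrow> 'a \<Rightarrow> 'a \<Rightarrow> 'a \<Rightarrow> nat \<Rightarrow> bool" where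
  "feasible q a b c d \<longleftrightarrow>
     a \<noteq> 0 \<and> b \<noteq> 0 \<and> c \<noteq> 0 \<and> d \<ge> 1
   \<and> {a\<^sup>2, b\<^sup>2} \<inter> {q powi (2 * k) | k. 1 - int d \<le> k \<and> k \<le> int d - 1} = {}
   \<and> {a * b * c, inverse a * b * c, a * inverse b * c, a * b * inverse c}
       \<inter> {q powi (int d + 1 - 2 * int n) | n. 1 \<le> n \<and> n \<le> d} = {}"

text \<open>With parameter \<open>a\<close> this is $\theta_n$; with \<open>b\<close> in its place it is $\theta^*_n$.\<close>

definition theta :: "'a::field \<Rightarrow> nat \<Rightarrow> 'a \<Rightarrow> nat \<Rightarrow> 'a" where
  "theta q d a n = a * q powi (2 * int n - int d) + inverse a * q powi (int d - 2 * int n)"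

definition varphi_seq :: "'a::field \<Rightarrow> 'a \<Rightarrow> 'a \<Rightarrow> 'a \<Rightarrow> nat \<Rightarrow> nat \<Rightarrow> 'a" where
  "varphi_seq q a b c d n =
     inverse a * inverse b * q powi (int d + 1)
     * (q powi (int n) - q powi (- int n))
     * (q powi (int n - int d - 1) - q powi (int d - int n + 1))
     * (q powi (- int n) - a * b * c * q powi (int n - int d - 1))
     * (q powi (- int n) - a * b * inverse c * q powi (int n - int d - 1))"

definition phi_seq :: "'a::field \<Rightarrow> 'a \<Rightarrow> 'a \<Rightarrow> 'a \<Rightarrow> nat \<Rightarrow> nat \<Rightarrow> 'a" where
  "phi_seq q a b c d n =
     a * inverse b * q powi (int d + 1)
     * (q powi (int n) - q powi (- int n))
     * (q powi (int n - int d - 1) - q powi (int d - int n + 1))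
     * (q powi (- int n) - inverse a * b * c * q powi (int n - int d - 1))
     * (q powi (- int n) - inverse a * b * inverse c * q powi (int n - int d - 1))"

definition lower_bidiag :: "nat \<Rightarrow> (nat \<Rightarrow> 'a::field) \<Rightarrow> 'a mat" where
  "lower_bidiag d \<theta> = mat (d + 1) (d + 1) (\<lambda>(i, j).
     if i = j then \<theta> j else if i = j + 1 then 1 else 0)"

definition upper_bidiag :: "nat \<Rightarrow> (nat \<Rightarrow> 'a::field) \<Rightarrow> (nat \<Rightarrow> 'a) \<Rightarrow> 'a mat" where
  "upper_bidiag d \<theta> \<psi> = mat (d + 1) (d + 1) (\<lambda>(i, j).
     if i = j then \<theta> j else if i + 1 = j then \<psi> j else 0)"

definition irred_tridiagonal :: "'a::zero mat \<Rightarrow> bool" where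
  "irred_tridiagonal M \<longleftrightarrow>
     (\<forall>i<dim_row M. \<forall>j<dim_col M.
        (i + 1 < j \<or> j + 1 < i \<longrightarrow> M $$ (i, j) = 0)
      \<and> (i + 1 = j \<or> j + 1 = i \<longrightarrow> M $$ (i, j) \<noteq> 0))"


section \<open>Linear algebra on the underlying vector space\<close>

text \<open>A copy of the library locale, kept separate from its interpretation for real vector spaces.\<close>

locale qtet_space = vector_space scale
  for scale :: "'a::field \<Rightarrow> 'b::ab_group_add \<Rightarrow> 'b" (infixr \<open>*s\<close> 75)
begin

abbreviation endo :: "('b \<Rightarrow> 'b) \<Rightarrow> bool" where
  "endo f \<equiv> Vector_Spaces.linear scale scale f"

definition is_basis :: "nat \<Rightarrow> (nat \<Rightarrow> 'b) \<Rightarrow> bool" where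
  "is_basis d v \<longleftrightarrow> inj_on v {..d} \<and> independent (v ` {..d}) \<and> span (v ` {..d}) = UNIV"

definition represents :: "nat \<Rightarrow> (nat \<Rightarrow> 'b) \<Rightarrow> 'a mat \<Rightarrow> ('b \<Rightarrow> 'b) \<Rightarrow> bool" where
  "represents d v M f \<longleftrightarrow>
     M \<in> carrier_mat (d + 1) (d + 1) \<and> (\<forall>n\<le>d. f (v n) = (\<Sum>i\<le>d. M $$ (i, n) *s v i))"

definition eigenvalues :: "('b \<Rightarrow> 'b) \<Rightarrow> 'a set" where
  "eigenvalues f = {r. \<exists>v. v \<noteq> 0 \<and> f v = r *s v}"

definition eigenspace :: "('b \<Rightarrow> 'b) \<Rightarrow> 'a \<Rightarrow> 'b set" where
  "eigenspace f r = {v. f v = r *s v}"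

definition diagonalizable :: "('b \<Rightarrow> 'b) \<Rightarrow> bool" where
  "diagonalizable f \<longleftrightarrow>
     (\<exists>S. independent S \<and> span S = UNIV \<and> (\<forall>v\<in>S. \<exists>r. f v = r *s v))"


section \<open>Modules for the $q$-tetrahedron algebra\<close>

text \<open>
  A module structure is a unital algebra homomorphism from the quotient algebra to the
  endomorphisms of the space, stated on representatives of cosets. Extensionality pins down the
  irrelevant values outside the algebra, so that uniqueness of module structures makes sense.
\<close>

definition qtet_module :: "'a \<Rightarrow> ('a qtet_free set \<Rightarrow> 'b \<Rightarrow> 'b) \<Rightarrow> bool" where
  "qtet_module q \<rho> \<longleftrightarrow>
     \<rho> \<in> extensional (qtet_algebra q)
   \<and> (\<forall>u. endo (\<rho> (qtet_class q u)))
   \<and> (\<forall>r. \<rho> (qtet_class q (fscal r)) = (\<lambda>x. r *s x))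
   \<and> (\<forall>u v. \<rho> (qtet_class q (u + v)) = (\<lambda>x. \<rho> (qtet_class q u) x + \<rho> (qtet_class q v) x))
   \<and> (\<forall>u v. \<rho> (qtet_class q (u * v)) = \<rho> (qtet_class q u) \<circ> \<rho> (qtet_class q v))"

definition irreducible_module :: "'a \<Rightarrow> ('a qtet_free set \<Rightarrow> 'b \<Rightarrow> 'b) \<Rightarrow> bool" where
  "irreducible_module q \<rho> \<longleftrightarrow>
     (UNIV :: 'b set) \<noteq> {0}
   \<and> (\<forall>W. subspace W \<and> (\<forall>X\<in>qtet_algebra q. \<rho> X ` W \<subseteq> W) \<longrightarrow> W = {0} \<or> W = UNIV)"

definition has_diameter_type ::
    "'a \<Rightarrow> ('a qtet_free set \<Rightarrow> 'b \<Rightarrow> 'b) \<Rightarrow> nat \<Rightarrow> 'a \<Rightarrow> bool" where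
  "has_diameter_type q \<rho> d \<epsilon> \<longleftrightarrow>
     \<epsilon> \<in> {1, -1}
   \<and> (\<forall>i j. j - i = 1 \<or> j - i = 2 \<longrightarrow>
        diagonalizable (\<rho> (qtet_x q i j))
      \<and> eigenvalues (\<rho> (qtet_x q i j)) = {\<epsilon> * q powi (int d - 2 * int n) | n. n \<le> d})"

definition has_shape ::
    "'a \<Rightarrow> ('a qtet_free set \<Rightarrow> 'b \<Rightarrow> 'b) \<Rightarrow> nat \<Rightarrow> (nat \<Rightarrow> nat) \<Rightarrow> bool" where
  "has_shape q \<rho> d s \<longleftrightarrow>
     (\<forall>i j. j - i = 1 \<or> j - i = 2 \<longrightarrow>
        (\<forall>n\<le>d. dim (eigenspace (\<rho> (qtet_x q i j)) (q powi (int d - 2 * int n))) = s n))"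

definition trivial_module :: "'a \<Rightarrow> ('a qtet_free set \<Rightarrow> 'b \<Rightarrow> 'b) \<Rightarrow> bool" where
  "trivial_module q \<rho> \<longleftrightarrow>
     dim (UNIV :: 'b set) = 1
   \<and> (\<forall>i j. j - i = 1 \<or> j - i = 2 \<longrightarrow> \<rho> (qtet_x q i j) = id)"

definition evaluation_module ::
    "'a \<Rightarrow> ('a qtet_free set \<Rightarrow> 'b \<Rightarrow> 'b) \<Rightarrow> nat \<Rightarrow> bool" where
  "evaluation_module q \<rho> d \<longleftrightarrow>
     qtet_module q \<rho>
   \<and> (\<exists>S::'b set. finite S \<and> span S = UNIV)
   \<and> irreducible_module q \<rho>
   \<and> \<not> trivial_module q \<rho>
   \<and> has_diameter_type q \<rho> d 1
   \<and> has_shape q \<rho> d (\<lambda>_. 1)"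

text \<open>
  Being isomorphic to $\mathbf V_d(t)$ amounts to having a basis as follows. The two matrices that
  are inverted are triangular with nonzero diagonal entries.
\<close>

definition isomorphic_to_V ::
    "'a \<Rightarrow> ('a qtet_free set \<Rightarrow> 'b \<Rightarrow> 'b) \<Rightarrow> nat \<Rightarrow> 'a \<Rightarrow> bool" where
  "isomorphic_to_V q \<rho> d t \<longleftrightarrow>
     (\<exists>v. is_basis d v
      \<and> represents d v (Zmat d * Smat d (inverse q) (inverse t) * Zmat d) (\<rho> (qtet_x q 0 1))
      \<and> represents d v (Emat d q) (\<rho> (qtet_x q 1 2))
      \<and> represents d v (Kmat d q) (\<rho> (qtet_x q 2 3))
      \<and> represents d v (Zmat d * Gmat d (inverse q) t * Zmat d) (\<rho> (qtet_x q 3 0))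
      \<and> represents d v (Lmat d q t) (\<rho> (qtet_x q 0 2))
      \<and> represents d v (the (mat_inverse (Zmat d * Emat d (inverse q) * Zmat d)))
          (\<rho> (qtet_x q 1 3))
      \<and> represents d v (the (mat_inverse (Lmat d q t))) (\<rho> (qtet_x q 2 0))
      \<and> represents d v (Zmat d * Emat d (inverse q) * Zmat d) (\<rho> (qtet_x q 3 1)))"

definition t_evaluation_module :: "'a \<Rightarrow> 'a \<Rightarrow> ('a qtet_free set \<Rightarrow> 'b \<Rightarrow> 'b) \<Rightarrow> bool" where
  "t_evaluation_module q t \<rho> \<longleftrightarrow>
     (\<exists>d\<ge>1. evaluation_module q \<rho> d
        \<and> t \<noteq> 0 \<and> t \<notin> {q powi (int d - 2 * int n + 1) | n. 1 \<le> n \<and> n \<le> d}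
        \<and> isomorphic_to_V q \<rho> d t)"


section \<open>Leonard pairs\<close>

definition leonard_pair :: "('b \<Rightarrow> 'b) \<Rightarrow> ('b \<Rightarrow> 'b) \<Rightarrow> bool" where
  "leonard_pair A B \<longleftrightarrow>
     endo A \<and> endo B
   \<and> (\<exists>d.
        (\<exists>v M N. is_basis d v \<and> represents d v M A \<and> diagonal_mat M
                \<and> represents d v N B \<and> irred_tridiagonal N)
      \<and> (\<exists>v M N. is_basis d v \<and> represents d v M A \<and> irred_tridiagonal M
                \<and> represents d v N B \<and> diagonal_mat N))"

text \<open>That is, \<open>A, B\<close> is a Leonard pair of $q$-Racah type and corresponds to \<open>(a, b, c, d)\<close>.\<close>

definition q_racah_leonard_pair ::
    "'a \<Rightarrow> ('b \<Rightarrow> 'b) \<Rightarrow> ('b \<Rightarrow> 'b) \<Rightarrow> 'a \<Rightarrow> 'a \<Rightarrow> 'a \<Rightarrow> nat \<Rightarrow> bool" where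
  "q_racah_leonard_pair q A B a b c d \<longleftrightarrow>
     leonard_pair A B \<and> feasible q a b c d
   \<and> (\<exists>v. is_basis d v
        \<and> represents d v (lower_bidiag d (theta q d a)) A
        \<and> represents d v (upper_bidiag d (theta q d b) (varphi_seq q a b c d)) B)
   \<and> (\<exists>v. is_basis d v
        \<and> represents d v (lower_bidiag d (\<lambda>n. theta q d a (d - n))) A
        \<and> represents d v (upper_bidiag d (theta q d b) (phi_seq q a b c d)) B)"

definition Z3_relation ::
    "'a \<Rightarrow> nat \<Rightarrow> 'a \<Rightarrow> 'a \<Rightarrow> 'a \<Rightarrow> ('b \<Rightarrow> 'b) \<Rightarrow> ('b \<Rightarrow> 'b) \<Rightarrow> ('b \<Rightarrow> 'b) \<Rightarrow> bool" where
  "Z3_relation q d a b c A B C \<longleftrightarrow>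
     (\<forall>x. A x + inverse (q\<^sup>2 - inverse (q\<^sup>2)) *s (q *s B (C x) - inverse q *s C (B x)) =
        (((a + inverse a) * (q powi (int d + 1) + q powi (- int d - 1))
          + (b + inverse b) * (c + inverse c)) / (q + inverse q)) *s x)"

definition Z3_equations ::
    "'a \<Rightarrow> 'a \<Rightarrow> 'a \<Rightarrow> 'a \<Rightarrow> nat \<Rightarrow> ('b \<Rightarrow> 'b) \<Rightarrow> ('b \<Rightarrow> 'b) \<Rightarrow> ('b \<Rightarrow> 'b) \<Rightarrow> bool" where
  "Z3_equations q a b c d A B C \<longleftrightarrow>
     Z3_relation q d a b c A B C \<and> Z3_relation q d b c a B C A \<and> Z3_relation q d c a b C A B"

definition Z3_symmetric_completion ::
    "'a \<Rightarrow> 'a \<Rightarrow> 'a \<Rightarrow> 'a \<Rightarrow> nat \<Rightarrow> ('b \<Rightarrow> 'b) \<Rightarrow> ('b \<Rightarrow> 'b) \<Rightarrow> ('b \<Rightarrow> 'b) \<Rightarrow> bool" where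
  "Z3_symmetric_completion q a b c d A B C \<longleftrightarrow>
     endo C \<and> Z3_equations q a b c d A B C
   \<and> (\<forall>C'. endo C' \<and> Z3_equations q a b c d A B C' \<longrightarrow> C' = C)"

definition dual_Z3_symmetric_completion ::
    "'a \<Rightarrow> 'a \<Rightarrow> 'a \<Rightarrow> 'a \<Rightarrow> nat \<Rightarrow> ('b \<Rightarrow> 'b) \<Rightarrow> ('b \<Rightarrow> 'b) \<Rightarrow> ('b \<Rightarrow> 'b) \<Rightarrow> bool" where
  "dual_Z3_symmetric_completion q a b c d A B C \<longleftrightarrow> Z3_symmetric_completion q b a c d B A C"


definition compatible_evaluation_module ::
    "'a \<Rightarrow> 'a \<Rightarrow> 'a \<Rightarrow> 'a \<Rightarrow> ('b \<Rightarrow> 'b) \<Rightarrow> ('b \<Rightarrow> 'b) \<Rightarrow> ('a qtet_free set \<Rightarrow> 'b \<Rightarrow> 'b) \<Rightarrow> bool" where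
  "compatible_evaluation_module q t a b A B \<rho> \<longleftrightarrow>
     t_evaluation_module q t \<rho>
   \<and> A = \<rho> (qtet_class q (fscal a * xg 0 1 + fscal (inverse a) * xg 1 2))
   \<and> B = \<rho> (qtet_class q (fscal b * xg 2 3 + fscal (inverse b) * xg 3 0))"

end

definition bold_C :: "'a::field \<Rightarrow> 'a \<Rightarrow> 'a \<Rightarrow> 'a \<Rightarrow> 'a qtet_free set" where
  "bold_C q a b c = qtet_class q
     (fscal c * xg 3 0 + fscal (inverse c) * xg 0 1
      + fscal (a * inverse b / (q - inverse q)) * (xg 3 0 * xg 0 1 - xg 0 1 * xg 3 0))"

definition bold_C' :: "'a::field \<Rightarrow> 'a \<Rightarrow> 'a \<Rightarrow> 'a \<Rightarrow> 'a qtet_free set" where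
  "bold_C' q a b c = qtet_class q
     (fscal c * xg 1 2 + fscal (inverse c) * xg 2 3
      + fscal (b * inverse a / (q - inverse q)) * (xg 1 2 * xg 2 3 - xg 2 3 * xg 1 2))"

end

theory Submission
  imports Defs
begin

text \<open>
  The link between the Leonard pair and the algebra is the second split basis of the pair, the one
  in which \<open>A\<close> is lower bidiagonal with entries \<open>\<theta>\<^sub>d, ..., \<theta>\<^sub>0\<close> and \<open>B\<close> is upper bidiagonal with the
  parameters \<open>\<phi>\<^sub>n\<close>. In an evaluation module the eigenvectors \<open>w\<^sub>n\<close> of \<open>x31\<close> form such a basis: \<open>x01\<close> and
  \<open>x12\<close> raise the index of \<open>w\<^sub>n\<close> by at most one, \<open>x23\<close> and \<open>x30\<close> lower it by at most one, and every
  coefficient is a short expression in \<open>q\<close>, \<open>t\<close>, \<open>D = q^d\<close> and \<open>y\<^sub>n = q^(2n - d)\<close>. The diagonals of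
  \<open>a x01 + a^-1 x12\<close> and \<open>b x23 + b^-1 x30\<close> are then the sequences \<open>\<theta>\<close> and \<open>\<theta>*\<close>, and the products of
  opposite off-diagonal entries, which are what is left after rescaling a basis, are equal to the
  \<open>\<phi>\<^sub>n\<close> because \<open>t = a b c^-1\<close>. So the operators can be defined on \<open>V\<close> from the split basis
  of the given pair (\<open>racah_evaluation_system\<close>).

  Existence then amounts to computations with band matrices. Most defining relations are read off on
  the basis \<open>w\<close>. The cubic ones follow from the quadratic ones and two commutator identities
  special to evaluation modules (\<open>q_serreI\<close>). To recognize the module as \<open>V_d(t)\<close>, one passes to the
  eigenbasis \<open>v\<close> of \<open>x23\<close> on which \<open>x31\<close> is bidiagonal in the prescribed way; there all generators have
  the matrices of the definition, and \<open>x02\<close> is bidiagonal, so that \<open>x02\<close> and its inverse \<open>x20\<close> are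
  treated there as well. Bidiagonal operators with distinct diagonal entries have simple spectrum,
  which gives type and shape.

  Uniqueness: two such modules have bases with equal matrices for all generators, so the linear map
  from one basis to the other commutes with \<open>A\<close> and \<open>B\<close>. Only scalars do that
  (\<open>commutant_scalar\<close>), hence the modules coincide (\<open>compatible_unique\<close>).

  For the completions, the last of the three equations expresses \<open>C\<close> through \<open>A\<close> and \<open>B\<close>, which gives
  uniqueness. Expanding the three equations in \<open>a\<close>, \<open>b\<close>, \<open>c\<close> with \<open>t = a b c^-1\<close> splits each of them into
  a few identities between the generators that involve only \<open>q\<close>, \<open>d\<close>, \<open>t\<close>. These say in several
  forms that a Casimir element acts as \<open>q^(d+1) + q^(-d-1)\<close> (the lemmas named \<open>casimir\<close>), and they are
  verified on the basis \<open>w\<close>.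
\<close>

section \<open>Free algebra and linear operators\<close>

lemma free_alg_induct [case_names zero single add]:
  assumes "P 0" and "\<And>w r. P (Poly_Mapping.single w r)" and "\<And>u v. P u \<Longrightarrow> P v \<Longrightarrow> P (u + v)"
  shows "P (u :: ('g, 'a::comm_ring_1) free_alg)"
proof (induction u rule: update_induct)
  case const
  show ?case by (rule assms(1))
next
  case (update f k v)
  have "Poly_Mapping.update k v f = f + Poly_Mapping.single k v"
    using update(1)
    by (intro poly_mapping_eqI) (auto simp: lookup_update lookup_add lookup_single when_def in_keys_iff)
  then show ?case using assms(2,3) update(3) by simp
qed

lemma Z4_exhaust: "(i::4) = 0 \<or> i = 1 \<or> i = 2 \<or> i = 3"
proof (induct i)
  case (of_int z)
  then have "z = 0 \<or> z = 1 \<or> z = 2 \<or> z = 3" by fastforce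
  then show ?case by auto
qed

context qtet_space
begin

lemma endoI:
  assumes "\<And>x y. f (x + y) = f x + f y" and "\<And>r x. f (r *s x) = r *s f x"
  shows "endo f"
  using assms vector_space_axioms by (simp add: Vector_Spaces.linear_iff)

lemma endo_add: "endo f \<Longrightarrow> f (x + y) = f x + f y"
  by (simp add: Vector_Spaces.linear_iff)

lemma endo_scale: "endo f \<Longrightarrow> f (r *s x) = r *s f x"
  by (simp add: Vector_Spaces.linear_iff)

lemma endo_zero: "endo f \<Longrightarrow> f 0 = 0"
  using endo_scale[of f 0 0] by simp

lemma endo_diff: "endo f \<Longrightarrow> f (x - y) = f x - f y"
  using endo_add[of f "x - y" y] by simp

lemma endo_sum: "endo f \<Longrightarrow> f (sum g S) = (\<Sum>x\<in>S. f (g x))"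
  by (induction S rule: infinite_finite_induct) (simp_all add: endo_zero endo_add)

lemma endo_id: "endo id"
  by (rule endoI) simp_all

lemma endo_comp: "endo f \<Longrightarrow> endo g \<Longrightarrow> endo (f \<circ> g)"
  by (rule endoI) (simp_all add: endo_add endo_scale)

lemma endo_comp': "endo f \<Longrightarrow> endo g \<Longrightarrow> endo (\<lambda>x. f (g x))"
  by (rule endoI) (simp_all add: endo_add endo_scale)

lemma endo_plus: "endo f \<Longrightarrow> endo g \<Longrightarrow> endo (\<lambda>x. f x + g x)"
  by (rule endoI) (simp_all add: endo_add endo_scale algebra_simps scale_right_distrib)

lemma endo_minus: "endo f \<Longrightarrow> endo g \<Longrightarrow> endo (\<lambda>x. f x - g x)"
  by (rule endoI) (simp_all add: endo_add endo_scale algebra_simps scale_right_distrib)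

lemma endo_scaled: "endo f \<Longrightarrow> endo (\<lambda>x. r *s f x)"
  by (rule endoI) (simp_all add: endo_add endo_scale scale_right_distrib mult.commute)

lemma endo_scaling: "endo (\<lambda>x. r *s x)"
  by (rule endoI) (simp_all add: scale_right_distrib mult.commute)

lemmas endo_intros = endo_id endo_comp endo_comp' endo_plus endo_minus endo_scaled endo_scaling

section \<open>Modules from operators satisfying the relations\<close>

definition word_act :: "('g \<Rightarrow> 'b \<Rightarrow> 'b) \<Rightarrow> 'g free_monoid \<Rightarrow> 'b \<Rightarrow> 'b" where
  "word_act \<phi> w = foldr (\<lambda>g f. \<phi> g \<circ> f) (letters w) id"

definition free_act :: "('g \<Rightarrow> 'b \<Rightarrow> 'b) \<Rightarrow> ('g, 'a) free_alg \<Rightarrow> 'b \<Rightarrow> 'b" where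
  "free_act \<phi> u x = (\<Sum>w\<in>Poly_Mapping.keys u. Poly_Mapping.lookup u w *s word_act \<phi> w x)"

lemma word_act_zero: "word_act \<phi> 0 = id"
  by (simp add: word_act_def zero_free_monoid_def)

lemma word_act_plus: "word_act \<phi> (v + w) = word_act \<phi> v \<circ> word_act \<phi> w"
proof -
  have "foldr (\<lambda>g f. \<phi> g \<circ> f) xs h = foldr (\<lambda>g f. \<phi> g \<circ> f) xs id \<circ> h" for xs h
    by (induction xs) (auto simp: comp_assoc)
  then show ?thesis
    by (simp add: word_act_def plus_free_monoid_def foldr_append)
qed

lemma endo_word_act:
  assumes "\<And>g. endo (\<phi> g)"
  shows "endo (word_act \<phi> w)"
proof -
  have "endo (foldr (\<lambda>g f. \<phi> g \<circ> f) xs id)" for xs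
    by (induction xs) (auto intro: endo_intros assms simp: endo_id[unfolded id_def])
  then show ?thesis by (simp add: word_act_def)
qed

lemma free_act_single: "free_act \<phi> (Poly_Mapping.single w r) x = r *s word_act \<phi> w x"
  by (simp add: free_act_def)

lemma free_act_add: "free_act \<phi> (u + v) x = free_act \<phi> u x + free_act \<phi> v x"
  unfolding free_act_def
  by (rule setsum_keys_plus_distrib) (simp_all add: scale_left_distrib)

lemma free_act_zero: "free_act \<phi> 0 x = 0"
  by (simp add: free_act_def)

lemma free_act_diff: "free_act \<phi> (u - v) x = free_act \<phi> u x - free_act \<phi> v x"
  using free_act_add[of \<phi> "u - v" v x] by simp

lemma endo_free_act:
  assumes "\<And>g. endo (\<phi> g)"
  shows "endo (free_act \<phi> u)"
  by (rule endoI)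
    (simp_all add: free_act_def endo_add[OF endo_word_act[OF assms]]
      endo_scale[OF endo_word_act[OF assms]] scale_right_distrib sum.distrib scale_sum_right
      mult.commute)

text \<open>
  The action of the free algebra is multiplicative because both sides are additive in each factor and
  agree on words; the induction is first on the left factor and then on the right one.
\<close>

lemma free_act_mult:
  assumes "\<And>g. endo (\<phi> g)"
  shows "free_act \<phi> (u * v) x = free_act \<phi> u (free_act \<phi> v x)"
proof (induction u arbitrary: x rule: free_alg_induct)
  case zero
  show ?case by (simp add: free_act_zero)
next
  case (single w r)
  show ?case
  proof (induction v arbitrary: x rule: free_alg_induct)
    case zero
    show ?case by (simp add: free_act_zero endo_zero[OF endo_free_act[OF assms]])
  next
    case (single w' r')
    show ?case
      by (simp add: mult_single free_act_single word_act_plus endo_scale[OF endo_word_act[OF assms]])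
  next
    case (add v v')
    then show ?case
      by (simp add: distrib_left free_act_add endo_add[OF endo_free_act[OF assms]])
  qed
next
  case (add u u')
  then show ?case by (simp add: distrib_right free_act_add)
qed

lemma free_act_fscal: "free_act \<phi> (fscal r) x = r *s x"
  by (simp add: fscal_def free_act_single word_act_zero)

lemma free_act_one: "free_act \<phi> 1 x = x"
  using free_act_fscal[of \<phi> 1 x] by (simp add: fscal_def)

lemma free_act_fgen: "free_act \<phi> (fgen g) x = \<phi> g x"
  by (simp add: fgen_def free_act_single word_act_def)

text \<open>
  The relations in the form in which they are verified: products of generators are applied to a vector
  and the denominator \<open>q - q^-1\<close> is cleared.
\<close>

definition q_weyl :: "'a \<Rightarrow> ('b \<Rightarrow> 'b) \<Rightarrow> ('b \<Rightarrow> 'b) \<Rightarrow> bool" where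
  "q_weyl q f g \<longleftrightarrow> (\<forall>x. q *s f (g x) - inverse q *s g (f x) = (q - inverse q) *s x)"

definition q_serre :: "'a \<Rightarrow> ('b \<Rightarrow> 'b) \<Rightarrow> ('b \<Rightarrow> 'b) \<Rightarrow> bool" where
  "q_serre q f g \<longleftrightarrow> (\<forall>x. f (f (f (g x))) - qnum q 3 *s f (f (g (f x)))
      + qnum q 3 *s f (g (f (f x))) - g (f (f (f x))) = 0)"

definition qtet_relations :: "'a \<Rightarrow> (4 \<Rightarrow> 4 \<Rightarrow> 'b \<Rightarrow> 'b) \<Rightarrow> bool" where
  "qtet_relations q X \<longleftrightarrow>
     (\<forall>i j x. j - i = 2 \<longrightarrow> X i j (X j i x) = x)
   \<and> (\<forall>i j k. (j - i, k - j) \<in> {(1, 1), (1, 2), (2, 1)} \<longrightarrow> q_weyl q (X i j) (X j k))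
   \<and> (\<forall>i j k l. j - i = 1 \<and> k - j = 1 \<and> l - k = 1 \<longrightarrow> q_serre q (X i j) (X k l))"

lemma mem_qtet_class_iff: "v \<in> qtet_class q u \<longleftrightarrow> v - u \<in> two_sided_ideal (qtet_relators q)"
  by (simp add: qtet_class_def)

text \<open>
  The action of the free algebra kills the relators, hence the two-sided ideal generated by them, and so
  it depends only on the coset. The choice of a representative in the proof is therefore harmless.
\<close>

lemma qtet_module_exists:
  assumes q: "q - inverse q \<noteq> 0"
    and endo: "\<And>i j. endo (X i j)"
    and rel: "qtet_relations q X"
  obtains \<rho> where "qtet_module q \<rho>"
    and "\<And>i j. j - i = 1 \<or> j - i = 2 \<Longrightarrow> \<rho> (qtet_x q i j) = X i j"
proof -
  define \<phi> where "\<phi> g = (case Rep_qtet_gen g of (i, j) \<Rightarrow> X i j)" for g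
  have endo_\<phi>: "endo (\<phi> g)" for g
    using endo by (simp add: \<phi>_def split: prod.split)
  note act_simps = free_act_mult[OF endo_\<phi>] free_act_add free_act_diff free_act_fscal free_act_one
  have act_xg: "free_act \<phi> (xg i j) x = X i j x" if "j - i = 1 \<or> j - i = 2" for i j x
    using that by (simp add: xg_def free_act_fgen \<phi>_def Abs_qtet_gen_inverse)
  have relator: "free_act \<phi> s x = 0" if "s \<in> qtet_relators q" for s x
  proof -
    from that consider
      (inv) i j where "s = xg i j * xg j i - 1" "j - i = 2"
    | (weyl) i j k where "s = fscal (inverse (q - inverse q))
        * (fscal q * xg i j * xg j k - fscal (inverse q) * xg j k * xg i j) - 1"
        "(j - i, k - j) \<in> {(1, 1), (1, 2), (2, 1)}"
    | (serre) i j k l where "s = xg i j ^ 3 * xg k l - fscal (qnum q 3) * xg i j ^ 2 * xg k l * xg i j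
        + fscal (qnum q 3) * xg i j * xg k l * xg i j ^ 2 - xg k l * xg i j ^ 3"
        "j - i = 1 \<and> k - j = 1 \<and> l - k = 1"
      unfolding qtet_relators_def by blast
    then show ?thesis
    proof cases
      case inv
      have "i - j = - (j - i)" by simp
      then have "i - j = 2" using inv(2) by simp
      then show ?thesis
        using inv rel by (simp add: act_simps act_xg qtet_relations_def)
    next
      case weyl
      then have "q_weyl q (X i j) (X j k)"
        using rel unfolding qtet_relations_def by blast
      moreover have "(j - i = 1 \<or> j - i = 2) \<and> (k - j = 1 \<or> k - j = 2)" using weyl(2) by auto
      ultimately show ?thesis
        using q by (simp add: weyl(1) act_simps act_xg q_weyl_def)
    next
      case serre
      then have "q_serre q (X i j) (X k l)"
        using rel unfolding qtet_relations_def by blast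
      then show ?thesis
        using serre by (simp add: act_simps act_xg q_serre_def power3_eq_cube power2_eq_square
            endo_scale[OF endo])
    qed
  qed
  have ideal: "free_act \<phi> s x = 0" if "s \<in> two_sided_ideal (qtet_relators q)" for s x
    using that
    by (induction arbitrary: x rule: two_sided_ideal.induct)
      (simp_all add: free_act_zero act_simps relator endo_zero[OF endo_free_act[OF endo_\<phi>]])
  define \<rho> where "\<rho> = restrict (\<lambda>K. free_act \<phi> (SOME u. u \<in> K)) (qtet_algebra q)"
  have \<rho>: "\<rho> (qtet_class q u) = free_act \<phi> u" for u
  proof -
    have "u \<in> qtet_class q u"
      by (simp add: mem_qtet_class_iff two_sided_ideal.zero)
    then have "(SOME v. v \<in> qtet_class q u) - u \<in> two_sided_ideal (qtet_relators q)"
      by (metis mem_qtet_class_iff someI)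
    then have "free_act \<phi> (SOME v. v \<in> qtet_class q u) = free_act \<phi> u"
      using ideal free_act_diff by (metis eq_iff_diff_eq_0 ext)
    then show ?thesis
      by (simp add: \<rho>_def qtet_algebra_def)
  qed
  have "qtet_module q \<rho>"
    unfolding qtet_module_def \<rho>
    by (auto simp: \<rho>_def act_simps fun_eq_iff intro: endo_free_act[OF endo_\<phi>])
  moreover have "\<rho> (qtet_x q i j) = X i j" if "j - i = 1 \<or> j - i = 2" for i j
    using act_xg[OF that] by (auto simp: qtet_x_def \<rho>)
  ultimately show ?thesis using that by blast
qed

lemma qtet_module_mult: "qtet_module q \<rho> \<Longrightarrow> \<rho> (qtet_class q (u * v)) x = \<rho> (qtet_class q u) (\<rho> (qtet_class q v) x)"
  and qtet_module_add: "qtet_module q \<rho> \<Longrightarrow> \<rho> (qtet_class q (u + v)) x = \<rho> (qtet_class q u) x + \<rho> (qtet_class q v) x"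
  and qtet_module_fscal: "qtet_module q \<rho> \<Longrightarrow> \<rho> (qtet_class q (fscal r)) x = r *s x"
  and qtet_module_endo: "qtet_module q \<rho> \<Longrightarrow> endo (\<rho> (qtet_class q u))"
  by (simp_all add: qtet_module_def)

lemma qtet_module_diff:
  assumes "qtet_module q \<rho>"
  shows "\<rho> (qtet_class q (u - v)) x = \<rho> (qtet_class q u) x - \<rho> (qtet_class q v) x"
  using qtet_module_add[OF assms, of "u - v" v x] by simp

text \<open>
  The generators generate: on cosets of words this is induction on the length, and words span. The values
  outside the algebra agree by extensionality.
\<close>

lemma qtet_module_eqI:
  assumes \<rho>: "qtet_module q \<rho>" and \<rho>': "qtet_module q \<rho>'"
    and gen: "\<And>i j. j - i = 1 \<or> j - i = 2 \<Longrightarrow> \<rho> (qtet_x q i j) = \<rho>' (qtet_x q i j)"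
  shows "\<rho> = \<rho>'"
proof -
  have fgen: "\<rho> (qtet_class q (fgen g)) = \<rho>' (qtet_class q (fgen g))" for g
  proof -
    obtain i j where "Rep_qtet_gen g = (i, j)" by (cases "Rep_qtet_gen g") auto
    then have "g = Abs_qtet_gen (i, j)" and "j - i = 1 \<or> j - i = 2"
      using Rep_qtet_gen[of g] Rep_qtet_gen_inverse[of g] by auto
    then show ?thesis using gen[of j i] by (simp add: qtet_x_def xg_def)
  qed
  have word: "\<rho> (qtet_class q (Poly_Mapping.single (FM l) r)) = \<rho>' (qtet_class q (Poly_Mapping.single (FM l) r))" for l r
  proof (induction l)
    case Nil
    have "Poly_Mapping.single (FM []) r = (fscal r :: 'a qtet_free)"
      by (simp add: fscal_def zero_free_monoid_def)
    then show ?case using \<rho> \<rho>' by (simp add: qtet_module_def)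
  next
    case (Cons g l)
    have "Poly_Mapping.single (FM (g # l)) r = fgen g * (Poly_Mapping.single (FM l) r :: 'a qtet_free)"
      by (simp add: fgen_def mult_single plus_free_monoid_def)
    then show ?case using \<rho> \<rho>' Cons fgen by (simp add: qtet_module_def)
  qed
  have "\<rho> (qtet_class q u) = \<rho>' (qtet_class q u)" for u
  proof (induction u rule: free_alg_induct)
    case zero
    have "\<rho> (qtet_class q (fscal 0)) = \<rho>' (qtet_class q (fscal 0))"
      using \<rho> \<rho>' by (simp add: qtet_module_def)
    then show ?case by (simp add: fscal_def)
  next
    case (single w r)
    show ?case using word[of "letters w" r] by simp
  next
    case (add u v)
    then show ?case using \<rho> \<rho>' by (simp add: qtet_module_def)
  qed
  moreover have "\<rho> \<in> extensional (qtet_algebra q)" "\<rho>' \<in> extensional (qtet_algebra q)"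
    using \<rho> \<rho>' by (simp_all add: qtet_module_def)
  ultimately show ?thesis
    by (intro extensionalityI[of \<rho> "qtet_algebra q"]) (auto simp: qtet_algebra_def)
qed

end

context qtet_space
begin

section \<open>Bases, invariant subspaces and simple spectrum\<close>

lemma basis_expand:
  assumes "is_basis d w"
  obtains c where "x = (\<Sum>n\<le>d. c n *s w n)"
proof -
  have inj: "inj_on w {..d}" and "x \<in> span (w ` {..d})"
    using assms by (auto simp: is_basis_def)
  then obtain u where "x = (\<Sum>v\<in>w ` {..d}. u v *s v)"
    using span_finite[of "w ` {..d}"] by auto
  then have "x = (\<Sum>n\<le>d. u (w n) *s w n)"
    using inj by (simp add: sum.reindex)
  then show ?thesis by (rule that)
qed

lemma endo_eqI:
  assumes "is_basis d w" and f: "endo f" and g: "endo g" and eq: "\<And>n. n \<le> d \<Longrightarrow> f (w n) = g (w n)"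
  shows "f = g"
proof
  fix x
  obtain c where "x = (\<Sum>n\<le>d. c n *s w n)"
    using basis_expand[OF assms(1)] .
  then show "f x = g x"
    using eq by (simp add: endo_sum[OF f] endo_sum[OF g] endo_scale[OF f] endo_scale[OF g])
qed

lemma endo_exists:
  assumes "is_basis d w"
  obtains f where "endo f" and "\<And>n. n \<le> d \<Longrightarrow> f (w n) = y n"
proof -
  interpret vector_space_pair scale scale ..
  have inj: "inj_on w {..d}" and ind: "independent (w ` {..d})"
    using assms by (auto simp: is_basis_def)
  obtain f where "endo f" and "\<forall>x\<in>w ` {..d}. f x = (y \<circ> inv_into {..d} w) x"
    using linear_independent_extend[OF ind] by metis
  then show ?thesis using that[of f] inj by simp
qed

lemma basis_coeff_zero:
  assumes "is_basis d w" and "(\<Sum>n\<le>d. c n *s w n) = 0" and "n \<le> d"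
  shows "c n = 0"
proof -
  have inj: "inj_on w {..d}" and ind: "independent (w ` {..d})"
    using assms by (auto simp: is_basis_def)
  have "(\<Sum>v\<in>w ` {..d}. (c \<circ> inv_into {..d} w) v *s v) = (\<Sum>n\<le>d. c n *s w n)"
    using inj by (simp add: sum.reindex)
  then show ?thesis
    using independentD[OF ind, of "w ` {..d}" "c \<circ> inv_into {..d} w" "w n"] assms(2,3) inj by simp
qed

lemma basis_coeff_eq:
  assumes "is_basis d w" and "(\<Sum>n\<le>d. c n *s w n) = (\<Sum>n\<le>d. c' n *s w n)" and "n \<le> d"
  shows "c n = c' n"
  using basis_coeff_zero[of d w "\<lambda>n. c n - c' n", OF assms(1) _ assms(3)] assms(2)
  by (simp add: scale_left_diff_distrib sum_subtractf)

lemma basis_nonzero: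
  assumes "is_basis d w" and "n \<le> d"
  shows "w n \<noteq> 0"
  using assms dependent_zero[of "w ` {..d}"] by (auto simp: is_basis_def)

lemma basis_dim:
  assumes "is_basis d w"
  shows "dim (UNIV :: 'b set) = d + 1"
  using assms dim_eq_card[of "w ` {..d}" UNIV] by (simp add: is_basis_def card_image)

lemma independent_is_basis:
  assumes "is_basis d w" and inj: "inj_on y {..d}" and ind: "independent (y ` {..d})"
  shows "is_basis d y"
proof -
  have span_w: "span (w ` {..d}) = UNIV" and card: "card (y ` {..d}) = card (w ` {..d})"
    using assms by (auto simp: is_basis_def card_image)
  have "x \<in> span (y ` {..d})" for x
  proof (rule ccontr)
    assume x: "x \<notin> span (y ` {..d})"
    then have "independent (insert x (y ` {..d}))"
      by (rule independent_insertI[OF _ ind])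
    moreover have "x \<notin> y ` {..d}"
      using x span_base by metis
    ultimately have "card (insert x (y ` {..d})) \<le> card (w ` {..d})"
      using independent_span_bound[of "w ` {..d}" "insert x (y ` {..d})"] span_w by simp
    with \<open>x \<notin> y ` {..d}\<close> show False using card by simp
  qed
  then show ?thesis
    using assms by (auto simp: is_basis_def)
qed

lemma is_basis_cong:
  assumes "\<And>n. n \<le> d \<Longrightarrow> v n = v' n"
  shows "is_basis d v \<longleftrightarrow> is_basis d v'"
proof -
  have eq: "v n = v' n" if "n \<in> {..d}" for n using assms that by simp
  have "v ` {..d} = v' ` {..d}" using eq by (rule image_cong[OF refl])
  moreover have "inj_on v {..d} = inj_on v' {..d}" using eq by (rule inj_on_cong)
  ultimately show ?thesis by (simp only: is_basis_def)
qed

lemma is_basis_rev: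
  assumes "is_basis d w"
  shows "is_basis d (\<lambda>n. w (d - n))"
proof -
  have img: "(\<lambda>n. d - n) ` {..d} = {..d}"
  proof
    show "{..d} \<subseteq> (\<lambda>n. d - n) ` {..d}"
    proof
      fix x assume "x \<in> {..d}"
      then have "x = d - (d - x)" "d - x \<in> {..d}" by auto
      then show "x \<in> (\<lambda>n. d - n) ` {..d}" by (rule image_eqI)
    qed
  qed auto
  have "w ` {..d} = (\<lambda>n. w (d - n)) ` {..d}"
    using image_image[of w "\<lambda>n. d - n" "{..d}"] img by simp
  moreover have "inj_on (\<lambda>n. w (d - n)) {..d}"
  proof (rule inj_onI)
    fix m n assume mn: "m \<in> {..d}" "n \<in> {..d}" "w (d - m) = w (d - n)"
    then have "d - m = d - n"
      using assms by (auto simp: is_basis_def dest: inj_onD)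
    then show "m = n" using mn by auto
  qed
  ultimately show ?thesis using assms by (simp add: is_basis_def)
qed

lemma is_basis_scaled:
  assumes "is_basis d w" and s: "\<And>n. n \<le> d \<Longrightarrow> s n \<noteq> 0"
  shows "is_basis d (\<lambda>n. s n *s w n)"
proof (rule independent_is_basis[OF assms(1)])
  have zero: "c n = 0" if "(\<Sum>n\<le>d. c n *s (s n *s w n)) = 0" "n \<le> d" for c n
    using basis_coeff_zero[OF assms(1), of "\<lambda>n. c n * s n" n] that s by simp
  show inj: "inj_on (\<lambda>n. s n *s w n) {..d}"
  proof (rule inj_onI, rule ccontr)
    fix m n assume mn: "m \<in> {..d}" "n \<in> {..d}" "s m *s w m = s n *s w n" "m \<noteq> n"
    have "(\<Sum>k\<le>d. (if k = m then 1 else if k = n then -1 else 0) *s (s k *s w k))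
        = (\<Sum>k\<in>{m, n}. (if k = m then 1 else if k = n then -1 else 0) *s (s k *s w k))"
      using mn by (intro sum.mono_neutral_right) auto
    also have "\<dots> = 0" using mn by simp
    finally show False using zero[of "\<lambda>k. if k = m then 1 else if k = n then -1 else 0" m] mn by simp
  qed
  show "independent ((\<lambda>n. s n *s w n) ` {..d})"
  proof (rule independent_if_scalars_zero)
    fix f x assume f: "(\<Sum>x\<in>(\<lambda>n. s n *s w n) ` {..d}. f x *s x) = 0" "x \<in> (\<lambda>n. s n *s w n) ` {..d}"
    then show "f x = 0"
      using inj zero[of "\<lambda>n. f (s n *s w n)"] by (auto simp: sum.reindex)
  qed simp
qed

text \<open>
  An invariant subspace of a diagonalizable operator with distinct eigenvalues contains the eigencomponents of
  its members: applying the product of all \<open>f - \<mu>\<^sub>i\<close> with \<open>i \<noteq> n\<close> leaves a nonzero multiple of the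
  \<open>n\<close>-th component. Taken with the zero subspace, this is also the independence of eigenvectors.
\<close>

lemma invariant_contains_components:
  fixes d :: nat
  assumes W: "subspace W" and f: "endo f" and fW: "f ` W \<subseteq> W"
    and eig: "\<And>n. n \<le> d \<Longrightarrow> f (y n) = \<mu> n *s y n" and \<mu>: "inj_on \<mu> {..d}"
    and x: "(\<Sum>n\<le>d. c n *s y n) \<in> W" and n: "n \<le> d"
  shows "c n *s y n \<in> W"
proof -
  have step: "(\<Sum>m\<le>d. (c m * (\<Prod>i\<in>S. \<mu> m - \<mu> i)) *s y m) \<in> W" if "finite S" for S
    using that
  proof (induction S rule: finite_induct)
    case empty
    then show ?case using x by simp
  next
    case (insert i S)
    let ?e = "\<lambda>m. c m * (\<Prod>i\<in>S. \<mu> m - \<mu> i)"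
    let ?z = "\<Sum>m\<le>d. ?e m *s y m"
    have "f ?z = (\<Sum>m\<le>d. (?e m * \<mu> m) *s y m)"
      by (simp add: endo_sum[OF f] endo_scale[OF f] eig)
    then have "f ?z - \<mu> i *s ?z = (\<Sum>m\<le>d. (?e m * \<mu> m - \<mu> i * ?e m) *s y m)"
      by (simp add: scale_sum_right sum_subtractf scale_left_diff_distrib)
    also have "\<dots> = (\<Sum>m\<le>d. (c m * (\<Prod>i\<in>insert i S. \<mu> m - \<mu> i)) *s y m)"
    proof (rule sum.cong[OF refl])
      fix m
      have "?e m * \<mu> m - \<mu> i * ?e m = c m * ((\<mu> m - \<mu> i) * (\<Prod>i\<in>S. \<mu> m - \<mu> i))"
        by (simp only: left_diff_distrib right_diff_distrib mult_ac)
      also have "\<dots> = c m * (\<Prod>i\<in>insert i S. \<mu> m - \<mu> i)"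
        by (simp add: insert.hyps)
      finally show "(?e m * \<mu> m - \<mu> i * ?e m) *s y m = (c m * (\<Prod>i\<in>insert i S. \<mu> m - \<mu> i)) *s y m"
        by (rule arg_cong)
    qed
    finally have "f ?z - \<mu> i *s ?z = (\<Sum>m\<le>d. (c m * (\<Prod>i\<in>insert i S. \<mu> m - \<mu> i)) *s y m)" .
    moreover have "f ?z - \<mu> i *s ?z \<in> W"
      using W fW insert.IH by (intro subspace_diff subspace_scale) auto
    ultimately show ?case by simp
  qed
  define P where "P m = (\<Prod>i\<in>{..d} - {n}. \<mu> m - \<mu> i)" for m
  have P0: "P m = 0" if "m \<in> {..d} - {n}" for m
    unfolding P_def by (rule prod_zero) (use that in auto)
  have Pn: "P n \<noteq> 0"
  proof
    assume "P n = 0"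
    then obtain i where "i \<in> {..d} - {n}" "\<mu> n - \<mu> i = 0" by (auto simp: P_def prod_zero_iff)
    then show False using inj_onD[OF \<mu>, of n i] n by auto
  qed
  have "(\<Sum>m\<le>d. (c m * P m) *s y m) = (\<Sum>m\<in>{n}. (c m * P m) *s y m)"
    using P0 n by (intro sum.mono_neutral_right) auto
  then have "(c n * P n) *s y n \<in> W"
    using step[of "{..d} - {n}"] by (simp add: P_def)
  then have "inverse (P n) *s ((c n * P n) *s y n) \<in> W"
    by (rule subspace_scale[OF W])
  moreover have "inverse (P n) * (c n * P n) = c n"
    using Pn by simp
  ultimately show ?thesis by simp
qed

lemma eigenvectors_is_basis:
  assumes w: "is_basis d w" and f: "endo f"
    and eig: "\<And>n. n \<le> d \<Longrightarrow> f (y n) = \<mu> n *s y n" and nz: "\<And>n. n \<le> d \<Longrightarrow> y n \<noteq> 0"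
    and \<mu>: "inj_on \<mu> {..d}"
  shows "is_basis d y"
proof (rule independent_is_basis[OF w])
  show inj: "inj_on y {..d}"
  proof (rule inj_onI)
    fix m n assume "m \<in> {..d}" "n \<in> {..d}" "y m = y n"
    then have "\<mu> m *s y n = \<mu> n *s y n" "n \<le> d" "m \<le> d"
      using eig[of m] eig[of n] by auto
    then show "m = n" using nz \<mu> by (auto simp: inj_on_def)
  qed
  show "independent (y ` {..d})"
  proof (rule independent_if_scalars_zero)
    fix c x assume c: "(\<Sum>x\<in>y ` {..d}. c x *s x) = 0" and "x \<in> y ` {..d}"
    then obtain n where n: "n \<le> d" "x = y n" by auto
    have "f 0 = 0" by (rule endo_zero[OF f])
    moreover have "(\<Sum>n\<le>d. c (y n) *s y n) \<in> {0}"
      using c inj by (simp add: sum.reindex)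
    ultimately have "c (y n) *s y n \<in> {0}"
      using invariant_contains_components[OF subspace_single_0 f, of d y \<mu> "c \<circ> y" n] eig \<mu> n by simp
    then show "c x = 0" using nz n by simp
  qed simp
qed

text \<open>
  The eigenvalues are required to be distinct, so this says that the spectrum of \<open>f\<close> is simple.
\<close>

definition eigenbasis :: "nat \<Rightarrow> ('b \<Rightarrow> 'b) \<Rightarrow> (nat \<Rightarrow> 'a) \<Rightarrow> (nat \<Rightarrow> 'b) \<Rightarrow> bool" where
  "eigenbasis d f \<mu> y \<longleftrightarrow> endo f \<and> is_basis d y \<and> inj_on \<mu> {..d} \<and> (\<forall>n\<le>d. f (y n) = \<mu> n *s y n)"

lemma eigenbasis_diagonalizable: "eigenbasis d f \<mu> y \<Longrightarrow> diagonalizable f"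
  unfolding diagonalizable_def eigenbasis_def is_basis_def by blast

lemma eigenbasis_eigenvector:
  assumes y: "eigenbasis d f \<mu> y" and v: "f v = r *s v" "v \<noteq> 0"
  obtains n k where "n \<le> d" "r = \<mu> n" "v = k *s y n"
proof -
  have f: "endo f" and b: "is_basis d y" and \<mu>: "inj_on \<mu> {..d}"
    and eig: "n \<le> d \<Longrightarrow> f (y n) = \<mu> n *s y n" for n
    using y by (auto simp: eigenbasis_def)
  obtain c where c: "v = (\<Sum>n\<le>d. c n *s y n)"
    using basis_expand[OF b] .
  have "(\<Sum>n\<le>d. (c n * \<mu> n) *s y n) = (\<Sum>n\<le>d. (r * c n) *s y n)"
    using v(1) by (simp add: c endo_sum[OF f] endo_scale[OF f] eig scale_sum_right)
  then have cr: "c n * \<mu> n = r * c n" if "n \<le> d" for n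
    using basis_coeff_eq[OF b _ that, of "\<lambda>n. c n * \<mu> n" "\<lambda>n. r * c n"] by blast
  have "\<exists>n\<le>d. c n \<noteq> 0"
  proof (rule ccontr)
    assume "\<not> ?thesis"
    then have "v = 0" by (simp add: c)
    with v(2) show False by simp
  qed
  then obtain n where n: "n \<le> d" "c n \<noteq> 0" by blast
  then have r: "r = \<mu> n" using cr[of n] by simp
  have "c m = 0" if "m \<le> d" "m \<noteq> n" for m
    using cr[OF that(1)] r n that \<mu> by (auto simp: inj_on_def)
  then have "v = (\<Sum>m\<in>{n}. c m *s y m)"
    unfolding c using n by (intro sum.mono_neutral_right) auto
  then show ?thesis using that[of n "c n"] n r by simp
qed

lemma eigenbasis_eigenvalues:
  assumes y: "eigenbasis d f \<mu> y"
  shows "eigenvalues f = \<mu> ` {..d}"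
proof
  show "eigenvalues f \<subseteq> \<mu> ` {..d}"
    unfolding eigenvalues_def by (auto elim: eigenbasis_eigenvector[OF y])
  show "\<mu> ` {..d} \<subseteq> eigenvalues f"
    using y basis_nonzero by (fastforce simp: eigenbasis_def eigenvalues_def)
qed

lemma eigenbasis_eigenspace:
  assumes y: "eigenbasis d f \<mu> y" and n: "n \<le> d"
  shows "eigenspace f (\<mu> n) = span {y n}"
proof
  show "eigenspace f (\<mu> n) \<subseteq> span {y n}"
  proof
    fix v assume "v \<in> eigenspace f (\<mu> n)"
    then have v: "f v = \<mu> n *s v" by (simp add: eigenspace_def)
    show "v \<in> span {y n}"
    proof (cases "v = 0")
      case False
      then obtain m k where "m \<le> d" "\<mu> n = \<mu> m" "v = k *s y m"
        using eigenbasis_eigenvector[OF y v] by blast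
      then show ?thesis
        using y n by (auto simp: eigenbasis_def inj_on_def intro: span_scale span_base)
    qed (simp add: span_zero)
  qed
  show "span {y n} \<subseteq> eigenspace f (\<mu> n)"
    using y n by (auto simp: eigenbasis_def eigenspace_def span_singleton endo_scale mult.commute)
qed

lemma eigenbasis_dim_eigenspace:
  assumes "eigenbasis d f \<mu> y" and "n \<le> d"
  shows "dim (eigenspace f (\<mu> n)) = 1"
proof -
  have "independent {y n}"
    using assms basis_nonzero[of d y n] by (simp add: eigenbasis_def)
  then show ?thesis
    using assms dim_span_eq_card_independent[of "{y n}"] by (simp add: eigenbasis_eigenspace)
qed

lemma sum_shift_basis:
  fixes W :: "nat \<Rightarrow> 'b"
  assumes "W (Suc d) = 0"
  shows "(\<Sum>k\<le>d. e k *s W (Suc k)) = (\<Sum>k\<le>d. (case k of 0 \<Rightarrow> 0 | Suc j \<Rightarrow> e j) *s W k)"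
  using sum.atMost_Suc_shift[of "\<lambda>k. (case k of 0 \<Rightarrow> 0 | Suc j \<Rightarrow> e j) *s W k" d] assms by simp

text \<open>
  A bidiagonal operator with distinct diagonal entries \<open>\<mu>\<^sub>n\<close> has an eigenbasis. Solving for an eigenvector
  with eigenvalue \<open>\<mu>\<^sub>n\<close> from the index \<open>n\<close> upwards divides successively by \<open>\<mu>\<^sub>n - \<mu>\<^sub>k\<close> for \<open>k > n\<close>.
  The convention \<open>W (Suc d) = 0\<close> makes the formula for the action uniform in \<open>n\<close>.
\<close>

lemma bidiagonal_eigenbasis:
  assumes W: "is_basis d W" and W0: "W (Suc d) = 0" and f: "endo f" and \<mu>: "inj_on \<mu> {..d}"
    and fW: "\<And>n. n \<le> d \<Longrightarrow> f (W n) = \<mu> n *s W n + r n *s W (Suc n)"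
  obtains y where "eigenbasis d f \<mu> y"
proof -
  define e where "e n k = (if k < n then 0 else \<Prod>j=n..<k. r j * inverse (\<mu> n - \<mu> (Suc j)))" for n k
  define y where "y n = (\<Sum>k\<le>d. e n k *s W k)" for n
  have eig: "f (y n) = \<mu> n *s y n" if n: "n \<le> d" for n
  proof -
    have "f (y n) = (\<Sum>k\<le>d. (e n k * \<mu> k) *s W k) + (\<Sum>k\<le>d. (e n k * r k) *s W (Suc k))"
      by (simp add: y_def endo_sum[OF f] endo_scale[OF f] fW scale_right_distrib sum.distrib)
    also have "\<dots> = (\<Sum>k\<le>d. (e n k * \<mu> k + (case k of 0 \<Rightarrow> 0 | Suc j \<Rightarrow> e n j * r j)) *s W k)"
      by (simp add: sum_shift_basis[where W = W, OF W0] scale_left_distrib sum.distrib)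
    also have "\<dots> = (\<Sum>k\<le>d. (\<mu> n * e n k) *s W k)"
    proof (rule sum.cong[OF refl])
      fix k assume k: "k \<in> {..d}"
      have "e n k * \<mu> k + (case k of 0 \<Rightarrow> 0 | Suc j \<Rightarrow> e n j * r j) = \<mu> n * e n k"
      proof (cases k)
        case 0
        then show ?thesis by (simp add: e_def)
      next
        case (Suc j)
        show ?thesis
        proof (cases "n \<le> j")
          case True
          then have "\<mu> n - \<mu> (Suc j) \<noteq> 0"
            using inj_onD[OF \<mu>, of n "Suc j"] n k Suc by auto
          moreover have "e n (Suc j) = e n j * (r j * inverse (\<mu> n - \<mu> (Suc j)))"
            using True by (simp add: e_def)
          ultimately show ?thesis by (simp add: Suc field_simps)
        next
          case False
          then show ?thesis by (cases "n = Suc j") (auto simp: e_def Suc)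
        qed
      qed
      then show "(e n k * \<mu> k + (case k of 0 \<Rightarrow> 0 | Suc j \<Rightarrow> e n j * r j)) *s W k = (\<mu> n * e n k) *s W k"
        by simp
    qed
    finally show ?thesis by (simp add: y_def scale_sum_right)
  qed
  have "y n \<noteq> 0" if n: "n \<le> d" for n
    using basis_coeff_zero[OF W, of "e n" n] n by (auto simp: y_def e_def)
  then have "eigenbasis d f \<mu> y"
    using eigenvectors_is_basis[OF W f eig _ \<mu>] eig f \<mu> by (simp add: eigenbasis_def)
  then show ?thesis by (rule that)
qed

end

context qtet_space
begin

section \<open>Operators with a band matrix\<close>

text \<open>
  Basis vectors are indexed by integers and vanish outside \<open>0, ..., d\<close>. Coefficient formulas
  for neighbouring vectors then need no case distinction at the two ends.
\<close>

definition int_basis :: "nat \<Rightarrow> (int \<Rightarrow> 'b) \<Rightarrow> bool" where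
  "int_basis d w \<longleftrightarrow> is_basis d (\<lambda>n. w (int n)) \<and> (\<forall>k. k < 0 \<or> int d < k \<longrightarrow> w k = 0)"

lemma int_basis_rev:
  assumes "int_basis d u"
  shows "is_basis d (\<lambda>n. u (int d - int n))"
proof -
  have "is_basis d (\<lambda>n. u (int (d - n)))"
    using is_basis_rev[of d "\<lambda>n. u (int n)"] assms by (simp add: int_basis_def)
  moreover have "is_basis d (\<lambda>n. u (int (d - n))) \<longleftrightarrow> is_basis d (\<lambda>n. u (int d - int n))"
    by (rule is_basis_cong) (simp add: of_nat_diff)
  ultimately show ?thesis by blast
qed

lemma int_basis_eqI:
  assumes ib: "int_basis d w" and "endo f" "endo g"
    and eq: "\<And>n. 0 \<le> n \<Longrightarrow> n \<le> int d \<Longrightarrow> f (w n) = g (w n)"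
  shows "f = g"
  using endo_eqI[of d "\<lambda>n. w (int n)" f g] assms by (simp add: int_basis_def)

text \<open>
  The matrix of \<open>f\<close> is supported on five diagonals, given as functions of the column. The formula is
  required at all integers, also where the basis vector is zero; this makes the composition rule
  \<open>band_comp\<close> unconditional, and forces boundary coefficients such as \<open>r (-1)\<close> to vanish.
\<close>

definition penta :: "(int \<Rightarrow> 'b) \<Rightarrow> ('b \<Rightarrow> 'b) \<Rightarrow> (int \<Rightarrow> 'a) \<Rightarrow> (int \<Rightarrow> 'a) \<Rightarrow> (int \<Rightarrow> 'a) \<Rightarrow> (int \<Rightarrow> 'a) \<Rightarrow> (int \<Rightarrow> 'a) \<Rightarrow> bool" where
  "penta w f l2 l m r r2 \<longleftrightarrow> endo f \<and> (\<forall>n. f (w n) =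
     l2 n *s w (n - 2) + l n *s w (n - 1) + m n *s w n + r n *s w (n + 1) + r2 n *s w (n + 2))"

abbreviation band :: "(int \<Rightarrow> 'b) \<Rightarrow> ('b \<Rightarrow> 'b) \<Rightarrow> (int \<Rightarrow> 'a) \<Rightarrow> (int \<Rightarrow> 'a) \<Rightarrow> (int \<Rightarrow> 'a) \<Rightarrow> bool" where
  "band w f l m r \<equiv> penta w f (\<lambda>_. 0) l m r (\<lambda>_. 0)"

lemma penta_endo: "penta w f l2 l m r r2 \<Longrightarrow> endo f"
  by (simp add: penta_def)

lemma band_apply: "band w f l m r \<Longrightarrow> f (w n) = l n *s w (n - 1) + m n *s w n + r n *s w (n + 1)"
  by (simp add: penta_def)

lemma band_id: "band w (\<lambda>x. x) (\<lambda>_. 0) (\<lambda>_. 1) (\<lambda>_. 0)"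
  using endo_id by (simp add: penta_def id_def)

lemma penta_scale:
  "penta w f l2 l m r r2 \<Longrightarrow> penta w (\<lambda>x. k *s f x) (\<lambda>n. k * l2 n) (\<lambda>n. k * l n) (\<lambda>n. k * m n) (\<lambda>n. k * r n) (\<lambda>n. k * r2 n)"
  by (simp add: penta_def endo_scaled scale_right_distrib)

lemma penta_add:
  assumes "penta w f l2 l m r r2" and "penta w g l2' l' m' r' r2'"
  shows "penta w (\<lambda>x. f x + g x) (\<lambda>n. l2 n + l2' n) (\<lambda>n. l n + l' n) (\<lambda>n. m n + m' n) (\<lambda>n. r n + r' n) (\<lambda>n. r2 n + r2' n)"
  using assms by (simp add: penta_def endo_plus scale_left_distrib add_ac)

lemma penta_diff:
  assumes "penta w f l2 l m r r2" and "penta w g l2' l' m' r' r2'"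
  shows "penta w (\<lambda>x. f x - g x) (\<lambda>n. l2 n - l2' n) (\<lambda>n. l n - l' n) (\<lambda>n. m n - m' n) (\<lambda>n. r n - r' n) (\<lambda>n. r2 n - r2' n)"
  using assms by (simp add: penta_def endo_minus scale_left_diff_distrib)

lemma band_comp:
  assumes f: "band w f fl fm fr" and g: "band w g gl gm gr"
  shows "penta w (\<lambda>x. f (g x))
    (\<lambda>n. gl n * fl (n - 1))
    (\<lambda>n. gl n * fm (n - 1) + gm n * fl n)
    (\<lambda>n. gl n * fr (n - 1) + gm n * fm n + gr n * fl (n + 1))
    (\<lambda>n. gm n * fr n + gr n * fm (n + 1))
    (\<lambda>n. gr n * fr (n + 1))"
proof -
  have ef: "endo f" and eg: "endo g" using f g penta_endo by auto
  show ?thesis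
    by (simp add: penta_def endo_comp'[OF ef eg] band_apply[OF f] band_apply[OF g]
        endo_add[OF ef] endo_scale[OF ef] scale_right_distrib scale_left_distrib add_ac)
qed

text \<open>
  Coefficients are compared only where the corresponding basis vectors are nonzero. This matters for \<open>x02\<close>,
  whose coefficients have denominators that may vanish outside the range.
\<close>

lemma penta_eqI:
  assumes ib: "int_basis d w" and f: "penta w f l2 l m r r2" and g: "penta w g l2' l' m' r' r2'"
    and "\<And>n. 2 \<le> n \<Longrightarrow> n \<le> int d \<Longrightarrow> l2 n = l2' n"
    and "\<And>n. 1 \<le> n \<Longrightarrow> n \<le> int d \<Longrightarrow> l n = l' n"
    and "\<And>n. 0 \<le> n \<Longrightarrow> n \<le> int d \<Longrightarrow> m n = m' n"
    and "\<And>n. 0 \<le> n \<Longrightarrow> n \<le> int d - 1 \<Longrightarrow> r n = r' n"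
    and "\<And>n. 0 \<le> n \<Longrightarrow> n \<le> int d - 2 \<Longrightarrow> r2 n = r2' n"
  shows "f = g"
proof (rule int_basis_eqI[OF ib])
  fix n assume n: "0 \<le> n" "n \<le> int d"
  have w0: "w k = 0" if "k < 0 \<or> int d < k" for k
    using ib that by (auto simp: int_basis_def)
  have "l2 n *s w (n - 2) = l2' n *s w (n - 2)"
    using assms(4)[of n] w0[of "n - 2"] n by (cases "2 \<le> n") auto
  moreover have "l n *s w (n - 1) = l' n *s w (n - 1)"
    using assms(5)[of n] w0[of "n - 1"] n by (cases "1 \<le> n") auto
  moreover have "m n *s w n = m' n *s w n"
    using assms(6)[of n] n by simp
  moreover have "r n *s w (n + 1) = r' n *s w (n + 1)"
    using assms(7)[of n] w0[of "n + 1"] n by (cases "n \<le> int d - 1") auto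
  moreover have "r2 n *s w (n + 2) = r2' n *s w (n + 2)"
    using assms(8)[of n] w0[of "n + 2"] n by (cases "n \<le> int d - 2") auto
  ultimately show "f (w n) = g (w n)"
    using f g unfolding penta_def by metis
qed (use f g penta_endo in auto)

lemma penta_cong:
  assumes "penta w f l2 l m r r2"
    and "\<And>n. l2 n = l2' n" "\<And>n. l n = l' n" "\<And>n. m n = m' n" "\<And>n. r n = r' n" "\<And>n. r2 n = r2' n"
  shows "penta w f l2' l' m' r' r2'"
  using assms by (simp add: penta_def)

lemma band_exists:
  assumes ib: "int_basis d w" and "l (int d + 1) = 0" and "r (-1) = 0"
  obtains f where "band w f l m r"
proof -
  have w0: "w k = 0" if "k < 0 \<or> int d < k" for k
    using ib that by (auto simp: int_basis_def)
  have "is_basis d (\<lambda>n. w (int n))" using ib by (simp add: int_basis_def)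
  then obtain f where f: "endo f"
    and fw: "\<And>n. n \<le> d \<Longrightarrow> f (w (int n)) = l (int n) *s w (int n - 1) + m (int n) *s w (int n) + r (int n) *s w (int n + 1)"
    using endo_exists[of d "\<lambda>n. w (int n)" "\<lambda>n. l (int n) *s w (int n - 1) + m (int n) *s w (int n) + r (int n) *s w (int n + 1)"]
    by auto
  have "f (w n) = l n *s w (n - 1) + m n *s w n + r n *s w (n + 1)" for n
  proof (cases "0 \<le> n \<and> n \<le> int d")
    case True
    then have "nat n \<le> d" by linarith
    with True show ?thesis using fw[of "nat n"] by simp
  next
    case False
    then consider "n = -1" | "n = int d + 1" | "n < -1" | "n > int d + 1" by linarith
    then show ?thesis
      by cases (simp_all add: w0 endo_zero[OF f] assms(2,3))
  qed
  then have "band w f l m r" using f by (simp add: penta_def)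
  then show ?thesis by (rule that)
qed

lemma lower_band_eigenbasis:
  assumes u: "int_basis d u" and f: "band u f (\<lambda>_. 0) m r" and inj: "inj_on (\<lambda>n. m (int n)) {..d}"
  obtains z where "eigenbasis d f (\<lambda>n. m (int n)) z"
proof (rule bidiagonal_eigenbasis[of d "\<lambda>n. u (int n)" f "\<lambda>n. m (int n)" "\<lambda>n. r (int n)"])
  show "is_basis d (\<lambda>n. u (int n))" "u (int (Suc d)) = 0"
    using u by (simp_all add: int_basis_def)
  show "f (u (int n)) = m (int n) *s u (int n) + r (int n) *s u (int (Suc n))" for n
    using band_apply[OF f, of "int n"] by (simp add: add.commute)
qed (use penta_endo[OF f] inj that in auto)

lemma upper_band_eigenbasis:
  assumes u: "int_basis d u" and f: "band u f l m (\<lambda>_. 0)" and inj: "inj_on (\<lambda>n. m (int d - int n)) {..d}"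
  obtains z where "eigenbasis d f (\<lambda>n. m (int d - int n)) z"
proof (rule bidiagonal_eigenbasis[of d "\<lambda>n. u (int d - int n)" f "\<lambda>n. m (int d - int n)" "\<lambda>n. l (int d - int n)"])
  show "is_basis d (\<lambda>n. u (int d - int n))" by (rule int_basis_rev[OF u])
  show "u (int d - int (Suc d)) = 0" using u by (simp add: int_basis_def)
  show "f (u (int d - int n)) = m (int d - int n) *s u (int d - int n) + l (int d - int n) *s u (int d - int (Suc n))" for n
    using band_apply[OF f, of "int d - int n"] by (simp add: algebra_simps)
qed (use penta_endo[OF f] inj that in auto)

end

section \<open>The generators on an eigenbasis of x31\<close>

text \<open>
  The eigenvalues of the generators, in increasing powers of \<open>q\<close>.
\<close>

definition qy :: "'a::field \<Rightarrow> nat \<Rightarrow> int \<Rightarrow> 'a" where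
  "qy q d n = q powi (2 * n - int d)"

lemma qy_succ: "q \<noteq> 0 \<Longrightarrow> qy q d (n + 1) = q^2 * qy q d n"
  and qy_pred: "q \<noteq> 0 \<Longrightarrow> qy q d (n - 1) = qy q d n / q^2"
  and qy_nonzero: "q \<noteq> 0 \<Longrightarrow> qy q d n \<noteq> 0"
proof -
  assume q: "q \<noteq> 0"
  have "2 * (n + 1) - int d = (2 * n - int d) + 2" "2 * (n - 1) - int d = (2 * n - int d) - 2" by auto
  then show "qy q d (n + 1) = q^2 * qy q d n" "qy q d (n - 1) = qy q d n / q^2" "qy q d n \<noteq> 0"
    using q by (simp_all add: qy_def power_int_add power_int_diff)
qed

text \<open>
  The action of six of the eight generators on the eigenbasis \<open>w\<close> of \<open>x31\<close> in an evaluation module. The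
  scaling of \<open>w\<close> is chosen such that every off-diagonal coefficient vanishes by itself where it would
  lead from outside the range into the basis.
\<close>

locale split_system = qtet_space scale
  for scale :: "'a::field \<Rightarrow> 'b::ab_group_add \<Rightarrow> 'b" (infixr \<open>*s\<close> 75) +
  fixes q t :: 'a and d :: nat and w :: "int \<Rightarrow> 'b" and x01 x12 x23 x30 x31 x13 :: "'b \<Rightarrow> 'b"
  assumes ib: "int_basis d w" and q0: "q \<noteq> 0" and q_nonroot: "\<And>n::nat. n \<ge> 1 \<Longrightarrow> q ^ n \<noteq> 1"
    and t0: "t \<noteq> 0" and d1: "d \<ge> 1"
    and x01: "band w x01 (\<lambda>_. 0) (\<lambda>n. 1 / qy q d n) (\<lambda>n. 1 - 1 / (q^2 * q powi int d * qy q d n))"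
    and x12: "band w x12 (\<lambda>_. 0) (\<lambda>n. qy q d n) (\<lambda>n. t * (1 - q^2 * q powi int d * qy q d n) / (q * q powi int d))"
    and x23: "band w x23 (\<lambda>n. q * q powi int d * (1 - qy q d n / (q^2 * q powi int d)) / t) (\<lambda>n. qy q d n) (\<lambda>_. 0)"
    and x30: "band w x30 (\<lambda>n. 1 - q^2 * q powi int d / qy q d n) (\<lambda>n. 1 / qy q d n) (\<lambda>_. 0)"
    and x31: "band w x31 (\<lambda>_. 0) (\<lambda>n. 1 / qy q d n) (\<lambda>_. 0)"
    and x13: "band w x13 (\<lambda>_. 0) (\<lambda>n. qy q d n) (\<lambda>_. 0)"
begin

abbreviation y :: "int \<Rightarrow> 'a" where "y \<equiv> qy q d"
abbreviation D :: "'a" where "D \<equiv> q powi int d"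

lemma y0: "y n \<noteq> 0" and D0: "D \<noteq> 0"
  and y_succ: "y (n + 1) = q^2 * y n" and y_pred: "y (n - 1) = y n / q^2"
  using q0 by (simp_all add: qy_succ qy_pred qy_nonzero)

lemma y_pred2: "y (n - 2) = y n / q^4" and y_succ2: "y (n + 2) = q^4 * y n"
  using y_pred[of "n - 1"] y_pred[of n] y_succ[of "n + 1"] y_succ[of n]
  by (simp_all add: algebra_simps)

lemmas y_simps = y_succ y_pred y_succ2 y_pred2
lemmas nz = q0 t0 D0 y0

lemma q_weylI:
  assumes f: "band v f fl fm fr" and g: "band v g gl gm gr" and v: "int_basis d v"
    and "\<And>n. 2 \<le> n \<Longrightarrow> n \<le> int d \<Longrightarrow> q * (gl n * fl (n - 1)) = inverse q * (fl n * gl (n - 1))"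
    and "\<And>n. 1 \<le> n \<Longrightarrow> n \<le> int d \<Longrightarrow>
       q * (gl n * fm (n - 1) + gm n * fl n) = inverse q * (fl n * gm (n - 1) + fm n * gl n)"
    and "\<And>n. 0 \<le> n \<Longrightarrow> n \<le> int d \<Longrightarrow>
       q * (gl n * fr (n - 1) + gm n * fm n + gr n * fl (n + 1))
         - inverse q * (fl n * gr (n - 1) + fm n * gm n + fr n * gl (n + 1)) = q - inverse q"
    and "\<And>n. 0 \<le> n \<Longrightarrow> n \<le> int d - 1 \<Longrightarrow>
       q * (gm n * fr n + gr n * fm (n + 1)) = inverse q * (fm n * gr n + fr n * gm (n + 1))"
    and "\<And>n. 0 \<le> n \<Longrightarrow> n \<le> int d - 2 \<Longrightarrow> q * (gr n * fr (n + 1)) = inverse q * (fr n * gr (n + 1))"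
  shows "q_weyl q f g"
proof -
  have "(\<lambda>x. q *s f (g x) - inverse q *s g (f x)) = (\<lambda>x. (q - inverse q) *s x)"
    by (rule penta_eqI[OF v penta_diff[OF penta_scale[OF band_comp[OF f g]] penta_scale[OF band_comp[OF g f]]]
          penta_scale[OF band_id]]) (use assms(4-) in auto)
  then show ?thesis by (simp add: q_weyl_def fun_eq_iff)
qed

lemma weyl_01_12: "q_weyl q x01 x12"
  by (rule q_weylI[OF x01 x12 ib]; simp add: y_simps nz field_simps eval_nat_numeral)
lemma weyl_12_23: "q_weyl q x12 x23"
  by (rule q_weylI[OF x12 x23 ib]; simp add: y_simps nz field_simps eval_nat_numeral)
lemma weyl_23_30: "q_weyl q x23 x30"
  by (rule q_weylI[OF x23 x30 ib]; simp add: y_simps nz field_simps eval_nat_numeral)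
lemma weyl_30_01: "q_weyl q x30 x01"
  by (rule q_weylI[OF x30 x01 ib]; simp add: y_simps nz field_simps eval_nat_numeral)
lemma weyl_23_31: "q_weyl q x23 x31"
  by (rule q_weylI[OF x23 x31 ib]; simp add: y_simps nz field_simps eval_nat_numeral)
lemma weyl_31_12: "q_weyl q x31 x12"
  by (rule q_weylI[OF x31 x12 ib]; simp add: y_simps nz field_simps eval_nat_numeral)
lemma weyl_01_13: "q_weyl q x01 x13"
  by (rule q_weylI[OF x01 x13 ib]; simp add: y_simps nz field_simps eval_nat_numeral)
lemma weyl_13_30: "q_weyl q x13 x30"
  by (rule q_weylI[OF x13 x30 ib]; simp add: y_simps nz field_simps eval_nat_numeral)

lemma x13_x31: "x13 (x31 x) = x"
proof -
  have "(\<lambda>x. x13 (x31 x)) = (\<lambda>x. x)"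
    by (rule penta_eqI[OF ib band_comp[OF x13 x31] band_id]) (simp_all add: nz)
  then show ?thesis by (simp add: fun_eq_iff)
qed

lemma x31_x13: "x31 (x13 x) = x"
proof -
  have "(\<lambda>x. x31 (x13 x)) = (\<lambda>x. x)"
    by (rule penta_eqI[OF ib band_comp[OF x31 x13] band_id]) (simp_all add: nz)
  then show ?thesis by (simp add: fun_eq_iff)
qed

text \<open>
  This identity and the next one are special to evaluation modules: the commutator of two
  opposite generators is a combination of the other two. They define the parameter \<open>t\<close> without a basis.
\<close>

lemma evaluation_30_12: "x30 (x12 x) - x12 (x30 x) = (t * (q - inverse q)) *s (x01 x - x23 x)"
proof -
  have "(\<lambda>x. x30 (x12 x) - x12 (x30 x)) = (\<lambda>x. (t * (q - inverse q)) *s (x01 x - x23 x))"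
    by (rule penta_eqI[OF ib penta_diff[OF band_comp[OF x30 x12] band_comp[OF x12 x30]]
          penta_scale[OF penta_diff[OF x01 x23]]]; simp add: y_simps nz field_simps eval_nat_numeral)
  then show ?thesis by (simp add: fun_eq_iff)
qed

lemma evaluation_01_23: "x01 (x23 x) - x23 (x01 x) = (inverse t * (q - inverse q)) *s (x12 x - x30 x)"
proof -
  have "(\<lambda>x. x01 (x23 x) - x23 (x01 x)) = (\<lambda>x. (inverse t * (q - inverse q)) *s (x12 x - x30 x))"
    by (rule penta_eqI[OF ib penta_diff[OF band_comp[OF x01 x23] band_comp[OF x23 x01]]
          penta_scale[OF penta_diff[OF x12 x30]]]; simp add: y_simps nz field_simps eval_nat_numeral)
  then show ?thesis by (simp add: fun_eq_iff)
qed

text \<open>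
  This moves \<open>x30\<close> to the basis \<open>v\<close> below, where \<open>x31\<close> and \<open>x23\<close> are known.
\<close>

lemma x30_via_x31: "x30 x = x31 x - (t / q) *s (x31 (x23 x) - x)"
proof -
  have "x30 = (\<lambda>x. x31 x - (t / q) *s (x31 (x23 x) - x))"
    by (rule penta_eqI[OF ib x30 penta_diff[OF x31 penta_scale[OF penta_diff[OF band_comp[OF x31 x23] band_id]]]];
      simp add: y_simps nz field_simps eval_nat_numeral)
  then show ?thesis by (simp add: fun_eq_iff)
qed

end

context qtet_space
begin

section \<open>The cubic relations\<close>

lemma q_weyl_swap:
  assumes q: "q \<noteq> 0" and fg: "q_weyl q f g"
  shows "f (g x) = (1 - inverse (q^2)) *s x + inverse (q^2) *s g (f x)"
proof -
  have "q *s f (g x) = (q - inverse q) *s x + inverse q *s g (f x)"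
    using fg by (simp add: q_weyl_def diff_eq_eq)
  then have "inverse q *s (q *s f (g x)) = (inverse q * (q - inverse q)) *s x + (inverse q * inverse q) *s g (f x)"
    by (simp add: scale_right_distrib)
  then show ?thesis using q by (simp add: power2_eq_square right_diff_distrib)
qed

text \<open>
  For left and right multiplication by \<open>f\<close>, the operator \<open>(left - q^2 right) (left - q^-2 right)\<close> takes \<open>g\<close> to a
  multiple of \<open>f\<close> that depends neither on \<open>g\<close> nor on the order in which the \<open>q\<close>-Weyl relation holds.
\<close>

lemma q_weyl_cubic:
  assumes q: "q \<noteq> 0" and f: "endo f" and g: "endo g" and fg: "q_weyl q f g \<or> q_weyl q g f"
  shows "f (f (g u)) - (q^2 + inverse (q^2)) *s f (g (f u)) + g (f (f u)) = (- ((q - inverse q)^2)) *s f u"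
proof -
  define \<alpha> \<beta> where ab: "\<alpha> = 1 - inverse (q^2)" "\<beta> = inverse (q^2)"
  have c1: "\<alpha> + \<beta> * \<alpha> - (q^2 + inverse (q^2)) * \<alpha> = - ((q - inverse q)^2)"
    and c2: "\<beta> * \<beta> - (q^2 + inverse (q^2)) * \<beta> + 1 = 0"
    using q by (simp_all add: ab field_simps eval_nat_numeral)
  have *: "a - (q^2 + inverse (q^2)) *s c + d = (- ((q - inverse q)^2)) *s Q"
    if "c = \<alpha> *s Q + \<beta> *s P" "{a, d} = {P, \<alpha> *s Q + \<beta> *s c}" for a c d P Q
  proof -
    have "a + d = P + (\<alpha> *s Q + \<beta> *s c)" using that(2) by (auto simp: doubleton_eq_iff)
    then have "a - s *s c + d = (\<alpha> + \<beta> * \<alpha> - s * \<alpha>) *s Q + (\<beta> * \<beta> - s * \<beta> + 1) *s P" for s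
      by (simp add: that(1) algebra_simps)
    then show ?thesis using c1 c2 by (simp only: scale_zero_left add_0_right)
  qed
  from fg show ?thesis
  proof
    assume "q_weyl q f g"
    note s = q_weyl_swap[OF q this, folded ab]
    have "f (f (g u)) = \<alpha> *s f u + \<beta> *s f (g (f u))" by (simp add: s[of u] endo_add[OF f] endo_scale[OF f])
    then show ?thesis
      using *[OF s[of "f u"], of "f (f (g u))" "g (f (f u))"] by (simp add: insert_commute)
  next
    assume "q_weyl q g f"
    note s = q_weyl_swap[OF q this, folded ab]
    have "f (g (f u)) = \<alpha> *s f u + \<beta> *s f (f (g u))" by (simp add: s[of u] endo_add[OF f] endo_scale[OF f])
    then show ?thesis
      using *[of "f (g (f u))" "f u" "f (f (g u))" "f (f (g u))" "g (f (f u))"] s[of "f u"] by simp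
  qed
qed

text \<open>
  The cubic expression is \<open>(left - right) (left - q^2 right) (left - q^-2 right)\<close> applied to \<open>h\<close>. The first
  factor gives a multiple of \<open>g - g'\<close>, on which the other two vanish by \<open>q_weyl_cubic\<close>.
\<close>

lemma q_serreI:
  assumes q: "q \<noteq> 0" "q - inverse q \<noteq> 0"
    and f: "endo f" and g: "endo g" and g': "endo g'"
    and w: "q_weyl q f g" "q_weyl q g' f"
    and h: "\<And>x. f (h x) - h (f x) = k *s (g x - g' x)"
  shows "q_serre q f h"
proof -
  define s where "s = q^2 + inverse (q^2)"
  have q3: "qnum q 3 = s + 1"
    using q unfolding qnum_def s_def
    by (simp add: power_int_minus divide_eq_eq field_simps eval_nat_numeral)
  have "f (f (f (h x))) - qnum q 3 *s f (f (h (f x))) + qnum q 3 *s f (h (f (f x))) - h (f (f (f x))) = 0" for x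
  proof -
    let ?\<delta> = "\<lambda>x. f (h x) - h (f x)"
    have "f (f (f (h x))) - qnum q 3 *s f (f (h (f x))) + qnum q 3 *s f (h (f (f x))) - h (f (f (f x)))
        = f (f (?\<delta> x)) - s *s f (?\<delta> (f x)) + ?\<delta> (f (f x))"
      by (simp add: q3 endo_diff[OF f] algebra_simps)
    also have "\<dots> = k *s ((f (f (g x)) - s *s f (g (f x)) + g (f (f x)))
        - (f (f (g' x)) - s *s f (g' (f x)) + g' (f (f x))))"
      by (simp add: h endo_diff[OF f] endo_scale[OF f] algebra_simps)
    also have "\<dots> = 0"
      using q_weyl_cubic[OF q(1) f g, of x] q_weyl_cubic[OF q(1) f g', of x] w by (simp add: s_def)
    finally show ?thesis .
  qed
  then show ?thesis by (simp add: q_serre_def)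
qed

end

context split_system
begin

lemma q_power_nonzero: "k \<noteq> 0 \<Longrightarrow> q powi k \<noteq> 1"
proof -
  have pos: "q powi k \<noteq> 1" if "k > 0" for k
    using q_nonroot[of "nat k"] that by (simp add: power_int_def)
  assume "k \<noteq> 0"
  then show ?thesis
    using pos[of k] pos[of "-k"] by (cases "k > 0") (auto simp: power_int_minus)
qed

lemma q_minus_nonzero: "q - inverse q \<noteq> 0"
proof
  assume "q - inverse q = 0"
  then have "q^2 = 1" using q0 by (simp add: field_simps power2_eq_square)
  then show False using q_nonroot[of 2] by simp
qed

lemma q2_minus_nonzero: "q^2 - inverse (q^2) \<noteq> 0"
proof
  assume "q^2 - inverse (q^2) = 0"
  then have "q^4 = 1" using q0 by (simp add: field_simps eval_nat_numeral)
  then show False using q_nonroot[of 4] by simp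
qed

lemma q_plus_nonzero: "q + inverse q \<noteq> 0"
proof
  assume "q + inverse q = 0"
  then have "(q + inverse q) * (q - inverse q) = 0" by simp
  then show False using q2_minus_nonzero by (simp add: algebra_simps power2_eq_square)
qed

lemmas endos = x01[THEN penta_endo] x12[THEN penta_endo] x23[THEN penta_endo]
  x30[THEN penta_endo] x31[THEN penta_endo] x13[THEN penta_endo]

lemma serre_01_23: "q_serre q x01 x23"
  by (rule q_serreI[OF q0 q_minus_nonzero endos(1,2,4) weyl_01_12 weyl_30_01 evaluation_01_23])

lemma serre_12_30: "q_serre q x12 x30"
proof (rule q_serreI[OF q0 q_minus_nonzero endos(2,3,1) weyl_12_23 weyl_01_12])
  fix x
  show "x12 (x30 x) - x30 (x12 x) = (t * (q - inverse q)) *s (x23 x - x01 x)"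
    using evaluation_30_12[of x] by (metis minus_diff_eq scale_minus_right)
qed

lemma serre_23_01: "q_serre q x23 x01"
proof (rule q_serreI[OF q0 q_minus_nonzero endos(3,4,2) weyl_23_30 weyl_12_23])
  fix x
  show "x23 (x01 x) - x01 (x23 x) = (inverse t * (q - inverse q)) *s (x30 x - x12 x)"
    using evaluation_01_23[of x] by (metis minus_diff_eq scale_minus_right)
qed

lemma serre_30_12: "q_serre q x30 x12"
  by (rule q_serreI[OF q0 q_minus_nonzero endos(4,1,3) weyl_30_01 weyl_23_30 evaluation_30_12])

section \<open>Irreducibility\<close>

lemma inj_y: "inj_on y S" and inj_y': "inj_on (\<lambda>n. 1 / y n) S"
proof -
  have "m = n" if "y m = y n" for m n
  proof (rule ccontr)
    assume "m \<noteq> n"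
    have "q powi (2 * m - 2 * n) = y m / y n"
      using q0 by (simp add: qy_def power_int_diff)
    then have "q powi (2 * m - 2 * n) = 1"
      using that y0 by simp
    then show False using q_power_nonzero[of "2 * m - 2 * n"] \<open>m \<noteq> n\<close> by simp
  qed
  then show "inj_on y S" "inj_on (\<lambda>n. 1 / y n) S" by (auto simp: inj_on_def)
qed

lemma y_eq_iff: "y m = y n \<longleftrightarrow> m = n"
  using inj_y[of UNIV] by (auto simp: inj_on_def)

lemma raise_nonzero: "n \<noteq> -1 \<Longrightarrow> 1 - 1 / (q^2 * D * y n) \<noteq> 0"
proof
  assume n: "n \<noteq> -1" and "1 - 1 / (q^2 * D * y n) = 0"
  then have "q^2 * D * y n = 1" using nz by (simp add: field_simps)
  moreover have "q^2 * D * y (-1) = 1"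
    using q0 by (simp add: qy_def power_int_diff power_int_minus power_int_add field_simps)
  ultimately have "(q^2 * D) * y n = (q^2 * D) * y (-1)" by (simp only:)
  then have "y n = y (-1)" using nz by (simp only: mult_cancel_left) simp
  then show False using n y_eq_iff by blast
qed

lemma lower_nonzero: "n \<noteq> int d + 1 \<Longrightarrow> 1 - q^2 * D / y n \<noteq> 0"
proof
  assume n: "n \<noteq> int d + 1" and "1 - q^2 * D / y n = 0"
  then have "y n = q^2 * D" using nz by (simp add: field_simps)
  moreover have "y (int d + 1) = q^2 * D"
    using q0 by (simp add: qy_def power_int_diff power_int_add field_simps power_int_mult)
  ultimately show False using n y_eq_iff by metis
qed

lemma w_basis: "is_basis d (\<lambda>n. w (int n))" and w_outside: "k < 0 \<or> int d < k \<Longrightarrow> w k = 0"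
  using ib by (auto simp: int_basis_def)

text \<open>
  The eigenvalues of \<open>x31\<close> are distinct, so a nonzero invariant subspace contains some \<open>w\<^sub>m\<close>. From
  there \<open>x01\<close> reaches all higher and \<open>x30\<close> all lower basis vectors.
\<close>

lemma irreducible:
  assumes W: "subspace W" "x01 ` W \<subseteq> W" "x30 ` W \<subseteq> W" "x31 ` W \<subseteq> W" and ne: "W \<noteq> {0}"
  shows "W = UNIV"
proof -
  obtain x where x: "x \<in> W" "x \<noteq> 0" using ne subspace_0[OF W(1)] by auto
  obtain c where c: "x = (\<Sum>n\<le>d. c n *s w (int n))" using basis_expand[OF w_basis] .
  have "\<exists>n\<le>d. c n \<noteq> 0"
  proof (rule ccontr)
    assume "\<not> ?thesis"
    then have "x = 0" by (simp add: c)
    with x(2) show False by simp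
  qed
  then obtain m where m: "m \<le> d" "c m \<noteq> 0" by blast
  have "c m *s w (int m) \<in> W"
    by (rule invariant_contains_components[OF W(1) endos(5) W(4), of d "\<lambda>n. w (int n)" "\<lambda>n. 1 / y (int n)"])
      (use x c m in \<open>auto simp: band_apply[OF x31] inj_on_def y_eq_iff\<close>)
  then have "inverse (c m) *s (c m *s w (int m)) \<in> W" by (rule subspace_scale[OF W(1)])
  then have base: "w (int m) \<in> W" using m by simp
  have up: "w (int n + 1) \<in> W" if "w (int n) \<in> W" for n
  proof -
    let ?k = "1 - 1 / (q^2 * D * y (int n))"
    have "x01 (w (int n)) - (1 / y (int n)) *s w (int n) \<in> W"
      using W that by (intro subspace_diff subspace_scale) auto
    then have "?k *s w (int n + 1) \<in> W" by (simp add: band_apply[OF x01])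
    then have "inverse ?k *s (?k *s w (int n + 1)) \<in> W" by (rule subspace_scale[OF W(1)])
    moreover have "?k \<noteq> 0" using raise_nonzero[of "int n"] by linarith
    ultimately show ?thesis by (simp only: scale_scale left_inverse scale_one simp_thms)
  qed
  have down: "w (int n) \<in> W" if "w (int (Suc n)) \<in> W" "n < d" for n
  proof -
    let ?k = "1 - q^2 * D / y (int (Suc n))"
    have "x30 (w (int (Suc n))) - (1 / y (int (Suc n))) *s w (int (Suc n)) \<in> W"
      using W that by (intro subspace_diff subspace_scale) auto
    then have "?k *s w (int n) \<in> W" by (simp add: band_apply[OF x30])
    then have "inverse ?k *s (?k *s w (int n)) \<in> W" by (rule subspace_scale[OF W(1)])
    moreover have "?k \<noteq> 0" using lower_nonzero[of "int (Suc n)"] that(2) by linarith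
    ultimately show ?thesis by (simp only: scale_scale left_inverse scale_one simp_thms)
  qed
  have "w 0 \<in> W"
    using m(1) base by (induction m) (use down in auto)
  then have "w (int n) \<in> W" if "n \<le> d" for n
    by (induction n) (use up in \<open>auto simp: add.commute\<close>)
  then have "span ((\<lambda>n. w (int n)) ` {..d}) \<subseteq> W"
    using W(1) by (intro span_minimal) auto
  then show ?thesis using w_basis by (auto simp: is_basis_def)
qed

end

context split_system
begin

section \<open>The Z3-symmetric completions\<close>

definition q_bracket :: "('b \<Rightarrow> 'b) \<Rightarrow> ('b \<Rightarrow> 'b) \<Rightarrow> 'b \<Rightarrow> 'b" where
  "q_bracket f g x = q *s f (g x) - inverse q *s g (f x)"

text \<open>
  Divided by \<open>q - q^-1\<close>, these commutators have coefficients without that denominator on \<open>w\<close>.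
\<close>

definition comm_30_01 :: "'b \<Rightarrow> 'b" where
  "comm_30_01 = (\<lambda>x. inverse (q - inverse q) *s (x30 (x01 x) - x01 (x30 x)))"
definition comm_12_23 :: "'b \<Rightarrow> 'b" where
  "comm_12_23 = (\<lambda>x. inverse (q - inverse q) *s (x12 (x23 x) - x23 (x12 x)))"

definition opA :: "'a \<Rightarrow> 'b \<Rightarrow> 'b" where "opA a = (\<lambda>x. a *s x01 x + inverse a *s x12 x)"
definition opB :: "'a \<Rightarrow> 'b \<Rightarrow> 'b" where "opB b = (\<lambda>x. b *s x23 x + inverse b *s x30 x)"
definition opC :: "'a \<Rightarrow> 'a \<Rightarrow> 'a \<Rightarrow> 'b \<Rightarrow> 'b" where
  "opC a b c = (\<lambda>x. c *s x30 x + inverse c *s x01 x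
     + (a * inverse b) *s comm_30_01 x)"
definition opC' :: "'a \<Rightarrow> 'a \<Rightarrow> 'a \<Rightarrow> 'b \<Rightarrow> 'b" where
  "opC' a b c = (\<lambda>x. c *s x12 x + inverse c *s x23 x
     + (b * inverse a) *s comm_12_23 x)"

lemma band_comm_30_01:
  "band w comm_30_01 (\<lambda>n. - (1 - q^2 * D / y n) * q / y n)
    (\<lambda>n. (q * D + 1 / (q * D)) / y n - (q + 1 / q) / (y n)^2)
    (\<lambda>n. - (1 - 1 / (q^2 * D * y n)) / (q * y n))"
proof -
  have *: "inverse (q - inverse q) * Y = Z" if "Y = (q - inverse q) * Z" for Y Z
    using that q_minus_nonzero by simp
  show ?thesis
    unfolding comm_30_01_def
    by (rule penta_cong[OF penta_scale[OF penta_diff[OF band_comp[OF x30 x01] band_comp[OF x01 x30]]]]; (rule *)?)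
      (simp_all add: y_simps nz field_simps eval_nat_numeral)
qed

lemma band_comm_12_23:
  "band w comm_12_23 (\<lambda>n. - D * (1 - y n / (q^2 * D)) / t * y n)
    (\<lambda>n. (q * D + 1 / (q * D)) * y n - (q + 1 / q) * (y n)^2)
    (\<lambda>n. - t * (1 - q^2 * D * y n) / D * y n)"
proof -
  have *: "inverse (q - inverse q) * Y = Z" if "Y = (q - inverse q) * Z" for Y Z
    using that q_minus_nonzero by simp
  show ?thesis
    unfolding comm_12_23_def
    by (rule penta_cong[OF penta_scale[OF penta_diff[OF band_comp[OF x12 x23] band_comp[OF x23 x12]]]]; (rule *)?)
      (simp_all add: y_simps nz field_simps eval_nat_numeral)
qed

text \<open>
  The common form of the identities below. The term with \<open>k\<close> occurs only in those that come from
  brackets of a generator with itself; the others use \<open>\<mu> = 0\<close>.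
\<close>

lemma q_bracketI:
  assumes f: "band w f fl fm fr" and g: "band w g gl gm gr" and h: "band w h hl hm hr" and k: "band w k kl km kr"
    and "\<And>n. 2 \<le> n \<Longrightarrow> n \<le> int d \<Longrightarrow> \<alpha> * (q * (gl n * fl (n - 1)) - inverse q * (fl n * gl (n - 1)))
       + \<mu> * ((q - inverse q) * (kl n * kl (n - 1))) = 0"
    and "\<And>n. 1 \<le> n \<Longrightarrow> n \<le> int d \<Longrightarrow>
       \<alpha> * (q * (gl n * fm (n - 1) + gm n * fl n) - inverse q * (fl n * gm (n - 1) + fm n * gl n))
       + \<mu> * ((q - inverse q) * (kl n * km (n - 1) + km n * kl n)) + (q^2 - inverse (q^2)) * hl n = 0"
    and "\<And>n. 0 \<le> n \<Longrightarrow> n \<le> int d \<Longrightarrow>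
       \<alpha> * (q * (gl n * fr (n - 1) + gm n * fm n + gr n * fl (n + 1))
         - inverse q * (fl n * gr (n - 1) + fm n * gm n + fr n * gl (n + 1)))
       + \<mu> * ((q - inverse q) * (kl n * kr (n - 1) + km n * km n + kr n * kl (n + 1)))
       + (q^2 - inverse (q^2)) * hm n = (q - inverse q) * \<kappa>"
    and "\<And>n. 0 \<le> n \<Longrightarrow> n \<le> int d - 1 \<Longrightarrow>
       \<alpha> * (q * (gm n * fr n + gr n * fm (n + 1)) - inverse q * (fm n * gr n + fr n * gm (n + 1)))
       + \<mu> * ((q - inverse q) * (km n * kr n + kr n * km (n + 1))) + (q^2 - inverse (q^2)) * hr n = 0"
    and "\<And>n. 0 \<le> n \<Longrightarrow> n \<le> int d - 2 \<Longrightarrow> \<alpha> * (q * (gr n * fr (n + 1)) - inverse q * (fr n * gr (n + 1)))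
       + \<mu> * ((q - inverse q) * (kr n * kr (n + 1))) = 0"
  shows "(q^2 - inverse (q^2)) *s h x + \<alpha> *s q_bracket f g x + \<mu> *s ((q - inverse q) *s k (k x)) = ((q - inverse q) * \<kappa>) *s x"
proof -
  have "(\<lambda>x. \<alpha> *s (q *s f (g x) - inverse q *s g (f x)) + \<mu> *s ((q - inverse q) *s k (k x)) + (q^2 - inverse (q^2)) *s h x)
      = (\<lambda>x. ((q - inverse q) * \<kappa>) *s x)"
    by (rule penta_eqI[OF ib penta_add[OF penta_add[OF penta_scale[OF penta_diff[OF penta_scale[OF band_comp[OF f g]] penta_scale[OF band_comp[OF g f]]]]
          penta_scale[OF penta_scale[OF band_comp[OF k k]]]] penta_scale[OF h]] penta_scale[OF band_id]])
      (use assms(5-) in auto)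
  then show ?thesis by (simp add: q_bracket_def fun_eq_iff add_ac)
qed

text \<open>
  The eight identities named \<open>casimir\<close> arise by collecting, in the three equations for \<open>C\<close> and in those
  for the dual completion, the terms with the same monomial in \<open>a\<close>, \<open>b\<close> after \<open>c\<close> is eliminated by
  \<open>t = a b c^-1\<close>. They express the same scalar, the value \<open>q D + (q D)^-1\<close> of a central element, in
  different generators.
\<close>

lemma casimir_23_01: "(q^2 - inverse (q^2)) *s x12 u + t *s q_bracket x23 x01 u
    = ((q - inverse q) * (q * D + 1 / (q * D) + t)) *s u"
proof -
  have "(q^2 - inverse (q^2)) *s x12 u + t *s q_bracket x23 x01 u + 0 *s ((q - inverse q) *s x12 (x12 u))
    = ((q - inverse q) * (q * D + 1 / (q * D) + t)) *s u"
    by (rule q_bracketI[OF x23 x01 x12 x12]; simp add: y_simps nz field_simps eval_nat_numeral)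
  then show ?thesis by simp
qed

lemma casimir_01_23: "(q^2 - inverse (q^2)) *s x30 u + t *s q_bracket x01 x23 u
    = ((q - inverse q) * (q * D + 1 / (q * D) + t)) *s u"
proof -
  have "(q^2 - inverse (q^2)) *s x30 u + t *s q_bracket x01 x23 u + 0 *s ((q - inverse q) *s x30 (x30 u))
    = ((q - inverse q) * (q * D + 1 / (q * D) + t)) *s u"
    by (rule q_bracketI[OF x01 x23 x30 x30]; simp add: y_simps nz field_simps eval_nat_numeral)
  then show ?thesis by simp
qed

lemma casimir_30_12: "(q^2 - inverse (q^2)) *s x23 u + inverse t *s q_bracket x30 x12 u
    = ((q - inverse q) * (q * D + 1 / (q * D) + inverse t)) *s u"
proof -
  have "(q^2 - inverse (q^2)) *s x23 u + inverse t *s q_bracket x30 x12 u + 0 *s ((q - inverse q) *s x23 (x23 u))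
    = ((q - inverse q) * (q * D + 1 / (q * D) + inverse t)) *s u"
    by (rule q_bracketI[OF x30 x12 x23 x23]; simp add: y_simps nz field_simps eval_nat_numeral)
  then show ?thesis by simp
qed

lemma casimir_12_30: "(q^2 - inverse (q^2)) *s x01 u + inverse t *s q_bracket x12 x30 u
    = ((q - inverse q) * (q * D + 1 / (q * D) + inverse t)) *s u"
proof -
  have "(q^2 - inverse (q^2)) *s x01 u + inverse t *s q_bracket x12 x30 u + 0 *s ((q - inverse q) *s x01 (x01 u))
    = ((q - inverse q) * (q * D + 1 / (q * D) + inverse t)) *s u"
    by (rule q_bracketI[OF x12 x30 x01 x01]; simp add: y_simps nz field_simps eval_nat_numeral)
  then show ?thesis by simp
qed

lemma casimir_cubic_01: "(q^2 - inverse (q^2)) *s x01 u + q_bracket x23 comm_30_01 u + inverse t *s ((q - inverse q) *s x30 (x30 u))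
    = ((q - inverse q) * (q * D + 1 / (q * D) + inverse t)) *s u"
proof -
  have "(q^2 - inverse (q^2)) *s x01 u + 1 *s q_bracket x23 comm_30_01 u + inverse t *s ((q - inverse q) *s x30 (x30 u))
    = ((q - inverse q) * (q * D + 1 / (q * D) + inverse t)) *s u"
    by (rule q_bracketI[OF x23 band_comm_30_01 x01 x30]; simp add: y_simps nz field_simps eval_nat_numeral)
  then show ?thesis by simp
qed

lemma casimir_cubic_30: "(q^2 - inverse (q^2)) *s x30 u + q_bracket comm_30_01 x12 u + t *s ((q - inverse q) *s x01 (x01 u))
    = ((q - inverse q) * (q * D + 1 / (q * D) + t)) *s u"
proof -
  have "(q^2 - inverse (q^2)) *s x30 u + 1 *s q_bracket comm_30_01 x12 u + t *s ((q - inverse q) *s x01 (x01 u))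
    = ((q - inverse q) * (q * D + 1 / (q * D) + t)) *s u"
    by (rule q_bracketI[OF band_comm_30_01 x12 x30 x01]; simp add: y_simps nz field_simps eval_nat_numeral)
  then show ?thesis by simp
qed

lemma casimir_cubic_23: "(q^2 - inverse (q^2)) *s x23 u + q_bracket x01 comm_12_23 u + inverse t *s ((q - inverse q) *s x12 (x12 u))
    = ((q - inverse q) * (q * D + 1 / (q * D) + inverse t)) *s u"
proof -
  have "(q^2 - inverse (q^2)) *s x23 u + 1 *s q_bracket x01 comm_12_23 u + inverse t *s ((q - inverse q) *s x12 (x12 u))
    = ((q - inverse q) * (q * D + 1 / (q * D) + inverse t)) *s u"
    by (rule q_bracketI[OF x01 band_comm_12_23 x23 x12]; simp add: y_simps nz field_simps eval_nat_numeral)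
  then show ?thesis by simp
qed

lemma casimir_cubic_12: "(q^2 - inverse (q^2)) *s x12 u + q_bracket comm_12_23 x30 u + t *s ((q - inverse q) *s x23 (x23 u))
    = ((q - inverse q) * (q * D + 1 / (q * D) + t)) *s u"
proof -
  have "(q^2 - inverse (q^2)) *s x12 u + 1 *s q_bracket comm_12_23 x30 u + t *s ((q - inverse q) *s x23 (x23 u))
    = ((q - inverse q) * (q * D + 1 / (q * D) + t)) *s u"
    by (rule q_bracketI[OF band_comm_12_23 x30 x12 x23]; simp add: y_simps nz field_simps eval_nat_numeral)
  then show ?thesis by simp
qed

lemma bracket_01_30: "(q^2 - inverse (q^2)) *s comm_30_01 u + q_bracket x01 x30 u
    = ((q - inverse q) * (1)) *s u"
proof -
  have "(q^2 - inverse (q^2)) *s comm_30_01 u + 1 *s q_bracket x01 x30 u + 0 *s ((q - inverse q) *s x01 (x01 u))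
    = ((q - inverse q) * (1)) *s u"
    by (rule q_bracketI[OF x01 x30 band_comm_30_01 x01]; simp add: y_simps nz field_simps eval_nat_numeral)
  then show ?thesis by simp
qed

lemma bracket_23_12: "(q^2 - inverse (q^2)) *s comm_12_23 u + q_bracket x23 x12 u
    = ((q - inverse q) * (1)) *s u"
proof -
  have "(q^2 - inverse (q^2)) *s comm_12_23 u + 1 *s q_bracket x23 x12 u + 0 *s ((q - inverse q) *s x01 (x01 u))
    = ((q - inverse q) * (1)) *s u"
    by (rule q_bracketI[OF x23 x12 band_comm_12_23 x01]; simp add: y_simps nz field_simps eval_nat_numeral)
  then show ?thesis by simp
qed

lemma bracket_30_comm: "q_bracket x30 comm_30_01 u = 0"
proof -
  have "(\<lambda>x. q *s x30 (comm_30_01 x) - inverse q *s comm_30_01 (x30 x)) = (\<lambda>x. 0 *s x)"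
    by (rule penta_eqI[OF ib penta_diff[OF penta_scale[OF band_comp[OF x30 band_comm_30_01]]
        penta_scale[OF band_comp[OF band_comm_30_01 x30]]] penta_scale[OF band_id]]; simp add: y_simps nz field_simps eval_nat_numeral)
  then show ?thesis by (simp add: q_bracket_def fun_eq_iff)
qed

lemma bracket_comm_01: "q_bracket comm_30_01 x01 u = 0"
proof -
  have "(\<lambda>x. q *s comm_30_01 (x01 x) - inverse q *s x01 (comm_30_01 x)) = (\<lambda>x. 0 *s x)"
    by (rule penta_eqI[OF ib penta_diff[OF penta_scale[OF band_comp[OF band_comm_30_01 x01]]
        penta_scale[OF band_comp[OF x01 band_comm_30_01]]] penta_scale[OF band_id]]; simp add: y_simps nz field_simps eval_nat_numeral)
  then show ?thesis by (simp add: q_bracket_def fun_eq_iff)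
qed

lemma bracket_12_comm: "q_bracket x12 comm_12_23 u = 0"
proof -
  have "(\<lambda>x. q *s x12 (comm_12_23 x) - inverse q *s comm_12_23 (x12 x)) = (\<lambda>x. 0 *s x)"
    by (rule penta_eqI[OF ib penta_diff[OF penta_scale[OF band_comp[OF x12 band_comm_12_23]]
        penta_scale[OF band_comp[OF band_comm_12_23 x12]]] penta_scale[OF band_id]]; simp add: y_simps nz field_simps eval_nat_numeral)
  then show ?thesis by (simp add: q_bracket_def fun_eq_iff)
qed

lemma bracket_comm_23: "q_bracket comm_12_23 x23 u = 0"
proof -
  have "(\<lambda>x. q *s comm_12_23 (x23 x) - inverse q *s x23 (comm_12_23 x)) = (\<lambda>x. 0 *s x)"
    by (rule penta_eqI[OF ib penta_diff[OF penta_scale[OF band_comp[OF band_comm_12_23 x23]]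
        penta_scale[OF band_comp[OF x23 band_comm_12_23]]] penta_scale[OF band_id]]; simp add: y_simps nz field_simps eval_nat_numeral)
  then show ?thesis by (simp add: q_bracket_def fun_eq_iff)
qed

text \<open>
  Multiplying by \<open>q^2 - q^-2 = (q - q^-1) (q + q^-1)\<close> removes both denominators of the equation.
\<close>

lemma Z3_relationI:
  assumes "\<And>x. (q^2 - inverse (q^2)) *s f x + q_bracket g h x
    = ((q - inverse q) * ((a + inverse a) * (q * D + 1 / (q * D)) + (b + inverse b) * (c + inverse c))) *s x"
  shows "Z3_relation q d a b c f g h"
  unfolding Z3_relation_def
proof
  fix x
  let ?s = "q^2 - inverse (q^2)"
  define K where "K = (a + inverse a) * (q * D + 1 / (q * D)) + (b + inverse b) * (c + inverse c)"
  have D: "q powi (int d + 1) = q * D" "q powi (- int d - 1) = 1 / (q * D)"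
    using q0 by (simp_all add: power_int_add power_int_diff power_int_minus field_simps)
  have "f x + inverse ?s *s (q *s g (h x) - inverse q *s h (g x))
      = inverse ?s *s (?s *s f x + (q *s g (h x) - inverse q *s h (g x)))"
    using q2_minus_nonzero by (simp add: scale_right_distrib)
  also have "\<dots> = inverse ?s *s ((q - inverse q) * K) *s x"
    using assms[of x] by (simp only: K_def q_bracket_def)
  also have "\<dots> = (inverse ?s * ((q - inverse q) * K)) *s x"
    by (simp only: scale_scale)
  also have "inverse ?s * ((q - inverse q) * K) = K / (q + inverse q)"
  proof -
    have "?s = (q - inverse q) * (q + inverse q)" by (simp add: algebra_simps power2_eq_square)
    then show ?thesis using q_minus_nonzero q_plus_nonzero by (simp add: divide_simps)
  qed
  finally show "f x + inverse ?s *s (q *s g (h x) - inverse q *s h (g x)) =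
      (((a + inverse a) * (q powi (int d + 1) + q powi (- int d - 1)) + (b + inverse b) * (c + inverse c)) / (q + inverse q)) *s x"
    by (simp only: D K_def)
qed

lemma Z3_relation_solve:
  assumes "Z3_relation q d a b c f g h"
  shows "f x = (((a + inverse a) * (q powi (int d + 1) + q powi (- int d - 1)) + (b + inverse b) * (c + inverse c))
      / (q + inverse q)) *s x - inverse (q^2 - inverse (q^2)) *s (q *s g (h x) - inverse q *s h (g x))"
  using assms[unfolded Z3_relation_def, rule_format, of x] by (simp only: eq_diff_eq)

text \<open>
  The last equation determines the completion, so only the equations have to be checked.
\<close>

lemma Z3_completionI:
  assumes "endo h" and "Z3_equations q a b c d f g h"
  shows "Z3_symmetric_completion q a b c d f g h"
proof -
  have unique: "h' = h" if "Z3_equations q a b c d f g h'" for h'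
  proof
    fix x
    have "Z3_relation q d c a b h' f g" "Z3_relation q d c a b h f g"
      using that assms(2) by (simp_all only: Z3_equations_def)
    then show "h' x = h x" by (rule trans[OF Z3_relation_solve Z3_relation_solve[symmetric]])
  qed
  show ?thesis
    unfolding Z3_symmetric_completion_def
    by (intro conjI allI impI) (rule assms(1), rule assms(2), rule unique[OF conjunct2])
qed

lemma q_bracket_weyl: "q_weyl q f g \<Longrightarrow> q_bracket f g u = (q - inverse q) *s u"
  by (simp add: q_weyl_def q_bracket_def)

lemma q_bracket_self: "q_bracket f f u = (q - inverse q) *s f (f u)"
  by (simp add: q_bracket_def scale_left_diff_distrib)

lemma q_bracket_2_2:
  assumes "endo f" "endo g" "endo h" "endo k"
  shows "q_bracket (\<lambda>x. \<alpha> *s f x + \<beta> *s g x) (\<lambda>x. \<gamma> *s h x + \<delta> *s k x) u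
    = (\<alpha> * \<gamma>) *s q_bracket f h u + (\<alpha> * \<delta>) *s q_bracket f k u
    + (\<beta> * \<gamma>) *s q_bracket g h u + (\<beta> * \<delta>) *s q_bracket g k u"
  by (simp add: q_bracket_def assms[THEN endo_add] assms[THEN endo_scale] algebra_simps)

lemma q_bracket_2_3:
  assumes "endo f" "endo g" "endo h" "endo k" "endo m"
  shows "q_bracket (\<lambda>x. \<alpha> *s f x + \<beta> *s g x) (\<lambda>x. \<gamma> *s h x + \<delta> *s k x + \<epsilon> *s m x) u
    = (\<alpha> * \<gamma>) *s q_bracket f h u + (\<alpha> * \<delta>) *s q_bracket f k u + (\<alpha> * \<epsilon>) *s q_bracket f m u
    + (\<beta> * \<gamma>) *s q_bracket g h u + (\<beta> * \<delta>) *s q_bracket g k u + (\<beta> * \<epsilon>) *s q_bracket g m u"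
  by (simp add: q_bracket_def assms[THEN endo_add] assms[THEN endo_scale] algebra_simps)

lemma q_bracket_3_2:
  assumes "endo f" "endo g" "endo h" "endo k" "endo m"
  shows "q_bracket (\<lambda>x. \<gamma> *s h x + \<delta> *s k x + \<epsilon> *s m x) (\<lambda>x. \<alpha> *s f x + \<beta> *s g x) u
    = (\<alpha> * \<gamma>) *s q_bracket h f u + (\<alpha> * \<delta>) *s q_bracket k f u + (\<alpha> * \<epsilon>) *s q_bracket m f u
    + (\<beta> * \<gamma>) *s q_bracket h g u + (\<beta> * \<delta>) *s q_bracket k g u + (\<beta> * \<epsilon>) *s q_bracket m g u"
  by (simp add: q_bracket_def assms[THEN endo_add] assms[THEN endo_scale] algebra_simps)

lemmas endo_comm_30_01 = penta_endo[OF band_comm_30_01] and endo_comm_12_23 = penta_endo[OF band_comm_12_23]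

text \<open>
  The bookkeeping for the equations in which \<open>C\<close> occurs inside a bracket: \<open>X\<close> and \<open>Y\<close> are the two
  generators in the operator \<open>M\<close> outside the bracket, each taking part in one Casimir identity;
  the terms with \<open>\<eta>\<close> and \<open>\<eta>'\<close> come from the brackets that are scalar.
\<close>

lemma combine_cubic:
  assumes Y: "s *s Y + \<alpha> *s P = (k0 * (E + \<alpha>)) *s U" and X: "s *s X + R + \<beta> *s W = (k0 * (E + \<beta>)) *s U"
    and M: "M = a *s X + a' *s Y"
    and S: "S = \<eta> *s k0 *s U + p *s P + r *s R + v *s W + \<eta>' *s k0 *s U"
    and eqs: "p = a' * \<alpha>" "r = a" "v = a * \<beta>"
    and \<kappa>: "\<kappa> = (a + a') * E + (\<eta> + p + v + \<eta>')"
  shows "s *s M + S = (k0 * \<kappa>) *s U"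
proof -
  have "s *s M + S = a' *s (s *s Y + \<alpha> *s P) + a *s (s *s X + R + \<beta> *s W) + (k0 * (\<eta> + \<eta>')) *s U"
    unfolding M S eqs by (simp add: algebra_simps)
  also have "\<dots> = (k0 * \<kappa>) *s U"
    unfolding X Y \<kappa> eqs by (simp add: algebra_simps)
  finally show ?thesis .
qed

text \<open>
  The same for the equation in which \<open>C\<close> stands alone; \<open>Z\<close> is its commutator part.
\<close>

lemma combine_quadratic:
  assumes Y: "s *s Y + \<alpha> *s P = (k0 * (E + \<alpha>)) *s U" and X: "s *s X + \<beta> *s Q = (k0 * (E + \<beta>)) *s U"
    and Z: "s *s Z + R = (k0 * 1) *s U"
    and M: "M = a *s X + a' *s Y + z *s Z"
    and S: "S = p *s P + v *s Q + z *s R + e *s k0 *s U"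
    and eqs: "p = a' * \<alpha>" "v = a * \<beta>"
    and \<kappa>: "\<kappa> = (a + a') * E + (p + v + z + e)"
  shows "s *s M + S = (k0 * \<kappa>) *s U"
proof -
  have "s *s M + S = a' *s (s *s Y + \<alpha> *s P) + a *s (s *s X + \<beta> *s Q) + z *s (s *s Z + R) + (k0 * e) *s U"
    unfolding M S eqs by (simp add: algebra_simps)
  also have "\<dots> = (k0 * \<kappa>) *s U"
    unfolding X Y Z \<kappa> eqs by (simp add: algebra_simps)
  finally show ?thesis .
qed

lemmas weyl_brackets = weyl_01_12[THEN q_bracket_weyl] weyl_12_23[THEN q_bracket_weyl]
  weyl_23_30[THEN q_bracket_weyl] weyl_30_01[THEN q_bracket_weyl]
  bracket_30_comm bracket_comm_01 bracket_12_comm bracket_comm_23 q_bracket_self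

context
  fixes a b c :: 'a
  assumes a: "a \<noteq> 0" and b: "b \<noteq> 0" and c: "c \<noteq> 0" and t: "t = a * b * inverse c"
begin

lemma Z3_ABC: "Z3_relation q d a b c (opA a) (opB b) (opC a b c)"
proof (rule Z3_relationI)
  fix u
  show "(q^2 - inverse (q^2)) *s opA a u + q_bracket (opB b) (opC a b c) u
      = ((q - inverse q) * ((a + inverse a) * (q * D + 1 / (q * D)) + (b + inverse b) * (c + inverse c))) *s u"
    by (rule combine_cubic[OF casimir_23_01 casimir_cubic_01,
          where a = a and a' = "inverse a" and p = "b * inverse c" and r = "b * (a * inverse b)"
          and v = "inverse b * c" and \<eta> = "b * c" and \<eta>' = "inverse b * inverse c"],
        simp_all only: opA_def opB_def opC_def opC'_def q_bracket_2_3[OF endos(3,4,4,1) endo_comm_30_01] weyl_brackets)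
      (use a b c in \<open>simp_all add: t field_simps\<close>)
qed

lemma Z3_BCA: "Z3_relation q d b c a (opB b) (opC a b c) (opA a)"
proof (rule Z3_relationI)
  fix u
  show "(q^2 - inverse (q^2)) *s opB b u + q_bracket (opC a b c) (opA a) u
      = ((q - inverse q) * ((b + inverse b) * (q * D + 1 / (q * D)) + (c + inverse c) * (a + inverse a))) *s u"
    by (rule combine_cubic[OF casimir_30_12 casimir_cubic_30,
          where a = "inverse b" and a' = b and p = "inverse a * c" and r = "inverse a * (a * inverse b)"
          and v = "a * inverse c" and \<eta> = "a * c" and \<eta>' = "inverse a * inverse c"],
        simp_all only: opA_def opB_def opC_def opC'_def q_bracket_3_2[OF endos(1,2,4,1) endo_comm_30_01] weyl_brackets)
      (use a b c in \<open>simp_all add: t field_simps\<close>)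
qed

lemma Z3_CAB: "Z3_relation q d c a b (opC a b c) (opA a) (opB b)"
proof (rule Z3_relationI)
  fix u
  show "(q^2 - inverse (q^2)) *s opC a b c u + q_bracket (opA a) (opB b) u
      = ((q - inverse q) * ((c + inverse c) * (q * D + 1 / (q * D)) + (a + inverse a) * (b + inverse b))) *s u"
  proof (rule combine_quadratic[OF casimir_01_23 casimir_12_30 bracket_01_30,
          where a = "inverse c" and a' = c and z = "a * inverse b" and p = "a * b" and v = "inverse a * inverse b"
          and e = "inverse a * b"])
    show "opC a b c u = inverse c *s x01 u + c *s x30 u + (a * inverse b) *s comm_30_01 u"
      by (simp only: opC_def add_ac)
    show "q_bracket (opA a) (opB b) u = (a * b) *s q_bracket x01 x23 u + (inverse a * inverse b) *s q_bracket x12 x30 u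
        + (a * inverse b) *s q_bracket x01 x30 u + (inverse a * b) *s (q - inverse q) *s u"
      by (simp only: opA_def opB_def q_bracket_2_2[OF endos(1,2,3,4)] weyl_brackets add_ac)
  qed (use a b c in \<open>simp_all add: t field_simps\<close>)
qed

lemma Z3_BAC': "Z3_relation q d b a c (opB b) (opA a) (opC' a b c)"
proof (rule Z3_relationI)
  fix u
  show "(q^2 - inverse (q^2)) *s opB b u + q_bracket (opA a) (opC' a b c) u
      = ((q - inverse q) * ((b + inverse b) * (q * D + 1 / (q * D)) + (a + inverse a) * (c + inverse c))) *s u"
    by (rule combine_cubic[OF casimir_01_23 casimir_cubic_23,
          where a = b and a' = "inverse b" and p = "a * inverse c" and r = "a * (b * inverse a)"
          and v = "inverse a * c" and \<eta> = "a * c" and \<eta>' = "inverse a * inverse c"],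
        simp_all only: opA_def opB_def opC_def opC'_def q_bracket_2_3[OF endos(1,2,2,3) endo_comm_12_23] weyl_brackets)
      (use a b c in \<open>simp_all add: t field_simps\<close>)
qed

lemma Z3_AC'B: "Z3_relation q d a c b (opA a) (opC' a b c) (opB b)"
proof (rule Z3_relationI)
  fix u
  show "(q^2 - inverse (q^2)) *s opA a u + q_bracket (opC' a b c) (opB b) u
      = ((q - inverse q) * ((a + inverse a) * (q * D + 1 / (q * D)) + (c + inverse c) * (b + inverse b))) *s u"
    by (rule combine_cubic[OF casimir_12_30 casimir_cubic_12,
          where a = "inverse a" and a' = a and p = "inverse b * c" and r = "inverse b * (b * inverse a)"
          and v = "b * inverse c" and \<eta> = "b * c" and \<eta>' = "inverse b * inverse c"],
        simp_all only: opA_def opB_def opC_def opC'_def q_bracket_3_2[OF endos(3,4,2,3) endo_comm_12_23] weyl_brackets)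
      (use a b c in \<open>simp_all add: t field_simps\<close>)
qed

lemma Z3_C'BA: "Z3_relation q d c b a (opC' a b c) (opB b) (opA a)"
proof (rule Z3_relationI)
  fix u
  show "(q^2 - inverse (q^2)) *s opC' a b c u + q_bracket (opB b) (opA a) u
      = ((q - inverse q) * ((c + inverse c) * (q * D + 1 / (q * D)) + (b + inverse b) * (a + inverse a))) *s u"
  proof (rule combine_quadratic[OF casimir_23_01 casimir_30_12 bracket_23_12,
          where a = "inverse c" and a' = c and z = "b * inverse a" and p = "b * a" and v = "inverse b * inverse a"
          and e = "inverse b * a"])
    show "opC' a b c u = inverse c *s x23 u + c *s x12 u + (b * inverse a) *s comm_12_23 u"
      by (simp only: opC'_def add_ac)
    show "q_bracket (opB b) (opA a) u = (b * a) *s q_bracket x23 x01 u + (inverse b * inverse a) *s q_bracket x30 x12 u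
        + (b * inverse a) *s q_bracket x23 x12 u + (inverse b * a) *s (q - inverse q) *s u"
      by (simp only: opA_def opB_def q_bracket_2_2[OF endos(3,4,1,2)] weyl_brackets add_ac)
  qed (use a b c in \<open>simp_all add: t field_simps\<close>)
qed

lemma completion: "Z3_symmetric_completion q a b c d (opA a) (opB b) (opC a b c)"
proof (rule Z3_completionI)
  show "endo (opC a b c)"
    unfolding opC_def by (intro endo_plus endo_scaled endos endo_comm_30_01)
qed (simp add: Z3_equations_def Z3_ABC Z3_BCA Z3_CAB)

lemma dual_completion: "dual_Z3_symmetric_completion q a b c d (opA a) (opB b) (opC' a b c)"
  unfolding dual_Z3_symmetric_completion_def
proof (rule Z3_completionI)
  show "endo (opC' a b c)"
    unfolding opC'_def by (intro endo_plus endo_scaled endos endo_comm_12_23)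
qed (simp add: Z3_equations_def Z3_BAC' Z3_AC'B Z3_C'BA)

end

end

context qtet_space
begin

section \<open>The eigenbasis of x23 that defines the evaluation module\<close>

lemma bandI:
  assumes v: "\<And>k. k < 0 \<or> int d < k \<Longrightarrow> v k = 0" and f: "endo f"
    and fv: "\<And>n. 0 \<le> n \<Longrightarrow> n \<le> int d \<Longrightarrow> f (v n) = l n *s v (n - 1) + m n *s v n + r n *s v (n + 1)"
    and "l (int d + 1) = 0" and "r (-1) = 0"
  shows "band v f l m r"
proof -
  have "f (v n) = l n *s v (n - 1) + m n *s v n + r n *s v (n + 1)" for n
  proof -
    consider "0 \<le> n \<and> n \<le> int d" | "n = -1" | "n = int d + 1" | "n < -1" | "n > int d + 1" by linarith
    then show ?thesis
      by cases (simp_all add: fv v endo_zero[OF f] assms(4,5))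
  qed
  then show ?thesis using f by (simp add: penta_def)
qed

end

text \<open>
  The condition on \<open>t\<close> is the one in the definition of \<open>V_d(t)\<close>, with the exponents in reverse order.
\<close>

locale evaluation_system = split_system +
  assumes tq: "\<And>n. 1 \<le> n \<Longrightarrow> n \<le> int d \<Longrightarrow> t \<noteq> y n / q"
begin

text \<open>
  The vector \<open>v\<^sub>0\<close> solves \<open>x23 v\<^sub>0 = q^d v\<^sub>0\<close>, which forces the geometric coefficients. The recursion is
  the prescribed bidiagonal action of \<open>x31\<close>, solved for the next vector.
\<close>

primrec v_nat :: "nat \<Rightarrow> 'b" where
  "v_nat 0 = (\<Sum>m\<le>d. (t / q) ^ m *s w (int m))"
| "v_nat (Suc n) = inverse (1 / D - q^2 * y (int n)) *s (x31 (v_nat n) - y (int n) *s v_nat n)"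

definition v :: "int \<Rightarrow> 'b" where
  "v k = (if 0 \<le> k \<and> k \<le> int d then v_nat (nat k) else 0)"

lemma y_0: "y 0 = 1 / D" and y_minus_1: "q^2 * y (-1) = 1 / D" and y_d: "y (int d) = D"
  and y_d_minus: "y (int d - n) = 1 / y n"
  using q0 by (simp_all add: qy_def power_int_diff power_int_minus power_int_add power_int_mult field_simps)

lemma v_step_nonzero: "1 / D - q^2 * y (int n) \<noteq> 0"
proof
  assume "1 / D - q^2 * y (int n) = 0"
  then have "q^2 * y (int n) = q^2 * y (-1)" by (simp only: y_minus_1 right_minus_eq)
  then have "y (int n) = y (-1)" using q0 by simp
  then show False by (simp add: y_eq_iff)
qed

lemma v_nat_explicit:
  "v_nat n = (\<Sum>m\<le>d. ((t / q) ^ m * (\<Prod>i<n. (1 / y (int m) - y (int i)) / (1 / D - q^2 * y (int i)))) *s w (int m))"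
proof (induction n)
  case 0
  show ?case by simp
next
  case (Suc n)
  let ?c = "\<lambda>m. (t / q) ^ m * (\<Prod>i<n. (1 / y (int m) - y (int i)) / (1 / D - q^2 * y (int i)))"
  let ?e = "1 / D - q^2 * y (int n)"
  have "x31 (v_nat n) = (\<Sum>m\<le>d. (?c m * (1 / y (int m))) *s w (int m))"
    by (simp add: Suc endo_sum[OF endos(5)] endo_scale[OF endos(5)] band_apply[OF x31])
  then have "v_nat (Suc n) = inverse ?e *s (\<Sum>m\<le>d. (?c m * (1 / y (int m)) - y (int n) * ?c m) *s w (int m))"
    by (simp add: Suc scale_sum_right sum_subtractf scale_left_diff_distrib)
  also have "\<dots> = (\<Sum>m\<le>d. (inverse ?e * (?c m * (1 / y (int m)) - y (int n) * ?c m)) *s w (int m))"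
    by (simp add: scale_sum_right)
  also have "\<dots> = (\<Sum>m\<le>d. (?c m * ((1 / y (int m) - y (int n)) / ?e)) *s w (int m))"
    by (intro sum.cong refl arg_cong2[where f = scale]) (simp add: divide_inverse algebra_simps)
  finally show ?case by (simp add: mult.assoc)
qed

text \<open>
  The recursion stops by itself: up to scalars \<open>v\<^sub>d\<^sub>+\<^sub>1\<close> is the product of all \<open>x31 - q^(2i - d)\<close> with
  \<open>i \<le> d\<close> applied to \<open>v\<^sub>0\<close>, and this product is zero.
\<close>

lemma v_nat_end: "v_nat (Suc d) = 0"
proof -
  have "(\<Prod>i<Suc d. (1 / y (int m) - y (int i)) / (1 / D - q^2 * y (int i))) = 0" if "m \<le> d" for m
  proof (rule prod_zero)
    have "y (int (d - m)) = 1 / y (int m)" using that y_d_minus[of "int m"] by (simp add: of_nat_diff)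
    then show "\<exists>i\<in>{..<Suc d}. (1 / y (int m) - y (int i)) / (1 / D - q^2 * y (int i)) = 0"
      by (intro bexI[of _ "d - m"]) auto
  qed simp
  then show ?thesis
    unfolding v_nat_explicit
    by (intro sum.neutral ballI) (simp only: atMost_iff mult_zero_right scale_zero_left)
qed

text \<open>
  The coefficient of \<open>w\<^sub>0\<close> does not vanish.
\<close>

lemma v_nat_nonzero:
  assumes "n \<le> d"
  shows "v_nat n \<noteq> 0"
proof
  let ?c = "\<lambda>m. (t / q) ^ m * (\<Prod>i<n. (1 / y (int m) - y (int i)) / (1 / D - q^2 * y (int i)))"
  assume "v_nat n = 0"
  then have "?c 0 = 0"
    using basis_coeff_zero[OF w_basis, of ?c 0] by (simp add: v_nat_explicit)
  then obtain i where i: "i < n" "1 / y 0 = y (int i)"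
    using v_step_nonzero by auto
  then have "y (int i) = y (int d)" by (simp add: y_0 y_d)
  then show False using i assms y_eq_iff by simp
qed

text \<open>
  After the first vector this is formal: if \<open>u\<close> is an eigenvector of \<open>x23\<close> for \<open>1 / y\<^sub>n\<close>, then the
  \<open>q\<close>-Weyl relation makes \<open>x31 u - y\<^sub>n u\<close> one for \<open>1 / y\<^sub>n\<^sub>+\<^sub>1\<close>.
\<close>

lemma x23_v_nat: "x23 (v_nat n) = (1 / y (int n)) *s v_nat n"
proof (induction n)
  case 0
  have "x23 (v_nat 0) = (\<Sum>m\<le>d. (t / q) ^ m *s (q * D * (1 - y (int m) / (q^2 * D)) / t) *s w (int m - 1))
      + (\<Sum>m\<le>d. (t / q) ^ m *s y (int m) *s w (int m))"
    by (simp add: endo_sum[OF endos(3)] endo_scale[OF endos(3)] band_apply[OF x23] scale_right_distrib sum.distrib)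
  also have "(\<Sum>m\<le>d. (t / q) ^ m *s (q * D * (1 - y (int m) / (q^2 * D)) / t) *s w (int m - 1))
      = (\<Sum>m\<le>Suc d. (t / q) ^ m *s (q * D * (1 - y (int m) / (q^2 * D)) / t) *s w (int m - 1))"
    using y_succ[of "int d"] y_d nz by (simp add: add.commute)
  also have "\<dots> = (\<Sum>m\<le>d. (t / q) ^ Suc m *s (q * D * (1 - y (int (Suc m)) / (q^2 * D)) / t) *s w (int m))"
    unfolding sum.atMost_Suc_shift using w_outside[of "-1"] by simp
  also have "\<dots> + (\<Sum>m\<le>d. (t / q) ^ m *s y (int m) *s w (int m)) = (\<Sum>m\<le>d. ((t / q) ^ m * D) *s w (int m))"
    unfolding sum.distrib[symmetric]
  proof (intro sum.cong refl)
    fix m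
    have "(t / q) ^ Suc m * (q * D * (1 - y (int (Suc m)) / (q^2 * D)) / t) + (t / q) ^ m * y (int m) = (t / q) ^ m * D"
      using y_succ[of "int m"] nz by (simp add: field_simps add.commute)
    then show "(t / q) ^ Suc m *s (q * D * (1 - y (int (Suc m)) / (q^2 * D)) / t) *s w (int m) + (t / q) ^ m *s y (int m) *s w (int m)
        = ((t / q) ^ m * D) *s w (int m)"
      by (simp only: scale_scale scale_left_distrib[symmetric])
  qed
  also have "\<dots> = (1 / y (int 0)) *s v_nat 0"
    by (simp add: y_0 scale_sum_right mult.commute)
  finally show ?case .
next
  case (Suc n)
  let ?u = "v_nat n"
  have "x23 (x31 ?u - y (int n) *s ?u) = (inverse (q^2) * (1 / y (int n))) *s (x31 ?u - y (int n) *s ?u)"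
    using nz
    by (simp add: endo_diff[OF endos(3)] endo_scale[OF endos(3)] q_weyl_swap[OF q0 weyl_23_31] Suc
        endo_scale[OF endos(5)] algebra_simps)
  moreover have "1 / y (int (Suc n)) = inverse (q^2) * (1 / y (int n))"
    using y_succ[of "int n"] nz by (simp add: add.commute field_simps)
  ultimately show ?case by (simp add: endo_scale[OF endos(3)] mult.commute)
qed

lemma v_outside: "k < 0 \<or> int d < k \<Longrightarrow> v k = 0" and v_of_nat: "n \<le> d \<Longrightarrow> v (int n) = v_nat n"
  by (auto simp: v_def)

lemma v_int_basis: "int_basis d v"
proof -
  have "is_basis d (\<lambda>n. v (int n))"
    by (rule eigenvectors_is_basis[OF w_basis endos(3), where \<mu> = "\<lambda>n. 1 / y (int n)"])
      (auto simp: v_of_nat x23_v_nat v_nat_nonzero inj_on_def y_eq_iff)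
  then show ?thesis by (auto simp: int_basis_def v_outside)
qed

lemma x23_v: "band v x23 (\<lambda>_. 0) (\<lambda>n. 1 / y n) (\<lambda>_. 0)"
proof (rule bandI[OF v_outside endos(3)])
  fix n assume "0 \<le> n" "n \<le> int d"
  then show "x23 (v n) = 0 *s v (n - 1) + (1 / y n) *s v n + 0 *s v (n + 1)"
    using x23_v_nat[of "nat n"] by (simp add: v_def)
qed simp_all

lemma x31_v: "band v x31 (\<lambda>_. 0) y (\<lambda>n. 1 / D - q^2 * y n)"
proof (rule bandI[OF v_outside endos(5)])
  fix n assume n: "0 \<le> n" "n \<le> int d"
  have "(1 / D - q^2 * y n) *s v_nat (Suc (nat n)) = x31 (v_nat (nat n)) - y n *s v_nat (nat n)"
    using v_step_nonzero[of "nat n"] n by simp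
  moreover have "v (n + 1) = v_nat (Suc (nat n))"
  proof (cases "n = int d")
    case True
    then show ?thesis by (simp add: v_nat_end v_outside del: v_nat.simps)
  next
    case False
    then show ?thesis using n by (simp add: v_def nat_add_distrib del: v_nat.simps)
  qed
  moreover have "v n = v_nat (nat n)" using n by (simp add: v_def)
  ultimately show "x31 (v n) = 0 *s v (n - 1) + y n *s v n + (1 / D - q^2 * y n) *s v (n + 1)"
    by (simp del: v_nat.simps)
qed (simp_all add: y_minus_1)

lemma x12_v_0: "x12 (v_nat 0) = y 0 *s v_nat 0"
proof -
  have wd: "w (int (Suc d)) = 0" by (rule w_outside) simp
  let ?e = "\<lambda>m. (t / q) ^ m * (t * (1 - q^2 * D * y (int m)) / (q * D))"
  have "x12 (v_nat 0) = (\<Sum>m\<le>d. ((t / q) ^ m * y (int m)) *s w (int m)) + (\<Sum>m\<le>d. ?e m *s w (int (Suc m)))"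
    by (simp add: endo_sum[OF endos(2)] endo_scale[OF endos(2)] band_apply[OF x12] scale_right_distrib sum.distrib add.commute)
  also have "(\<Sum>m\<le>d. ?e m *s w (int (Suc m))) = (\<Sum>m\<le>d. (case m of 0 \<Rightarrow> 0 | Suc j \<Rightarrow> ?e j) *s w (int m))"
    by (rule sum_shift_basis[of "\<lambda>k. w (int k)", OF wd])
  also have "(\<Sum>m\<le>d. ((t / q) ^ m * y (int m)) *s w (int m)) + \<dots> = (\<Sum>m\<le>d. (y 0 * (t / q) ^ m) *s w (int m))"
    unfolding sum.distrib[symmetric] scale_left_distrib[symmetric]
  proof (intro sum.cong refl arg_cong2[where f = scale])
    fix m
    show "(t / q) ^ m * y (int m) + (case m of 0 \<Rightarrow> 0 | Suc j \<Rightarrow> ?e j) = y 0 * (t / q) ^ m"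
    proof (cases m)
      case (Suc j)
      have "y (int (Suc j)) = q^2 * y (int j)" using y_succ[of "int j"] by (simp add: add.commute)
      then show ?thesis using nz by (simp add: Suc y_0 field_simps)
    qed simp
  qed
  finally show ?thesis by (simp add: scale_sum_right)
qed

text \<open>
  Induction along the recursion: the \<open>q\<close>-Weyl relation of \<open>x31\<close> and \<open>x12\<close> transports the action of \<open>x12\<close> from
  \<open>v\<^sub>n\<close> to \<open>v\<^sub>n\<^sub>+\<^sub>1\<close>.
\<close>

lemma x12_v: "band v x12 (\<lambda>n. D - y n / q^2) y (\<lambda>_. 0)"
proof (rule bandI[OF v_outside endos(2)])
  have *: "n \<le> d \<Longrightarrow> x12 (v (int n)) = (D - y (int n) / q^2) *s v (int n - 1) + y (int n) *s v (int n)" for n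
  proof (induction n)
    case 0
    then show ?case using x12_v_0 v_of_nat[of 0] by (simp add: v_outside)
  next
    case (Suc n)
    define u where "u = v (int n)"
    have IH: "x12 u = (D - y (int n) / q^2) *s v (int n - 1) + y (int n) *s u"
      using Suc by (simp add: u_def)
    let ?e = "1 / D - q^2 * y (int n)"
    have e: "?e *s v (int n + 1) = x31 u - y (int n) *s u"
      using band_apply[OF x31_v, of "int n"] by (simp add: u_def)
    have x31u: "x31 u = y (int n) *s u + ?e *s v (int n + 1)"
      using e by simp
    have x31u': "x31 (v (int n - 1)) = (y (int n) / q^2) *s v (int n - 1) + (1 / D - y (int n)) *s u"
      using band_apply[OF x31_v, of "int n - 1"] q0 by (simp add: u_def y_pred)
    have swap: "x12 (x31 u) = q^2 *s x31 (x12 u) - (q^2 - 1) *s u"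
    proof -
      have "q^2 *s x31 (x12 u) = (q^2 * (1 - inverse (q^2))) *s u + (q^2 * inverse (q^2)) *s x12 (x31 u)"
        by (simp add: q_weyl_swap[OF q0 weyl_31_12, of u] scale_right_distrib)
      then show ?thesis using q0 by (simp add: right_diff_distrib)
    qed
    \<comment> \<open>The vector identity behind the induction step, with \<open>k = q^2\<close> and the coefficients kept abstract.\<close>
    have expand: "k *s (f *s (g *s V + h *s U) + z *s (z *s U + e *s W)) - (k - 1) *s U - z *s (f *s V + z *s U)
        = (k * (f * g) - z * f) *s V + (k * (f * h) + k * z * z - (k - 1) - z * z) *s U + (k * z * e) *s W"
      for k f g h z e U V W
      by (simp add: algebra_simps)
    have coeff: "q^2 * ((D - y (int n) / q^2) * (1 / D - y (int n))) + q^2 * y (int n) * y (int n) - (q^2 - 1) - y (int n) * y (int n)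
        = ?e * (D - y (int n))"
      using nz by (simp add: field_simps eval_nat_numeral)
    have "?e *s x12 (v (int n + 1)) = x12 (?e *s v (int n + 1))"
      by (simp only: endo_scale[OF endos(2)])
    also have "\<dots> = q^2 *s x31 (x12 u) - (q^2 - 1) *s u - y (int n) *s x12 u"
      by (simp only: e endo_diff[OF endos(2)] endo_scale[OF endos(2)] swap)
    also have "\<dots> = (q^2 * ((D - y (int n) / q^2) * (y (int n) / q^2)) - y (int n) * (D - y (int n) / q^2)) *s v (int n - 1)
        + (q^2 * ((D - y (int n) / q^2) * (1 / D - y (int n))) + q^2 * y (int n) * y (int n) - (q^2 - 1) - y (int n) * y (int n)) *s u
        + (q^2 * y (int n) * ?e) *s v (int n + 1)"
      unfolding IH endo_add[OF endos(5)] endo_scale[OF endos(5)] x31u x31u' by (rule expand)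
    also have "q^2 * ((D - y (int n) / q^2) * (y (int n) / q^2)) - y (int n) * (D - y (int n) / q^2) = 0"
      using q0 by (simp add: field_simps)
    also have "0 *s v (int n - 1)
        + (q^2 * ((D - y (int n) / q^2) * (1 / D - y (int n))) + q^2 * y (int n) * y (int n) - (q^2 - 1) - y (int n) * y (int n)) *s u
        + (q^2 * y (int n) * ?e) *s v (int n + 1) = ?e *s ((D - y (int n)) *s u + (q^2 * y (int n)) *s v (int n + 1))"
      unfolding coeff by (simp add: scale_right_distrib mult_ac)
    finally have "x12 (v (int n + 1)) = (D - y (int n)) *s u + (q^2 * y (int n)) *s v (int n + 1)"
      using v_step_nonzero[of n] by (simp only: scale_cancel_left) simp
    then show ?case using q0 y_succ[of "int n"] by (simp add: u_def add.commute)
  qed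
  fix n assume "0 \<le> n" "n \<le> int d"
  then show "x12 (v n) = (D - y n / q^2) *s v (n - 1) + y n *s v n + 0 *s v (n + 1)"
    using *[of "nat n"] by simp
qed (simp_all add: y_succ y_d q0)

lemma x30_v: "band v x30 (\<lambda>_. 0) y (\<lambda>n. (1 / D - q^2 * y n) * (1 - t / (q * y n)))"
proof -
  have "x30 = (\<lambda>x. x31 x - (t / q) *s (x31 (x23 x) - x))" using x30_via_x31 by auto
  moreover have "band v (\<lambda>x. x31 x - (t / q) *s (x31 (x23 x) - x)) (\<lambda>_. 0) y (\<lambda>n. (1 / D - q^2 * y n) * (1 - t / (q * y n)))"
    by (rule penta_cong[OF penta_diff[OF x31_v penta_scale[OF penta_diff[OF band_comp[OF x31_v x23_v] band_id]]]])
      (simp_all add: nz field_simps)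
  ultimately show ?thesis by metis
qed

text \<open>
  Here \<open>x01\<close> is expressed through \<open>x23\<close>, \<open>x30\<close> and \<open>x12\<close> by \<open>evaluation_30_12\<close>.
\<close>

lemma x01_v: "band v x01 (\<lambda>n. (y n / q^2 - D) * y n / (q * t))
   (\<lambda>n. 1 / D - (y n - D) * y n * q / t - (1 / D - y n) * (1 - y n / (q * t)))
   (\<lambda>n. (1 / D - q^2 * y n) * (1 - q * y n / t))"
proof -
  have x01_eq: "x01 = (\<lambda>x. x23 x + inverse (q - inverse q) *s (inverse t *s (x30 (x12 x) - x12 (x30 x))))"
  proof
    fix x
    have "inverse k * (inverse t * (t * k)) = 1" if "k \<noteq> 0" for k
      using t0 that by (simp add: field_simps)
    then have "inverse (q - inverse q) * (inverse t * (t * (q - inverse q))) = 1"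
      using q_minus_nonzero .
    then show "x01 x = x23 x + inverse (q - inverse q) *s (inverse t *s (x30 (x12 x) - x12 (x30 x)))"
      by (simp only: evaluation_30_12 scale_scale scale_one) simp
  qed
  have *: "X + inverse (q - inverse q) * Y = Z" if "Y = (q - inverse q) * (Z - X)" for X Y Z
    unfolding that mult.assoc[symmetric] left_inverse[OF q_minus_nonzero] by simp
  have "band v (\<lambda>x. x23 x + inverse (q - inverse q) *s (inverse t *s (x30 (x12 x) - x12 (x30 x))))
   (\<lambda>n. (y n / q^2 - D) * y n / (q * t))
   (\<lambda>n. 1 / D - (y n - D) * y n * q / t - (1 / D - y n) * (1 - y n / (q * t)))
   (\<lambda>n. (1 / D - q^2 * y n) * (1 - q * y n / t))"
    by (rule penta_cong[OF penta_add[OF x23_v penta_scale[OF penta_scale[OF penta_diff[OF band_comp[OF x30_v x12_v] band_comp[OF x12_v x30_v]]]]]]; (rule *)?)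
      (simp_all add: y_simps nz field_simps eval_nat_numeral)
  then show ?thesis using x01_eq by metis
qed


text \<open>
  The superdiagonal of the matrix \<open>L_q(t)\<close>.
\<close>

definition x02_lower :: "int \<Rightarrow> 'a" where
  "x02_lower n = (D - y n / q^2) / (1 - t * q / y n)"

text \<open>
  On an eigenbasis of the bidiagonal operator \<open>x02\<close> its inverse is diagonal as well.
\<close>

lemma x02_x20_exist:
  obtains x02 x20 z where "band v x02 x02_lower y (\<lambda>_. 0)" "\<And>x. x20 (x02 x) = x" "\<And>x. x02 (x20 x) = x"
    and "eigenbasis d x02 (\<lambda>n. y (int d - int n)) z" "eigenbasis d x20 (\<lambda>n. 1 / y (int d - int n)) z"
proof -
  obtain x02 where x02: "band v x02 x02_lower y (\<lambda>_. 0)"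
    using band_exists[OF v_int_basis, of x02_lower "\<lambda>_. 0" y] by (auto simp: x02_lower_def y_succ y_d q0)
  note e02 = penta_endo[OF x02]
  have inj: "inj_on (\<lambda>n. y (int d - int n)) {..d}" "inj_on (\<lambda>n. 1 / y (int d - int n)) {..d}"
    by (auto simp: inj_on_def y_eq_iff)
  obtain z where z: "eigenbasis d x02 (\<lambda>n. y (int d - int n)) z"
    by (rule upper_band_eigenbasis[OF v_int_basis x02 inj(1)])
  then have zb: "is_basis d z" and x02z: "\<And>n. n \<le> d \<Longrightarrow> x02 (z n) = y (int d - int n) *s z n"
    by (auto simp: eigenbasis_def)
  obtain x20 where e20: "endo x20" and x20z: "\<And>n. n \<le> d \<Longrightarrow> x20 (z n) = (1 / y (int d - int n)) *s z n"
    using endo_exists[OF zb, of "\<lambda>n. (1 / y (int d - int n)) *s z n"] by blast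
  have "x20 \<circ> x02 = id" "x02 \<circ> x20 = id"
    by (rule endo_eqI[OF zb endo_comp[OF e20 e02] endo_id], simp add: x02z x20z endo_scale[OF e20] y0,
        rule endo_eqI[OF zb endo_comp[OF e02 e20] endo_id], simp add: x02z x20z endo_scale[OF e02] y0)
  then have "x20 (x02 x) = x" "x02 (x20 x) = x" for x
    by (auto simp: fun_eq_iff)
  moreover have "eigenbasis d x20 (\<lambda>n. 1 / y (int d - int n)) z"
    using e20 zb inj(2) x20z by (simp add: eigenbasis_def)
  ultimately show ?thesis using that[OF x02] z by blast
qed

lemma denominator_nonzero: "1 \<le> n \<Longrightarrow> n \<le> int d \<Longrightarrow> y n \<noteq> t * q"
  using tq[of n] q0 by (auto simp: field_simps)

lemma x02_lower_eq: "1 \<le> n \<Longrightarrow> n \<le> int d \<Longrightarrow> x02_lower n * (y n - t * q) = (D - y n / q^2) * y n"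
  using denominator_nonzero[of n] nz by (simp add: x02_lower_def divide_simps)

lemma x02_lower_eq_pred:
  assumes n: "2 \<le> n" "n \<le> int d"
  shows "(D - y n / q^4) * y n = x02_lower (n - 1) * (y n - t * q^3)"
proof -
  have "(D - y n / q^4) * y n = q^2 * ((D - y n / q^2 / q^2) * (y n / q^2))"
    using q0 by (simp add: field_simps eval_nat_numeral)
  also have "\<dots> = q^2 * (x02_lower (n - 1) * (y n / q^2 - t * q))"
    using x02_lower_eq[of "n - 1", unfolded y_pred] n by simp
  also have "\<dots> = x02_lower (n - 1) * (y n - t * q^3)"
    using q0 by (simp add: field_simps eval_nat_numeral)
  finally show ?thesis .
qed

text \<open>
  At the two ends of the range one of the numerators vanishes, so the denominator cancels although it may
  itself be zero there.
\<close>

lemma x02_lower_product: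
  assumes "0 \<le> n" "n \<le> int d + 1"
  shows "x02_lower n * ((1 / D - y n) * (1 - t * q / y n)) = (D - y n / q^2) * (1 / D - y n)"
proof -
  consider "n = 0" | "n = int d + 1" | "1 \<le> n \<and> n \<le> int d" using assms by linarith
  then show ?thesis
  proof cases
    case 1 then show ?thesis by (simp add: y_0)
  next
    case 2 then show ?thesis using q0 by (simp add: x02_lower_def y_succ y_d)
  next
    case 3
    then have "1 - t * q / y n \<noteq> 0" using denominator_nonzero[of n] nz by (simp add: field_simps)
    moreover have "A / k * (e * k) = A * e" if "k \<noteq> 0" for A k e :: 'a using that by simp
    ultimately show ?thesis unfolding x02_lower_def by blast
  qed
qed

context
  fixes x02 x20 :: "'b \<Rightarrow> 'b"
  assumes x02: "band v x02 x02_lower y (\<lambda>_. 0)"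
    and x20_x02: "\<And>x. x20 (x02 x) = x" and x02_x20: "\<And>x. x02 (x20 x) = x"
begin

lemma endo_x20: "endo x20"
proof (rule endoI)
  have inj: "u = u'" if "x02 u = x02 u'" for u u' using that x20_x02 by metis
  show "x20 (u + u') = x20 u + x20 u'" for u u'
    by (rule inj) (simp add: endo_add[OF penta_endo[OF x02]] x02_x20)
  show "x20 (k *s u) = k *s x20 u" for k u
    by (rule inj) (simp add: endo_scale[OF penta_endo[OF x02]] x02_x20)
qed

lemma weyl_02_23: "q_weyl q x02 x23"
  by (rule q_weylI[OF x02 x23_v v_int_basis]; simp add: y_simps nz field_simps eval_nat_numeral)

lemma weyl_30_02: "q_weyl q x30 x02"
proof (rule q_weylI[OF x30_v x02 v_int_basis])
  fix n assume n: "0 \<le> n" "n \<le> int d"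
  have 1: "x02_lower n * ((1 / D - q^2 * y (n - 1)) * (1 - t / (q * y (n - 1)))) = (D - y n / q^2) * (1 / D - y n)"
    using x02_lower_product[of n] n nz by (simp add: y_pred power2_eq_square)
  have 2: "(1 / D - q^2 * y n) * (1 - t / (q * y n)) * x02_lower (n + 1) = (D - y n) * (1 / D - q^2 * y n)"
    using x02_lower_product[of "n + 1"] n nz by (simp add: y_succ power2_eq_square mult.commute)
  show "q * (x02_lower n * ((1 / D - q^2 * y (n - 1)) * (1 - t / (q * y (n - 1)))) + y n * y n + 0 * 0)
      - inverse q * (0 * 0 + y n * y n + (1 / D - q^2 * y n) * (1 - t / (q * y n)) * x02_lower (n + 1)) = q - inverse q"
    unfolding 1 2 using nz by (simp add: field_simps eval_nat_numeral)
qed (simp_all add: y_simps nz field_simps eval_nat_numeral)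

text \<open>
  The relation between \<open>x12\<close> and \<open>x20\<close> multiplied by \<open>x02\<close> from both sides. In this form only bidiagonal
  matrices occur, whereas \<open>x20\<close> is a full triangular matrix.
\<close>

lemma x02_x12: "q *s x02 (x12 u) - inverse q *s x12 (x02 u) = (q - inverse q) *s x02 (x02 u)"
proof -
  have "(\<lambda>u. q *s x02 (x12 u) - inverse q *s x12 (x02 u)) = (\<lambda>u. (q - inverse q) *s x02 (x02 u))"
  proof (rule penta_eqI[OF v_int_basis penta_diff[OF penta_scale[OF band_comp[OF x02 x12_v]] penta_scale[OF band_comp[OF x12_v x02]]]
        penta_scale[OF band_comp[OF x02 x02]]])
    fix n assume n: "2 \<le> n" "n \<le> int d"
    \<comment> \<open>Both coefficients of \<open>x02\<close> have denominators; the numerators are traded for them.\<close>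
    have N: "(D - y n / q^2) * y n = x02_lower n * (y n - t * q)"
      using x02_lower_eq[of n] n by simp
    have N1: "(D - y n / q^4) * y n = x02_lower (n - 1) * (y n - t * q^3)"
      using n by (rule x02_lower_eq_pred)
    have "y n * (q * ((D - y n / q^2) * x02_lower (n - 1)) - inverse q * (x02_lower n * (D - y n / q^4)))
        = q * x02_lower (n - 1) * ((D - y n / q^2) * y n) - inverse q * x02_lower n * ((D - y n / q^4) * y n)"
      by (simp add: algebra_simps)
    also have "\<dots> = y n * ((q - inverse q) * (x02_lower n * x02_lower (n - 1)))"
      unfolding N N1 using q0 by (simp add: field_simps eval_nat_numeral)
    finally have "q * ((D - y n / q^2) * x02_lower (n - 1)) - inverse q * (x02_lower n * (D - y n / q^4)) = (q - inverse q) * (x02_lower n * x02_lower (n - 1))"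
      by (simp only: mult_cancel_left y0 simp_thms)
    then show "q * ((D - y n / q^2) * x02_lower (n - 1)) - inverse q * (x02_lower n * (D - y (n - 1) / q^2))
        = (q - inverse q) * (x02_lower n * x02_lower (n - 1))"
      by (simp add: y_pred eval_nat_numeral mult.assoc)
  next
    fix n assume n: "1 \<le> n" "n \<le> int d"
    show "q * ((D - y n / q^2) * y (n - 1) + y n * x02_lower n) - inverse q * (x02_lower n * y (n - 1) + y n * (D - y n / q^2))
        = (q - inverse q) * (x02_lower n * y (n - 1) + y n * x02_lower n)"
      using nz by (simp add: y_pred field_simps eval_nat_numeral)
  qed (simp_all add: y_simps nz field_simps eval_nat_numeral)
  then show ?thesis by (simp add: fun_eq_iff)
qed

lemma weyl_12_20: "q_weyl q x12 x20"
proof -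
  have "q *s x12 (x20 u) - inverse q *s x20 (x12 u) = (q - inverse q) *s u" for u
  proof -
    have "x20 ((q - inverse q) *s x02 (x02 (x20 u))) = x20 (q *s x02 (x12 (x20 u)) - inverse q *s x12 (x02 (x20 u)))"
      by (simp only: x02_x12)
    then show ?thesis
      by (simp add: endo_scale[OF endo_x20] endo_diff[OF endo_x20] x20_x02 x02_x20)
  qed
  then show ?thesis by (simp add: q_weyl_def)
qed

text \<open>
  The relation between \<open>x20\<close> and \<open>x01\<close>, multiplied by \<open>x02\<close> from both sides as before.
\<close>

lemma x01_x02: "q *s x01 (x02 u) - inverse q *s x02 (x01 u) = (q - inverse q) *s x02 (x02 u)"
proof -
  have "(\<lambda>u. q *s x01 (x02 u) - inverse q *s x02 (x01 u)) = (\<lambda>u. (q - inverse q) *s x02 (x02 u))"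
  proof (rule penta_eqI[OF v_int_basis penta_diff[OF penta_scale[OF band_comp[OF x01_v x02]] penta_scale[OF band_comp[OF x02 x01_v]]]
        penta_scale[OF band_comp[OF x02 x02]]])
    fix n assume n: "2 \<le> n" "n \<le> int d"
    have N: "(D - y n / q^2) * y n = x02_lower n * (y n - t * q)"
      using x02_lower_eq[of n] n by simp
    have N1: "(D - y n / q^4) * y n = x02_lower (n - 1) * (y n - t * q^3)"
      using n by (rule x02_lower_eq_pred)
    have "q * (x02_lower n * ((y (n - 1) / q^2 - D) * y (n - 1) / (q * t))) - inverse q * ((y n / q^2 - D) * y n / (q * t) * x02_lower (n - 1))
        = (x02_lower (n - 1) * ((D - y n / q^2) * y n) - x02_lower n * ((D - y n / q^4) * y n)) / (q^2 * t)"
      using nz by (simp add: y_pred field_simps eval_nat_numeral)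
    also have "\<dots> = (q - inverse q) * (x02_lower n * x02_lower (n - 1))"
      unfolding N N1 using nz by (simp add: field_simps eval_nat_numeral)
    finally show "q * (x02_lower n * ((y (n - 1) / q^2 - D) * y (n - 1) / (q * t))) - inverse q * ((y n / q^2 - D) * y n / (q * t) * x02_lower (n - 1))
        = (q - inverse q) * (x02_lower n * x02_lower (n - 1))" .
  next
    fix n assume n: "1 \<le> n" "n \<le> int d"
    let ?m = "\<lambda>n. 1 / D - (y n - D) * y n * q / t - (1 / D - y n) * (1 - y n / (q * t))"
    have "(y n / q^2 - D) * y n = - (x02_lower n * (y n - t * q))"
      using x02_lower_eq[of n] n by (simp add: algebra_simps)
    then have l01: "(y n / q^2 - D) * y n / (q * t) = - (x02_lower n * (y n - t * q)) / (q * t)"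
      by (simp only:)
    show "q * (x02_lower n * ?m (n - 1) + y n * ((y n / q^2 - D) * y n / (q * t))) - inverse q * ((y n / q^2 - D) * y n / (q * t) * y (n - 1) + ?m n * x02_lower n)
        = (q - inverse q) * (x02_lower n * y (n - 1) + y n * x02_lower n)"
      unfolding l01 y_pred using nz by (simp add: field_simps eval_nat_numeral)
  next
    fix n assume n: "0 \<le> n" "n \<le> int d"
    let ?m = "\<lambda>n. 1 / D - (y n - D) * y n * q / t - (1 / D - y n) * (1 - y n / (q * t))"
    have 1: "x02_lower n * ((1 / D - q^2 * y (n - 1)) * (1 - q * y (n - 1) / t)) = - (y n / (q * t)) * ((D - y n / q^2) * (1 / D - y n))"
    proof -
      have "(D - y n / q^2) * (1 / D - y n) = x02_lower n * ((1 / D - y n) * (1 - t * q / y n))"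
        using x02_lower_product[of n, symmetric] n by simp
      then show ?thesis using nz by (simp only:) (simp add: y_pred field_simps eval_nat_numeral)
    qed
    have 2: "(1 / D - q^2 * y n) * (1 - q * y n / t) * x02_lower (n + 1) = - (q * y n / t) * ((D - y n) * (1 / D - q^2 * y n))"
    proof -
      have "(D - y n) * (1 / D - q^2 * y n) = x02_lower (n + 1) * ((1 / D - q^2 * y n) * (1 - t / (q * y n)))"
        using x02_lower_product[of "n + 1", symmetric] n nz by (simp add: y_succ power2_eq_square)
      then show ?thesis using nz by (simp only:) (simp add: field_simps eval_nat_numeral)
    qed
    show "q * (x02_lower n * ((1 / D - q^2 * y (n - 1)) * (1 - q * y (n - 1) / t)) + y n * ?m n + 0 * ((y (n + 1) / q^2 - D) * y (n + 1) / (q * t)))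
        - inverse q * ((y n / q^2 - D) * y n / (q * t) * 0 + ?m n * y n + (1 / D - q^2 * y n) * (1 - q * y n / t) * x02_lower (n + 1))
        = (q - inverse q) * (x02_lower n * 0 + y n * y n + 0 * x02_lower (n + 1))"
      unfolding 1 2 using nz by (simp add: field_simps eval_nat_numeral)
  qed (simp_all add: y_simps nz field_simps eval_nat_numeral)
  then show ?thesis by (simp add: fun_eq_iff)
qed

lemma weyl_20_01: "q_weyl q x20 x01"
proof -
  have "q *s x20 (x01 u) - inverse q *s x01 (x20 u) = (q - inverse q) *s u" for u
  proof -
    have "x20 ((q - inverse q) *s x02 (x02 (x20 u))) = x20 (q *s x01 (x02 (x20 u)) - inverse q *s x02 (x01 (x20 u)))"
      by (simp only: x01_x02)
    then show ?thesis
      by (simp add: endo_scale[OF endo_x20] endo_diff[OF endo_x20] x20_x02 x02_x20)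
  qed
  then show ?thesis by (simp add: q_weyl_def)
qed

end

end

section \<open>The matrices of the definition\<close>

lemma Zmat_conjugate:
  assumes M: "M \<in> carrier_mat (d + 1) (d + 1)"
  shows "Zmat d * M * Zmat d = mat (d + 1) (d + 1) (\<lambda>(i, j). M $$ (d - i, d - j))"
proof (rule eq_matI)
  fix i j assume "i < dim_row (mat (d + 1) (d + 1) (\<lambda>(i, j). M $$ (d - i, d - j)))"
    "j < dim_col (mat (d + 1) (d + 1) (\<lambda>(i, j). M $$ (d - i, d - j)))"
  then have ij: "i \<le> d" "j \<le> d" by auto
  have left: "(Zmat d * M) $$ (i, k) = M $$ (d - i, k)" if "k \<le> d" for k
  proof -
    have "(Zmat d * M) $$ (i, k) = (\<Sum>l\<in>{0..<d + 1}. (if i + l = d then 1 else 0) * M $$ (l, k))"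
      using M ij that by (auto simp: Zmat_def scalar_prod_def intro!: sum.cong)
    also have "\<dots> = (\<Sum>l\<in>{0..<d + 1}. if l = d - i then M $$ (l, k) else 0)"
      using ij by (intro sum.cong) auto
    finally show ?thesis by simp
  qed
  have "(Zmat d * M * Zmat d) $$ (i, j) = (\<Sum>l\<in>{0..<d + 1}. (Zmat d * M) $$ (i, l) * (if l + j = d then 1 else 0))"
    using M ij by (auto simp: Zmat_def scalar_prod_def intro!: sum.cong)
  also have "\<dots> = (\<Sum>l\<in>{0..<d + 1}. if l = d - j then M $$ (d - i, l) else 0)"
    using ij by (intro sum.cong) (auto simp: left)
  finally show "(Zmat d * M * Zmat d) $$ (i, j) = mat (d + 1) (d + 1) (\<lambda>(i, j). M $$ (d - i, d - j)) $$ (i, j)"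
    using ij by simp
qed (use M in \<open>auto simp: Zmat_def\<close>)

definition band_mat :: "nat \<Rightarrow> (int \<Rightarrow> 'a::zero) \<Rightarrow> (int \<Rightarrow> 'a) \<Rightarrow> (int \<Rightarrow> 'a) \<Rightarrow> 'a mat" where
  "band_mat d l m r = mat (d + 1) (d + 1) (\<lambda>(i, j).
     if i + 1 = j then l (int j) else if i = j then m (int j) else if i = j + 1 then r (int j) else 0)"

lemma band_mat_conjugate:
  "Zmat d * band_mat d l m r * Zmat d
    = band_mat d (\<lambda>n. r (int d - n)) (\<lambda>n. m (int d - n)) (\<lambda>n. l (int d - n :: int) :: 'a::field)"
proof -
  have carr: "band_mat d l m r \<in> carrier_mat (d + 1) (d + 1)" by (simp add: band_mat_def)
  have "band_mat d l m r $$ (d - i, d - j) =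
      (if i + 1 = j then r (int d - int j) else if i = j then m (int d - int j)
       else if i = j + 1 then l (int d - int j) else 0)" if "i \<le> d" "j \<le> d" for i j
  proof -
    have "d - i + 1 = d - j \<longleftrightarrow> i = j + 1" "d - i = d - j \<longleftrightarrow> i = j" "d - i = d - j + 1 \<longleftrightarrow> i + 1 = j"
      using that by auto
    moreover have "int (d - j) = int d - int j" using that by (rule_tac of_nat_diff)
    ultimately show ?thesis by (simp add: band_mat_def)
  qed
  then show ?thesis
    unfolding Zmat_conjugate[OF carr] band_mat_def[of d "\<lambda>n. r (int d - n)"]
    by (intro eq_matI) simp_all
qed

lemma band_mat_cong:
  assumes "\<And>n. l n = l' n" "\<And>n. m n = m' n" "\<And>n. r n = r' n"
  shows "band_mat d l m r = band_mat d l' m' r'"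
proof -
  have "l = l'" "m = m'" "r = r'" using assms by auto
  then show ?thesis by simp
qed

lemmas qy_simps = qy_def power_int_add power_int_diff power_int_minus

lemma powi_qy:
  assumes "q \<noteq> 0"
  shows "q powi (2 * int n - int d) = qy q d (int n)" "q powi (int d - 2 * int n) = 1 / qy q d (int n)"
    "q powi (2 * int n - 2 - int d) = qy q d (int n) / q^2" "q powi (2 * int n - int d - 2) = qy q d (int n) / q^2"
    "q powi (2 * int n - int d - 1) = qy q d (int n) / q" "q powi (2 * int n - int d + 1) = qy q d (int n) * q"
    "q powi (int d - 2 * int n + 1) = q / qy q d (int n)" "q powi (- int d) = 1 / q powi int d"
  using assms by (simp_all add: qy_simps divide_inverse)

lemma Kmat_band: "q \<noteq> 0 \<Longrightarrow> Kmat d q = band_mat d (\<lambda>_. 0) (\<lambda>n. 1 / qy q d n) (\<lambda>_. 0)"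
  by (rule eq_matI) (auto simp: Kmat_def band_mat_def powi_qy)

lemma Emat_band: "q \<noteq> 0 \<Longrightarrow> Emat d q = band_mat d (\<lambda>n. q powi int d - qy q d n / q^2) (qy q d) (\<lambda>_. 0)"
  by (rule eq_matI) (auto simp: Emat_def band_mat_def powi_qy simp del: of_nat_Suc)

lemma Lmat_band: "q \<noteq> 0 \<Longrightarrow> Lmat d q t
    = band_mat d (\<lambda>n. (q powi int d - qy q d n / q^2) / (1 - t * q / qy q d n)) (qy q d) (\<lambda>_. 0)"
  by (rule eq_matI) (auto simp: Lmat_def band_mat_def powi_qy divide_inverse[of _ "1 - _"] simp del: of_nat_Suc)

lemma Gmat_band: "q \<noteq> 0 \<Longrightarrow> Gmat d q t
    = band_mat d (\<lambda>n. (q powi int d - qy q d n / q^2) * (1 - t * q / qy q d n)) (qy q d) (\<lambda>_. 0)"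
  by (rule eq_matI) (auto simp: Gmat_def band_mat_def powi_qy simp del: of_nat_Suc)

lemma Smat_band:
  assumes q: "q \<noteq> 0"
  shows "Smat d q t = band_mat d (\<lambda>n. (q powi int d - qy q d n / q^2) * (1 - t * qy q d n / q))
     (\<lambda>n. q powi int d - (qy q d n - 1 / q powi int d) * qy q d n * t / q - (q powi int d - qy q d n) * (1 - t * qy q d n * q))
     (\<lambda>n. (q^2 * qy q d n - 1 / q powi int d) * q * qy q d n * t)"
proof -
  have **: "qy q d (int (Suc n)) = q^2 * qy q d (int n)" for n
    using qy_succ[OF q, of d "int n"] by (simp add: add.commute)
  have r: "(qy q d (int (Suc n)) - X) * qy q d (int (Suc n)) * t / q = (q^2 * qy q d (int n) - X) * q * qy q d (int n) * t" for n X
    unfolding ** using q by (simp add: power2_eq_square)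
  show ?thesis
  proof (rule eq_matI)
    fix i j assume ij: "i < dim_row (band_mat d (\<lambda>n. (q powi int d - qy q d n / q^2) * (1 - t * qy q d n / q))
     (\<lambda>n. q powi int d - (qy q d n - 1 / q powi int d) * qy q d n * t / q - (q powi int d - qy q d n) * (1 - t * qy q d n * q))
     (\<lambda>n. (q^2 * qy q d n - 1 / q powi int d) * q * qy q d n * t))"
     "j < dim_col (band_mat d (\<lambda>n. (q powi int d - qy q d n / q^2) * (1 - t * qy q d n / q))
     (\<lambda>n. q powi int d - (qy q d n - 1 / q powi int d) * qy q d n * t / q - (q powi int d - qy q d n) * (1 - t * qy q d n * q))
     (\<lambda>n. (q^2 * qy q d n - 1 / q powi int d) * q * qy q d n * t))"
    then have le: "i \<le> d" "j \<le> d" by (auto simp: band_mat_def)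
    consider "j = Suc i" | "i = Suc j" | "i = j" | "Suc i \<noteq> j \<and> i \<noteq> Suc j \<and> i \<noteq> j" by blast
    then show "Smat d q t $$ (i, j) = band_mat d (\<lambda>n. (q powi int d - qy q d n / q^2) * (1 - t * qy q d n / q))
     (\<lambda>n. q powi int d - (qy q d n - 1 / q powi int d) * qy q d n * t / q - (q powi int d - qy q d n) * (1 - t * qy q d n * q))
     (\<lambda>n. (q^2 * qy q d n - 1 / q powi int d) * q * qy q d n * t) $$ (i, j)"
      using le by cases (simp_all add: Smat_def band_mat_def powi_qy[OF q] r del: of_nat_add of_nat_Suc)
  qed (simp_all add: Smat_def band_mat_def)
qed

context qtet_space
begin

lemma represents_comp:
  assumes M: "represents d b M f" and N: "represents d b N g" and f: "endo f"
  shows "represents d b (M * N) (\<lambda>x. f (g x))"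
proof -
  have carr: "M \<in> carrier_mat (d + 1) (d + 1)" "N \<in> carrier_mat (d + 1) (d + 1)"
    using M N by (auto simp: represents_def)
  have "f (g (b n)) = (\<Sum>i\<le>d. (M * N) $$ (i, n) *s b i)" if n: "n \<le> d" for n
  proof -
    have "f (g (b n)) = (\<Sum>k\<le>d. N $$ (k, n) *s (\<Sum>i\<le>d. M $$ (i, k) *s b i))"
      using M N n by (simp add: represents_def endo_sum[OF f] endo_scale[OF f])
    also have "\<dots> = (\<Sum>k\<le>d. \<Sum>i\<le>d. (M $$ (i, k) * N $$ (k, n)) *s b i)"
      by (simp add: scale_sum_right mult.commute)
    also have "\<dots> = (\<Sum>i\<le>d. \<Sum>k\<le>d. (M $$ (i, k) * N $$ (k, n)) *s b i)"
      by (rule sum.swap)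
    also have "\<dots> = (\<Sum>i\<le>d. (M * N) $$ (i, n) *s b i)"
    proof (rule sum.cong[OF refl])
      fix i assume "i \<in> {..d}"
      then have "(M * N) $$ (i, n) = (\<Sum>k\<in>{0..<d + 1}. M $$ (i, k) * N $$ (k, n))"
        using carr n by (auto simp: scalar_prod_def intro!: sum.cong)
      also have "{0..<d + 1} = {..d}" by auto
      finally show "(\<Sum>k\<le>d. (M $$ (i, k) * N $$ (k, n)) *s b i) = (M * N) $$ (i, n) *s b i"
        by (simp add: scale_sum_left)
    qed
    finally show ?thesis .
  qed
  then show ?thesis using carr by (simp add: represents_def)
qed

lemma represents_unique:
  assumes b: "is_basis d b" and M: "represents d b M f" and N: "represents d b N f"
  shows "M = N"
proof (rule eq_matI)
  have carr: "M \<in> carrier_mat (d + 1) (d + 1)" "N \<in> carrier_mat (d + 1) (d + 1)"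
    using M N by (auto simp: represents_def)
  fix i j assume "i < dim_row N" "j < dim_col N"
  then have ij: "i \<le> d" "j \<le> d" using carr by auto
  then have "(\<Sum>i\<le>d. M $$ (i, j) *s b i) = (\<Sum>i\<le>d. N $$ (i, j) *s b i)"
    using M N unfolding represents_def by metis
  then show "M $$ (i, j) = N $$ (i, j)"
    using basis_coeff_eq[OF b _ ij(1), of "\<lambda>i. M $$ (i, j)" "\<lambda>i. N $$ (i, j)"] by simp
qed (use M N in \<open>auto simp: represents_def\<close>)

lemma represents_exists:
  assumes b: "is_basis d b"
  obtains M where "represents d b M f"
proof -
  have "\<exists>c. f (b n) = (\<Sum>i\<le>d. c i *s b i)" for n
    using basis_expand[OF b] by metis
  then obtain c where "\<And>n. f (b n) = (\<Sum>i\<le>d. c n i *s b i)" by metis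
  then have "represents d b (mat (d + 1) (d + 1) (\<lambda>(i, n). c n i)) f"
    by (simp add: represents_def)
  then show ?thesis by (rule that)
qed

lemma represents_one: "represents d b (1\<^sub>m (d + 1)) (\<lambda>x. x)"
proof -
  have "b n = (\<Sum>i\<le>d. (1\<^sub>m (d + 1)) $$ (i, n) *s b i)" if "n \<le> d" for n
  proof -
    have "(\<Sum>i\<le>d. (1\<^sub>m (d + 1)) $$ (i, n) *s b i) = (\<Sum>i\<le>d. if i = n then b i else 0)"
      using that by (intro sum.cong) auto
    then show ?thesis using that by simp
  qed
  then show ?thesis by (simp add: represents_def)
qed

text \<open>
  The matrix of the inverse operator is a two-sided inverse of \<open>M\<close>, so \<open>mat_inverse\<close> does not
  fail and returns that matrix.
\<close>

lemma represents_mat_inverse: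
  assumes b: "is_basis d b" and M: "represents d b M f" and f: "endo f" and g: "endo g"
    and fg: "\<And>x. f (g x) = x" and gf: "\<And>x. g (f x) = x"
  shows "represents d b (the (mat_inverse M)) g"
proof -
  obtain N where N: "represents d b N g" using represents_exists[OF b] .
  have carr: "M \<in> carrier_mat (d + 1) (d + 1)" "N \<in> carrier_mat (d + 1) (d + 1)"
    using M N by (auto simp: represents_def)
  have "represents d b (M * N) (\<lambda>x. x)" and "represents d b (N * M) (\<lambda>x. x)"
    using represents_comp[OF M N f] represents_comp[OF N M g] by (simp_all add: fg gf)
  note this[THEN represents_unique[OF b _ represents_one]]
  then have MN: "M * N = 1\<^sub>m (d + 1)" and NM: "N * M = 1\<^sub>m (d + 1)" .
  have "M \<in> Units (ring_mat TYPE('a) (d + 1) undefined)"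
    using carr MN NM by (auto simp: Units_def ring_mat_def)
  then obtain N' where N': "mat_inverse M = Some N'"
    using mat_inverse(1)[OF carr(1)] by fastforce
  then have N'M: "N' * M = 1\<^sub>m (d + 1)" "N' \<in> carrier_mat (d + 1) (d + 1)"
    using mat_inverse(2)[OF carr(1)] by auto
  have "N' = N' * (M * N)" using N'M by (simp add: MN)
  also have "\<dots> = N' * M * N" by (rule assoc_mult_mat[symmetric, OF N'M(2) carr])
  also have "\<dots> = N" unfolding N'M(1) using carr by simp
  finally show ?thesis using N' N by simp
qed

lemma represents_band_mat:
  assumes v: "int_basis d v" and f: "band v f l m r"
  shows "represents d (\<lambda>n. v (int n)) (band_mat d l m r) f"
proof -
  have "f (v (int n)) = (\<Sum>i\<le>d. band_mat d l m r $$ (i, n) *s v (int i))" if n: "n \<le> d" for n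
  proof -
    have "(\<Sum>i\<le>d. band_mat d l m r $$ (i, n) *s v (int i))
        = (\<Sum>i\<le>d. (if i + 1 = n then l (int n) *s v (int n - 1) else 0)
            + (if i = n then m (int n) *s v (int n) else 0) + (if i = n + 1 then r (int n) *s v (int n + 1) else 0))"
      using n by (intro sum.cong) (auto simp: band_mat_def add.commute)
    also have "\<dots> = l (int n) *s v (int n - 1) + m (int n) *s v (int n) + r (int n) *s v (int n + 1)"
    proof -
      have "(\<Sum>i\<le>d. if i + 1 = n then l (int n) *s v (int n - 1) else 0) = l (int n) *s v (int n - 1)"
      proof (cases n)
        case 0
        then show ?thesis using v by (simp add: int_basis_def)
      next
        case (Suc k)
        then show ?thesis using n by simp
      qed
      moreover have "(\<Sum>i\<le>d. if i = n then m (int n) *s v (int n) else 0) = m (int n) *s v (int n)"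
        using n by simp
      moreover have "(\<Sum>i\<le>d. if i = n + 1 then r (int n) *s v (int n + 1) else 0) = r (int n) *s v (int n + 1)"
        using v n by (cases "n = d") (auto simp: int_basis_def)
      ultimately show ?thesis by (simp add: sum.distrib)
    qed
    finally show ?thesis by (simp add: band_apply[OF f])
  qed
  then show ?thesis by (simp add: represents_def band_mat_def)
qed

end

context evaluation_system
begin

text \<open>
  Replacing \<open>q\<close> by \<open>q^-1\<close> inverts the diagonal, and conjugation by \<open>Z\<close> reverses it; together they restore it.
\<close>

lemma inverse_q_simps:
  "inverse q \<noteq> 0" "qy (inverse q) d (int d - n) = y n" "inverse q powi int d = 1 / D" "(inverse q)^2 = 1 / q^2"
  using q0 y_d_minus[of n] by (simp_all add: qy_def power_int_inverse divide_inverse power_inverse)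

lemma Emat_conjugate: "Zmat d * Emat d (inverse q) * Zmat d = band_mat d (\<lambda>_. 0) y (\<lambda>n. 1 / D - q^2 * y n)"
  unfolding Emat_band[OF inverse_q_simps(1)] band_mat_conjugate inverse_q_simps(2-)
  by (rule band_mat_cong) (simp_all add: nz field_simps)

lemma Gmat_conjugate: "Zmat d * Gmat d (inverse q) t * Zmat d
    = band_mat d (\<lambda>_. 0) y (\<lambda>n. (1 / D - q^2 * y n) * (1 - t / (q * y n)))"
  unfolding Gmat_band[OF inverse_q_simps(1)] band_mat_conjugate inverse_q_simps(2-)
  by (rule band_mat_cong) (simp_all add: nz field_simps)

lemma Smat_conjugate: "Zmat d * Smat d (inverse q) (inverse t) * Zmat d
    = band_mat d (\<lambda>n. (y n / q^2 - D) * y n / (q * t))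
       (\<lambda>n. 1 / D - (y n - D) * y n * q / t - (1 / D - y n) * (1 - y n / (q * t)))
       (\<lambda>n. (1 / D - q^2 * y n) * (1 - q * y n / t))"
  unfolding Smat_band[OF inverse_q_simps(1)] band_mat_conjugate inverse_q_simps(2-)
  by (rule band_mat_cong) (simp_all add: nz field_simps power2_eq_square)

lemma Lmat_band_x02: "Lmat d q t = band_mat d x02_lower y (\<lambda>_. 0)"
  by (simp add: Lmat_band[OF q0] x02_lower_def[abs_def])

lemma isomorphic_to_VI:
  assumes \<rho>: "\<rho> (qtet_x q 0 1) = x01" "\<rho> (qtet_x q 1 2) = x12" "\<rho> (qtet_x q 2 3) = x23" "\<rho> (qtet_x q 3 0) = x30"
    "\<rho> (qtet_x q 0 2) = x02" "\<rho> (qtet_x q 1 3) = x13" "\<rho> (qtet_x q 2 0) = x20" "\<rho> (qtet_x q 3 1) = x31"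
    and x02: "band v x02 x02_lower y (\<lambda>_. 0)" and inv: "\<And>x. x20 (x02 x) = x" "\<And>x. x02 (x20 x) = x"
  shows "isomorphic_to_V q \<rho> d t"
proof -
  have b: "is_basis d (\<lambda>n. v (int n))" using v_int_basis by (simp add: int_basis_def)
  note rep = represents_band_mat[OF v_int_basis]
  show ?thesis
    unfolding isomorphic_to_V_def \<rho>
    by (intro exI conjI, rule b, rule rep[OF x01_v, folded Smat_conjugate], rule rep[OF x12_v, folded Emat_band[OF q0]],
        rule rep[OF x23_v, folded Kmat_band[OF q0]], rule rep[OF x30_v, folded Gmat_conjugate],
        rule rep[OF x02, folded Lmat_band_x02],
        rule represents_mat_inverse[OF b rep[OF x31_v, folded Emat_conjugate] endos(5,6) x31_x13 x13_x31],
        rule represents_mat_inverse[OF b rep[OF x02, folded Lmat_band_x02] penta_endo[OF x02] endo_x20[OF x02 inv] inv(2,1)],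
        rule rep[OF x31_v, folded Emat_conjugate])
qed

definition generator :: "('b \<Rightarrow> 'b) \<Rightarrow> ('b \<Rightarrow> 'b) \<Rightarrow> 4 \<Rightarrow> 4 \<Rightarrow> 'b \<Rightarrow> 'b" where
  "generator x02 x20 i j =
     (if (i, j) = (0, 1) then x01 else if (i, j) = (1, 2) then x12 else if (i, j) = (2, 3) then x23
      else if (i, j) = (3, 0) then x30 else if (i, j) = (0, 2) then x02 else if (i, j) = (1, 3) then x13
      else if (i, j) = (2, 0) then x20 else if (i, j) = (3, 1) then x31 else id)"

lemma qtet_relations_generator:
  assumes x02: "band v x02 x02_lower y (\<lambda>_. 0)" and inv: "\<And>x. x20 (x02 x) = x" "\<And>x. x02 (x20 x) = x"
  shows "qtet_relations q (generator x02 x20)"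
proof -
  have step: "j = i + k" if "j - i = k" for i j k :: 4
    using that by (simp add: algebra_simps)
  have "generator x02 x20 i j (generator x02 x20 j i x) = x" if "j - i = 2" for i j x
    using step[OF that] Z4_exhaust[of i] by (auto simp: generator_def inv x13_x31 x31_x13)
  moreover have "q_weyl q (generator x02 x20 i j) (generator x02 x20 j k)"
    if ijk: "(j - i, k - j) \<in> {(1, 1), (1, 2), (2, 1)}" for i j k
  proof -
    have "(j = i + 1 \<and> k = i + 2) \<or> (j = i + 1 \<and> k = i + 3) \<or> (j = i + 2 \<and> k = i + 3)"
      using ijk by (auto simp: algebra_simps)
    then show ?thesis
      using Z4_exhaust[of i]
      by (auto simp: generator_def weyl_01_12 weyl_12_23 weyl_23_30 weyl_30_01 weyl_23_31 weyl_31_12 weyl_01_13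
          weyl_13_30 weyl_02_23[OF x02 inv] weyl_30_02[OF x02 inv] weyl_12_20[OF x02 inv] weyl_20_01[OF x02 inv])
  qed
  moreover have "q_serre q (generator x02 x20 i j) (generator x02 x20 k l)"
    if ijkl: "j - i = 1 \<and> k - j = 1 \<and> l - k = 1" for i j k l
  proof -
    have "j = i + 1 \<and> k = i + 2 \<and> l = i + 3"
      using ijkl by (auto simp: algebra_simps)
    then show ?thesis
      using Z4_exhaust[of i]
      by (auto simp: generator_def serre_01_23 serre_12_30 serre_23_01 serre_30_12)
  qed
  ultimately show ?thesis unfolding qtet_relations_def by blast
qed

end

context qtet_space
begin

section \<open>The spectrum of the generators\<close>

definition q_spectrum :: "'a \<Rightarrow> nat \<Rightarrow> ('b \<Rightarrow> 'b) \<Rightarrow> bool" where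
  "q_spectrum q d f \<longleftrightarrow> diagonalizable f \<and> eigenvalues f = {q powi (int d - 2 * int n) | n. n \<le> d}
     \<and> (\<forall>n\<le>d. dim (eigenspace f (q powi (int d - 2 * int n))) = 1)"

lemma q_spectrumI:
  assumes z: "eigenbasis d f \<mu> z" and \<mu>: "\<mu> ` {..d} = {q powi (int d - 2 * int n) | n. n \<le> d}"
  shows "q_spectrum q d f"
proof -
  have "dim (eigenspace f (q powi (int d - 2 * int n))) = 1" if "n \<le> d" for n
  proof -
    have "q powi (int d - 2 * int n) \<in> \<mu> ` {..d}" using that \<mu> by blast
    then obtain k where "k \<le> d" "q powi (int d - 2 * int n) = \<mu> k" by auto
    then show ?thesis using eigenbasis_dim_eigenspace[OF z] by simp
  qed
  then show ?thesis
    using eigenbasis_diagonalizable[OF z] eigenbasis_eigenvalues[OF z] \<mu> by (simp add: q_spectrum_def)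
qed

section \<open>Uniqueness of the module\<close>

lemma represents_intertwines:
  assumes b: "is_basis d v" and f: "endo f" "represents d v M f" and g: "endo g" "represents d v' M g"
    and \<sigma>: "endo \<sigma>" "\<And>n. n \<le> d \<Longrightarrow> \<sigma> (v n) = v' n"
  shows "\<sigma> (f u) = g (\<sigma> u)"
proof -
  have "\<sigma> \<circ> f = g \<circ> \<sigma>"
  proof (rule endo_eqI[OF b endo_comp[OF \<sigma>(1) f(1)] endo_comp[OF g(1) \<sigma>(1)]])
    fix n assume n: "n \<le> d"
    then have "f (v n) = (\<Sum>i\<le>d. M $$ (i, n) *s v i)" "g (v' n) = (\<Sum>i\<le>d. M $$ (i, n) *s v' i)"
      using f g by (simp_all add: represents_def)
    then show "(\<sigma> \<circ> f) (v n) = (g \<circ> \<sigma>) (v n)"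
      using n by (simp add: endo_sum[OF \<sigma>(1)] endo_scale[OF \<sigma>(1)] \<sigma>(2))
  qed
  then show ?thesis by (simp add: fun_eq_iff)
qed

lemma compatible_ops:
  assumes "compatible_evaluation_module q t a b A B \<rho>"
  shows "qtet_module q \<rho>"
    and "A = (\<lambda>x. a *s \<rho> (qtet_x q 0 1) x + inverse a *s \<rho> (qtet_x q 1 2) x)"
    and "B = (\<lambda>x. b *s \<rho> (qtet_x q 2 3) x + inverse b *s \<rho> (qtet_x q 3 0) x)"
proof -
  show \<rho>: "qtet_module q \<rho>"
    using assms by (auto simp: compatible_evaluation_module_def t_evaluation_module_def evaluation_module_def)
  show "A = (\<lambda>x. a *s \<rho> (qtet_x q 0 1) x + inverse a *s \<rho> (qtet_x q 1 2) x)"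
    "B = (\<lambda>x. b *s \<rho> (qtet_x q 2 3) x + inverse b *s \<rho> (qtet_x q 3 0) x)"
    using assms by (auto simp: compatible_evaluation_module_def qtet_x_def qtet_module_add[OF \<rho>]
        qtet_module_mult[OF \<rho>] qtet_module_fscal[OF \<rho>])
qed

lemma Z4_pairs:
  assumes "j - i = 1 \<or> j - i = (2::4)"
  shows "(i, j) \<in> {(0, 1), (1, 2), (2, 3), (3, 0), (0, 2), (1, 3), (2, 0), (3, 1)}"
proof -
  have "j = i + 1 \<or> j = i + 2" using assms by (simp add: diff_eq_eq add.commute)
  then show ?thesis using Z4_exhaust[of i] by (elim disjE) simp_all
qed

definition scalar_commutant :: "('b \<Rightarrow> 'b) \<Rightarrow> ('b \<Rightarrow> 'b) \<Rightarrow> bool" where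
  "scalar_commutant A B \<longleftrightarrow> (\<forall>\<sigma>. endo \<sigma> \<and> (\<forall>x. \<sigma> (A x) = A (\<sigma> x)) \<and> (\<forall>x. \<sigma> (B x) = B (\<sigma> x))
     \<longrightarrow> (\<exists>k. \<forall>x. \<sigma> x = k *s x))"

text \<open>
  Both modules have bases \<open>v\<close> and \<open>v'\<close> with the matrices of \<open>V_d(t)\<close>, where \<open>d\<close> is determined by the dimension.
  The linear map with \<open>v\<^sub>n \<mapsto> v'\<^sub>n\<close> intertwines the modules and hence commutes with \<open>A\<close> and \<open>B\<close>. It is a
  scalar, so the two actions are equal.
\<close>

lemma compatible_unique:
  assumes \<rho>: "compatible_evaluation_module q t a b A B \<rho>" and \<rho>': "compatible_evaluation_module q t a b A B \<rho>'"
    and commutant: "scalar_commutant A B"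
  shows "\<rho> = \<rho>'"
proof -
  note ops = compatible_ops[OF \<rho>] and ops' = compatible_ops[OF \<rho>']
  obtain d1 d2 where iso: "isomorphic_to_V q \<rho> d1 t" "isomorphic_to_V q \<rho>' d2 t"
    using \<rho> \<rho>' by (auto simp: compatible_evaluation_module_def t_evaluation_module_def)
  have "d1 = d2"
    using iso by (auto simp: isomorphic_to_V_def dest!: basis_dim)
  then have iso': "isomorphic_to_V q \<rho>' d1 t" using iso(2) by simp
  from iso(1) obtain v where v: "is_basis d1 v"
      "represents d1 v (Zmat d1 * Smat d1 (inverse q) (inverse t) * Zmat d1) (\<rho> (qtet_x q 0 1))"
      "represents d1 v (Emat d1 q) (\<rho> (qtet_x q 1 2))"
      "represents d1 v (Kmat d1 q) (\<rho> (qtet_x q 2 3))"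
      "represents d1 v (Zmat d1 * Gmat d1 (inverse q) t * Zmat d1) (\<rho> (qtet_x q 3 0))"
      "represents d1 v (Lmat d1 q t) (\<rho> (qtet_x q 0 2))"
      "represents d1 v (the (mat_inverse (Zmat d1 * Emat d1 (inverse q) * Zmat d1))) (\<rho> (qtet_x q 1 3))"
      "represents d1 v (the (mat_inverse (Lmat d1 q t))) (\<rho> (qtet_x q 2 0))"
      "represents d1 v (Zmat d1 * Emat d1 (inverse q) * Zmat d1) (\<rho> (qtet_x q 3 1))"
    unfolding isomorphic_to_V_def by (elim exE conjE)
  from iso' obtain v' where v': "is_basis d1 v'"
      "represents d1 v' (Zmat d1 * Smat d1 (inverse q) (inverse t) * Zmat d1) (\<rho>' (qtet_x q 0 1))"
      "represents d1 v' (Emat d1 q) (\<rho>' (qtet_x q 1 2))"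
      "represents d1 v' (Kmat d1 q) (\<rho>' (qtet_x q 2 3))"
      "represents d1 v' (Zmat d1 * Gmat d1 (inverse q) t * Zmat d1) (\<rho>' (qtet_x q 3 0))"
      "represents d1 v' (Lmat d1 q t) (\<rho>' (qtet_x q 0 2))"
      "represents d1 v' (the (mat_inverse (Zmat d1 * Emat d1 (inverse q) * Zmat d1))) (\<rho>' (qtet_x q 1 3))"
      "represents d1 v' (the (mat_inverse (Lmat d1 q t))) (\<rho>' (qtet_x q 2 0))"
      "represents d1 v' (Zmat d1 * Emat d1 (inverse q) * Zmat d1) (\<rho>' (qtet_x q 3 1))"
    unfolding isomorphic_to_V_def by (elim exE conjE)
  obtain \<sigma> where \<sigma>: "endo \<sigma>" "\<And>n. n \<le> d1 \<Longrightarrow> \<sigma> (v n) = v' n"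
    using endo_exists[OF v(1)] by metis
  have endo: "endo (\<rho> (qtet_x q i j))" "endo (\<rho>' (qtet_x q i j))" for i j
    using qtet_module_endo[OF ops(1)] qtet_module_endo[OF ops'(1)] by (simp_all add: qtet_x_def)
  note int = represents_intertwines[OF v(1) endo(1) _ endo(2) _ \<sigma>]
  have intertwine: "\<sigma> (\<rho> (qtet_x q i j) u) = \<rho>' (qtet_x q i j) (\<sigma> u)" if "j - i = 1 \<or> j - i = 2" for i j u
  proof -
    have "(i, j) \<in> {(0, 1), (1, 2), (2, 3), (3, 0), (0, 2), (1, 3), (2, 0), (3, 1)}" by (rule Z4_pairs[OF that])
    then show ?thesis
      by (elim insertE emptyE Pair_inject)
        (simp_all only: int[OF v(2) v'(2)] int[OF v(3) v'(3)] int[OF v(4) v'(4)] int[OF v(5) v'(5)]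
          int[OF v(6) v'(6)] int[OF v(7) v'(7)] int[OF v(8) v'(8)] int[OF v(9) v'(9)])
  qed
  have "\<sigma> (A x) = A (\<sigma> x)" for x
  proof -
    have "\<sigma> (A x) = a *s \<sigma> (\<rho> (qtet_x q 0 1) x) + inverse a *s \<sigma> (\<rho> (qtet_x q 1 2) x)"
      unfolding ops(2) by (simp only: endo_add[OF \<sigma>(1)] endo_scale[OF \<sigma>(1)])
    also have "\<dots> = a *s \<rho>' (qtet_x q 0 1) (\<sigma> x) + inverse a *s \<rho>' (qtet_x q 1 2) (\<sigma> x)"
      by (subst (1 2) intertwine) simp_all
    also have "\<dots> = A (\<sigma> x)" unfolding ops'(2) ..
    finally show ?thesis .
  qed
  moreover have "\<sigma> (B x) = B (\<sigma> x)" for x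
  proof -
    have "\<sigma> (B x) = b *s \<sigma> (\<rho> (qtet_x q 2 3) x) + inverse b *s \<sigma> (\<rho> (qtet_x q 3 0) x)"
      unfolding ops(3) by (simp only: endo_add[OF \<sigma>(1)] endo_scale[OF \<sigma>(1)])
    also have "\<dots> = b *s \<rho>' (qtet_x q 2 3) (\<sigma> x) + inverse b *s \<rho>' (qtet_x q 3 0) (\<sigma> x)"
      by (subst (1 2) intertwine) simp_all
    also have "\<dots> = B (\<sigma> x)" unfolding ops'(3) ..
    finally show ?thesis .
  qed
  ultimately obtain k where k: "\<And>x. \<sigma> x = k *s x" using commutant \<sigma>(1) unfolding scalar_commutant_def by blast
  have "k \<noteq> 0"
  proof
    assume "k = 0"
    then have "v' 0 = 0" using \<sigma>(2)[of 0] by (simp add: k)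
    then show False using basis_nonzero[OF v'(1), of 0] by simp
  qed
  show ?thesis
  proof (rule qtet_module_eqI[OF ops(1) ops'(1)])
    fix i j :: 4 assume ij: "j - i = 1 \<or> j - i = 2"
    show "\<rho> (qtet_x q i j) = \<rho>' (qtet_x q i j)"
    proof
      fix u
      have "k *s \<rho> (qtet_x q i j) u = k *s \<rho>' (qtet_x q i j) u"
        using intertwine[OF ij, of u] by (simp add: k endo_scale[OF endo(2)])
      then show "\<rho> (qtet_x q i j) u = \<rho>' (qtet_x q i j) u" using \<open>k \<noteq> 0\<close> by simp
    qed
  qed
qed

end

context evaluation_system
begin

section \<open>Existence of the module\<close>

lemma eigenvalue_sets:
  "(\<lambda>n. 1 / y (int n)) ` {..d} = {q powi (int d - 2 * int n) | n. n \<le> d}"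
  "(\<lambda>n. y (int n)) ` {..d} = {q powi (int d - 2 * int n) | n. n \<le> d}"
  "(\<lambda>n. y (int d - int n)) ` {..d} = {q powi (int d - 2 * int n) | n. n \<le> d}"
  "(\<lambda>n. 1 / y (int d - int n)) ` {..d} = {q powi (int d - 2 * int n) | n. n \<le> d}"
proof -
  show 1: "(\<lambda>n. 1 / y (int n)) ` {..d} = {q powi (int d - 2 * int n) | n. n \<le> d}"
    by (auto simp: powi_qy[OF q0])
  show 2: "(\<lambda>n. y (int n)) ` {..d} = {q powi (int d - 2 * int n) | n. n \<le> d}"
  proof
    show "(\<lambda>n. y (int n)) ` {..d} \<subseteq> {q powi (int d - 2 * int n) | n. n \<le> d}"
    proof
      fix x assume "x \<in> (\<lambda>n. y (int n)) ` {..d}"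
      then obtain n where "n \<le> d" "x = y (int n)" by blast
      then have "x = q powi (int d - 2 * int (d - n)) \<and> d - n \<le> d" by (simp add: qy_def of_nat_diff)
      then show "x \<in> {q powi (int d - 2 * int n) | n. n \<le> d}" by blast
    qed
    show "{q powi (int d - 2 * int n) | n. n \<le> d} \<subseteq> (\<lambda>n. y (int n)) ` {..d}"
    proof
      fix x assume "x \<in> {q powi (int d - 2 * int n) | n. n \<le> d}"
      then obtain n where "n \<le> d" "x = q powi (int d - 2 * int n)" by blast
      then have "x = y (int (d - n))" by (simp add: qy_def of_nat_diff)
      then show "x \<in> (\<lambda>n. y (int n)) ` {..d}" by simp
    qed
  qed
  show "(\<lambda>n. y (int d - int n)) ` {..d} = {q powi (int d - 2 * int n) | n. n \<le> d}"
    using 1 by (simp only: y_d_minus)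
  show "(\<lambda>n. 1 / y (int d - int n)) ` {..d} = {q powi (int d - 2 * int n) | n. n \<le> d}"
    using 2 by (simp add: y_d_minus)
qed

lemma inj_eigenvalues: "inj_on (\<lambda>n. y (int n)) S" "inj_on (\<lambda>n. 1 / y (int n)) S"
  "inj_on (\<lambda>n. y (int d - int n)) S" "inj_on (\<lambda>n. 1 / y (int d - int n)) S"
  by (auto simp: inj_on_def y_eq_iff)

lemma q_spectra: "q_spectrum q d x01" "q_spectrum q d x12" "q_spectrum q d x23" "q_spectrum q d x30"
  "q_spectrum q d x13" "q_spectrum q d x31"
  by (rule lower_band_eigenbasis[OF ib x01 inj_eigenvalues(2)], erule q_spectrumI[OF _ eigenvalue_sets(1)],
      rule lower_band_eigenbasis[OF ib x12 inj_eigenvalues(1)], erule q_spectrumI[OF _ eigenvalue_sets(2)],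
      rule upper_band_eigenbasis[OF ib x23 inj_eigenvalues(3)], erule q_spectrumI[OF _ eigenvalue_sets(3)],
      rule upper_band_eigenbasis[OF ib x30 inj_eigenvalues(4)], erule q_spectrumI[OF _ eigenvalue_sets(4)],
      rule lower_band_eigenbasis[OF ib x13 inj_eigenvalues(1)], erule q_spectrumI[OF _ eigenvalue_sets(2)],
      rule lower_band_eigenbasis[OF ib x31 inj_eigenvalues(2)], erule q_spectrumI[OF _ eigenvalue_sets(1)])

lemma evaluation_parameter_admissible: "t \<notin> {q powi (int d - 2 * int n + 1) | n. 1 \<le> n \<and> n \<le> d}"
proof
  assume "t \<in> {q powi (int d - 2 * int n + 1) | n. 1 \<le> n \<and> n \<le> d}"
  then obtain n where n: "1 \<le> n" "n \<le> d" "t = q powi (int d - 2 * int n + 1)" by blast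
  have "q powi k / q = q powi (k - 1)" for k
    using q0 by (simp add: power_int_diff)
  then have "y (int d + 1 - int n) / q = q powi (2 * (int d + 1 - int n) - int d - 1)"
    by (simp only: qy_def)
  also have "2 * (int d + 1 - int n) - int d - 1 = int d - 2 * int n + 1" by simp
  finally show False using tq[of "int d + 1 - int n"] n by simp
qed

lemma evaluation_module_exists:
  obtains \<rho> where "t_evaluation_module q t \<rho>"
    and "\<rho> (qtet_x q 0 1) = x01" "\<rho> (qtet_x q 1 2) = x12" "\<rho> (qtet_x q 2 3) = x23" "\<rho> (qtet_x q 3 0) = x30"
proof -
  obtain x02 x20 z where x02: "band v x02 x02_lower y (\<lambda>_. 0)" and inv: "\<And>x. x20 (x02 x) = x" "\<And>x. x02 (x20 x) = x"
    and z: "eigenbasis d x02 (\<lambda>n. y (int d - int n)) z" "eigenbasis d x20 (\<lambda>n. 1 / y (int d - int n)) z"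
    by (rule x02_x20_exist) (rule that)
  have spec: "q_spectrum q d x02" "q_spectrum q d x20"
    using q_spectrumI[OF z(1) eigenvalue_sets(3)] q_spectrumI[OF z(2) eigenvalue_sets(4)] by blast+
  have "endo (generator x02 x20 i j)" for i j
    using endos endo_id penta_endo[OF x02] endo_x20[OF x02 inv] by (simp add: generator_def)
  then obtain \<rho> where \<rho>: "qtet_module q \<rho>"
    and \<rho>x: "\<And>i j. j - i = 1 \<or> j - i = 2 \<Longrightarrow> \<rho> (qtet_x q i j) = generator x02 x20 i j"
    using qtet_module_exists[OF q_minus_nonzero _ qtet_relations_generator[OF x02 inv]] by blast
  have gen: "\<rho> (qtet_x q 0 1) = x01" "\<rho> (qtet_x q 1 2) = x12" "\<rho> (qtet_x q 2 3) = x23" "\<rho> (qtet_x q 3 0) = x30"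
    "\<rho> (qtet_x q 0 2) = x02" "\<rho> (qtet_x q 1 3) = x13" "\<rho> (qtet_x q 2 0) = x20" "\<rho> (qtet_x q 3 1) = x31"
    by (subst \<rho>x, simp, simp add: generator_def)+
  have spectrum: "q_spectrum q d (\<rho> (qtet_x q i j))" if "j - i = 1 \<or> j - i = 2" for i j
  proof -
    have "(i, j) \<in> {(0, 1), (1, 2), (2, 3), (3, 0), (0, 2), (1, 3), (2, 0), (3, 1)}" by (rule Z4_pairs[OF that])
    then show ?thesis
      by (elim insertE emptyE Pair_inject) (simp_all only: gen spec q_spectra)
  qed
  have dim: "dim (UNIV :: 'b set) = d + 1" by (rule basis_dim[OF w_basis])
  have irred: "irreducible_module q \<rho>"
    unfolding irreducible_module_def
  proof (intro conjI allI impI)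
    show "(UNIV :: 'b set) \<noteq> {0}" using basis_nonzero[OF w_basis, of 0] by auto
    fix W assume W: "local.subspace W \<and> (\<forall>X\<in>qtet_algebra q. \<rho> X ` W \<subseteq> W)"
    have "\<rho> (qtet_x q i j) ` W \<subseteq> W" for i j
      using W by (auto simp: qtet_algebra_def qtet_x_def)
    from this[of 0 1] this[of 3 0] this[of 3 1] show "W = {0} \<or> W = UNIV"
      using irreducible[of W] W by (auto simp: gen)
  qed
  have fin: "\<exists>S::'b set. finite S \<and> span S = UNIV"
    using w_basis unfolding is_basis_def by (intro exI[of _ "(\<lambda>n. w (int n)) ` {..d}"]) simp
  have "has_diameter_type q \<rho> d 1" "has_shape q \<rho> d (\<lambda>_. 1)"
    using spectrum by (simp_all add: has_diameter_type_def has_shape_def q_spectrum_def)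
  moreover have "\<not> trivial_module q \<rho>"
    using dim d1 by (simp add: trivial_module_def)
  ultimately have "evaluation_module q \<rho> d"
    unfolding evaluation_module_def using \<rho> fin irred by (intro conjI)
  then have "t_evaluation_module q t \<rho>"
    unfolding t_evaluation_module_def
    by (intro exI[of _ d] conjI d1 t0 evaluation_parameter_admissible isomorphic_to_VI[OF gen x02 inv])
  then show ?thesis using gen(1-4) by (rule that)
qed

end

context split_system
begin

section \<open>From a Leonard pair to the module\<close>

lemma band_opA:
  assumes "a \<noteq> 0"
  shows "band w (opA a) (\<lambda>_. 0) (\<lambda>n. a / y n + y n / a)
    (\<lambda>n. a * (1 - 1 / (q^2 * D * y n)) + t * (1 - q^2 * D * y n) / (q * D * a))"
  unfolding opA_def
  by (rule penta_cong[OF penta_add[OF penta_scale[OF x01] penta_scale[OF x12]]])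
    (use assms in \<open>simp_all add: nz field_simps\<close>)

lemma band_opB:
  assumes "b \<noteq> 0"
  shows "band w (opB b) (\<lambda>n. b * (q * D * (1 - y n / (q^2 * D)) / t) + (1 - q^2 * D / y n) / b)
    (\<lambda>n. b * y n + 1 / (b * y n)) (\<lambda>_. 0)"
  unfolding opB_def
  by (rule penta_cong[OF penta_add[OF penta_scale[OF x23] penta_scale[OF x30]]])
    (use assms in \<open>simp_all add: nz field_simps\<close>)

text \<open>
  A commuting \<open>\<sigma>\<close> preserves the one-dimensional eigenspace of the second operator that contains \<open>w\<^sub>0\<close>,
  and it is determined by its value there because the first operator generates all \<open>w\<^sub>n\<close> from \<open>w\<^sub>0\<close>.
\<close>

lemma commutant_scalar:
  assumes a: "a \<noteq> 0" and b: "b \<noteq> 0"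
    and distinct: "inj_on (\<lambda>n. b * y (int d - int n) + 1 / (b * y (int d - int n))) {..d}"
    and raising: "\<And>n. n < d \<Longrightarrow> a * (1 - 1 / (q^2 * D * y (int n))) + t * (1 - q^2 * D * y (int n)) / (q * D * a) \<noteq> 0"
  shows "scalar_commutant (opA a) (opB b)"
  unfolding scalar_commutant_def
proof (intro allI impI, elim conjE)
  fix \<sigma> assume \<sigma>: "endo \<sigma>" and A': "\<forall>x. \<sigma> (opA a x) = opA a (\<sigma> x)" and B': "\<forall>x. \<sigma> (opB b x) = opB b (\<sigma> x)"
  note A = A'[rule_format] and B = B'[rule_format]
  let ?m = "\<lambda>n. b * y n + 1 / (b * y n)"
  obtain z where z: "eigenbasis d (opB b) (\<lambda>n. ?m (int d - int n)) z"
    using upper_band_eigenbasis[OF ib band_opB[OF b] distinct] .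
  have w_0: "opB b (w 0) = ?m 0 *s w 0"
    using band_apply[OF band_opB[OF b], of 0] by (simp add: w_outside)
  then have "opB b (\<sigma> (w 0)) = ?m 0 *s \<sigma> (w 0)"
    using B[of "w 0"] by (simp add: endo_scale[OF \<sigma>])
  then have "w 0 \<in> span {z d}" and \<sigma>w: "\<sigma> (w 0) \<in> span {z d}"
    using w_0 eigenbasis_eigenspace[OF z, of d] by (auto simp: eigenspace_def)
  then obtain k1 where k1: "w 0 = k1 *s z d"
    by (auto simp: span_singleton)
  obtain k2 where k2: "\<sigma> (w 0) = k2 *s z d"
    using \<sigma>w by (auto simp: span_singleton)
  have "k1 \<noteq> 0" using k1 basis_nonzero[OF w_basis, of 0] by auto
  then have base: "\<sigma> (w 0) = (k2 * inverse k1) *s w 0" unfolding k2 unfolding k1 by simp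
  let ?k = "k2 * inverse k1"
  have "\<sigma> (w (int n)) = ?k *s w (int n)" if "n \<le> d" for n
    using that
  proof (induction n)
    case 0
    then show ?case using base by simp
  next
    case (Suc n)
    define r where "r = a * (1 - 1 / (q^2 * D * y (int n))) + t * (1 - q^2 * D * y (int n)) / (q * D * a)"
    define \<theta> where "\<theta> = a / y (int n) + y (int n) / a"
    have r: "r \<noteq> 0" using raising[of n] Suc.prems by (simp add: r_def)
    have IH: "\<sigma> (w (int n)) = ?k *s w (int n)" using Suc by simp
    have up: "opA a (w (int n)) = \<theta> *s w (int n) + r *s w (int (Suc n))"
      using band_apply[OF band_opA[OF a], of "int n"] by (simp add: r_def \<theta>_def add.commute)
    have "\<theta> *s \<sigma> (w (int n)) + r *s \<sigma> (w (int (Suc n))) = \<sigma> (opA a (w (int n)))"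
      unfolding up by (simp only: endo_add[OF \<sigma>] endo_scale[OF \<sigma>])
    also have "\<dots> = opA a (?k *s w (int n))" unfolding A IH ..
    also have "\<dots> = ?k *s (\<theta> *s w (int n) + r *s w (int (Suc n)))"
      unfolding endo_scale[OF penta_endo[OF band_opA[OF a]]] up ..
    also have "\<dots> = \<theta> *s \<sigma> (w (int n)) + r *s (?k *s w (int (Suc n)))"
      unfolding IH by (simp only: scale_right_distrib scale_scale mult_ac)
    finally have "r *s \<sigma> (w (int (Suc n))) = r *s (?k *s w (int (Suc n)))" by (rule add_left_imp_eq)
    then show ?case using r by (simp only: scale_cancel_left simp_thms)
  qed
  then have "\<sigma> = (\<lambda>x. ?k *s x)"
    by (intro endo_eqI[OF w_basis \<sigma> endo_scaling]) blast
  then show "\<exists>k. \<forall>x. \<sigma> x = k *s x" by (intro exI[of _ ?k]) simp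
qed

end

context qtet_space
begin

text \<open>
  The basis \<open>w\<close> is the second split basis \<open>u\<close>, rescaled such that the subdiagonal entries \<open>1\<close> of \<open>A\<close> become the
  entries \<open>r\<^sub>n\<close> of \<open>a x01 + a^-1 x12\<close>. Feasibility is used three times: \<open>a b^-1 c\<close> for \<open>r\<^sub>n \<noteq> 0\<close>,
  \<open>a b c^-1\<close> for the admissibility of \<open>t\<close>, and \<open>b^2\<close> for the distinctness of the \<open>\<theta>*\<^sub>n\<close>.
\<close>

lemma racah_evaluation_system:
  assumes q0: "q \<noteq> 0" and nonroot: "\<And>n::nat. n \<ge> 1 \<Longrightarrow> q ^ n \<noteq> 1"
    and racah: "q_racah_leonard_pair q A B a b c d" and t: "t = a * b * inverse c"
  obtains w x01 x12 x23 x30 x31 x13 where "evaluation_system scale q t d w x01 x12 x23 x30 x31 x13"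
    and "A = (\<lambda>x. a *s x01 x + inverse a *s x12 x)" and "B = (\<lambda>x. b *s x23 x + inverse b *s x30 x)"
    and "scalar_commutant A B"
proof -
  define y where "y = qy q d"
  define D where "D = q powi int d"
  have feas: "feasible q a b c d" and endoA: "endo A" and endoB: "endo B"
    using racah by (auto simp: q_racah_leonard_pair_def leonard_pair_def)
  have a: "a \<noteq> 0" and b: "b \<noteq> 0" and c: "c \<noteq> 0" and d: "d \<ge> 1" using feas by (auto simp: feasible_def)
  have t0: "t \<noteq> 0" using a b c t by simp
  have b_sq: "b^2 \<noteq> q powi (2 * k)" if "1 - int d \<le> k" "k \<le> int d - 1" for k
    using feas that by (auto simp: feasible_def)
  have products: "a * inverse b * c \<noteq> q powi (int d + 1 - 2 * int n)" "a * b * inverse c \<noteq> q powi (int d + 1 - 2 * int n)"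
    if "1 \<le> n" "n \<le> d" for n
    using feas that by (auto simp: feasible_def)
  have y0: "y n \<noteq> 0" and y_prev: "y (n - 1) = y n / q^2" for n
    using q0 by (simp_all add: y_def qy_nonzero qy_pred)
  have D_nonzero: "D \<noteq> 0" using q0 by (simp add: D_def)
  have nonroot': "q powi k \<noteq> 1" if "k > 0" for k
    using nonroot[of "nat k"] that by (simp add: power_int_def)
  define r where "r n = a * (1 - 1 / (q^2 * D * y n)) + t * (1 - q^2 * D * y n) / (q * D * a)" for n
  have r_nonzero: "r (int n) \<noteq> 0" if n: "n < d" for n
  proof
    assume r: "r (int n) = 0"
    \<comment> \<open>The entry \<open>r\<^sub>n\<close> splits into the factors \<open>q^(2n+2) - 1\<close> and \<open>a^2 - t q y\<^sub>n\<close>.\<close>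
    have "r (int n) * (q^2 * D * y (int n) * a) = (q^2 * D * y (int n) - 1) * (a^2 - t * q * y (int n))"
      using q0 D_nonzero y0 a by (simp add: r_def field_simps eval_nat_numeral)
    moreover have "q^2 * D * y (int n) = q powi (2 * int n + 2)"
      using q0 by (simp add: D_def y_def qy_def power_int_add power_int_diff)
    then have "q^2 * D * y (int n) - 1 \<noteq> 0" using nonroot'[of "2 * int n + 2"] by simp
    ultimately have "a^2 = t * q * y (int n)" using r by simp
    then have "a * inverse b * c = q * y (int n)"
      using a b c by (simp add: t field_simps power2_eq_square)
    also have "\<dots> = q powi (int d + 1 - 2 * int (d - n))"
      using q0 n by (simp add: y_def qy_def of_nat_diff power_int_add power_int_diff)
    finally have "a * inverse b * c = q powi (int d + 1 - 2 * int (d - n))" .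
    moreover have "1 \<le> d - n" "d - n \<le> d" using n by auto
    ultimately show False using products(1) by blast
  qed
  have distinct: "inj_on (\<lambda>n. b * y (int d - int n) + 1 / (b * y (int d - int n))) {..d}"
  proof (rule inj_onI, rule ccontr)
    fix m n assume mn: "m \<in> {..d}" "n \<in> {..d}" "m \<noteq> n"
    define Y Y' where Y: "Y = y (int d - int m)" "Y' = y (int d - int n)"
    assume "b * y (int d - int m) + 1 / (b * y (int d - int m)) = b * y (int d - int n) + 1 / (b * y (int d - int n))"
    then have "(b * Y + 1 / (b * Y) - (b * Y' + 1 / (b * Y'))) * (b * Y * Y') = 0"
      by (simp only: Y) simp
    moreover have "Y \<noteq> 0" "Y' \<noteq> 0" using y0 by (simp_all add: Y)
    then have "(b * Y + 1 / (b * Y) - (b * Y' + 1 / (b * Y'))) * (b * Y * Y') = (Y - Y') * (b^2 * (Y * Y') - 1)"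
      using b by (simp add: field_simps power2_eq_square)
    ultimately have "(Y - Y') * (b^2 * (Y * Y') - 1) = 0" by simp
    moreover have "Y \<noteq> Y'"
    proof
      assume "Y = Y'"
      then have "q powi (2 * (int n - int m)) = 1" "q powi (2 * (int m - int n)) = 1"
        using q0 by (simp_all add: Y y_def qy_def power_int_diff right_diff_distrib)
      then show False using nonroot'[of "2 * (int n - int m)"] nonroot'[of "2 * (int m - int n)"] mn
        by (cases "m < n") auto
    qed
    ultimately have "b^2 * (Y * Y') = 1" by simp
    moreover have "Y * Y' = q powi (2 * (int d - int m) - int d + (2 * (int d - int n) - int d))"
      unfolding Y y_def qy_def by (simp only: power_int_add[OF disjI1[OF q0]])
    moreover have "2 * (int d - int m) - int d + (2 * (int d - int n) - int d) = - (2 * (int m + int n - int d))" by simp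
    ultimately have "b^2 * inverse (q powi (2 * (int m + int n - int d))) = 1"
      by (simp only: power_int_minus)
    moreover have "x = z" if "x * inverse z = 1" "z \<noteq> 0" for x z :: 'a
      using that by (simp add: field_simps)
    moreover have "q powi (2 * (int m + int n - int d)) \<noteq> 0" using q0 by simp
    ultimately have "b^2 = q powi (2 * (int m + int n - int d))" by blast
    moreover have "1 - int d \<le> int m + int n - int d" "int m + int n - int d \<le> int d - 1" using mn by auto
    ultimately show False using b_sq by blast
  qed
  have admissible: "t \<noteq> y n / q" if "1 \<le> n" "n \<le> int d" for n
  proof -
    have "y n / q = q powi (int d + 1 - 2 * int (nat (int d + 1 - n)))"
      using q0 that by (simp add: y_def qy_def power_int_diff power_int_add)
    moreover have "1 \<le> nat (int d + 1 - n)" "nat (int d + 1 - n) \<le> d" using that by linarith+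
    ultimately show ?thesis using products(2) by (simp only: t) metis
  qed
  obtain u where u: "is_basis d u"
    and Au: "represents d u (lower_bidiag d (\<lambda>n. theta q d a (d - n))) A"
    and Bu: "represents d u (upper_bidiag d (theta q d b) (phi_seq q a b c d)) B"
    using racah by (auto simp: q_racah_leonard_pair_def)
  define s where "s n = (\<Prod>i<n. inverse (r (int i)))" for n
  define w where "w k = (if 0 \<le> k \<and> k \<le> int d then s (nat k) *s u (nat k) else 0)" for k
  have s_nonzero: "s n \<noteq> 0" if "n \<le> d" for n
    using r_nonzero that by (auto simp: s_def)
  have w_eq: "w (int n) = (if n \<le> d then s n *s u n else 0)" for n by (simp add: w_def)
  have ib: "int_basis d w"
  proof -
    have "is_basis d (\<lambda>n. s n *s u n)" by (rule is_basis_scaled[OF u s_nonzero])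
    moreover have "is_basis d (\<lambda>n. w (int n)) \<longleftrightarrow> is_basis d (\<lambda>n. s n *s u n)"
      by (rule is_basis_cong) (simp add: w_eq)
    ultimately have "is_basis d (\<lambda>n. w (int n))" by blast
    then show ?thesis by (auto simp: int_basis_def w_def)
  qed
  have boundary: "y (-1) = 1 / (q^2 * D)" "y (int d + 1) = q^2 * D"
    using q0 by (simp_all add: y_def D_def qy_def power_int_add power_int_diff power_int_minus divide_inverse)
  obtain x01 where x01: "band w x01 (\<lambda>_. 0) (\<lambda>n. 1 / y n) (\<lambda>n. 1 - 1 / (q^2 * D * y n))"
    by (rule band_exists[OF ib, of "\<lambda>_. 0" "\<lambda>n. 1 - 1 / (q^2 * D * y n)" "\<lambda>n. 1 / y n"])
      (use q0 D_nonzero in \<open>simp_all add: boundary\<close>)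
  obtain x12 where x12: "band w x12 (\<lambda>_. 0) y (\<lambda>n. t * (1 - q^2 * D * y n) / (q * D))"
    by (rule band_exists[OF ib, of "\<lambda>_. 0" "\<lambda>n. t * (1 - q^2 * D * y n) / (q * D)" y])
      (use q0 D_nonzero in \<open>simp_all add: boundary\<close>)
  obtain x23 where x23: "band w x23 (\<lambda>n. q * D * (1 - y n / (q^2 * D)) / t) y (\<lambda>_. 0)"
    by (rule band_exists[OF ib, of "\<lambda>n. q * D * (1 - y n / (q^2 * D)) / t" "\<lambda>_. 0" y])
      (use q0 D_nonzero in \<open>simp_all add: boundary\<close>)
  obtain x30 where x30: "band w x30 (\<lambda>n. 1 - q^2 * D / y n) (\<lambda>n. 1 / y n) (\<lambda>_. 0)"
    by (rule band_exists[OF ib, of "\<lambda>n. 1 - q^2 * D / y n" "\<lambda>_. 0" "\<lambda>n. 1 / y n"])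
      (use q0 D_nonzero in \<open>simp_all add: boundary\<close>)
  obtain x31 where x31: "band w x31 (\<lambda>_. 0) (\<lambda>n. 1 / y n) (\<lambda>_. 0)"
    by (rule band_exists[OF ib, of "\<lambda>_. 0" "\<lambda>_. 0" "\<lambda>n. 1 / y n"]) simp_all
  obtain x13 where x13: "band w x13 (\<lambda>_. 0) y (\<lambda>_. 0)"
    by (rule band_exists[OF ib, of "\<lambda>_. 0" "\<lambda>_. 0" y]) simp_all
  have sys: "evaluation_system scale q t d w x01 x12 x23 x30 x31 x13"
    by (unfold_locales)
      (fact ib q0 nonroot t0 d x01[unfolded y_def D_def] x12[unfolded y_def D_def] x23[unfolded y_def D_def]
        x30[unfolded y_def D_def] x31[unfolded y_def D_def] x13[unfolded y_def D_def] admissible[unfolded y_def])+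
  interpret evaluation_system scale q t d w x01 x12 x23 x30 x31 x13 by (rule sys)
  note bA = band_opA[OF a, folded y_def D_def] and bB = band_opB[OF b, folded y_def D_def]
  have theta_A: "theta q d a (d - n) = a / y (int n) + y (int n) / a" if "n \<le> d" for n
    using that q0 a by (simp add: theta_def y_def qy_def of_nat_diff power_int_diff power_int_add divide_inverse)
  have theta_B: "theta q d b n = b * y (int n) + 1 / (b * y (int n))" for n
    using q0 b by (simp add: theta_def y_def qy_def power_int_diff divide_inverse)
  have "opA a (w (int n)) = A (w (int n))" if n: "n \<le> d" for n
  proof -
    have Aun: "A (u n) = theta q d a (d - n) *s u n + (if n < d then u (Suc n) else 0)"
    proof -
      have "A (u n) = (\<Sum>i\<le>d. (if i = n then theta q d a (d - n) *s u n else 0) + (if i = Suc n then u (Suc n) else 0))"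
        using Au n by (auto simp: represents_def lower_bidiag_def intro!: sum.cong)
      also have "\<dots> = theta q d a (d - n) *s u n + (if n < d then u (Suc n) else 0)"
        using n by (auto simp: sum.distrib)
      finally show ?thesis .
    qed
    have "r (int n) *s w (int n + 1) = (if n < d then s n *s u (Suc n) else 0)"
    proof (cases "n < d")
      case True
      have "w (int n + 1) = s (Suc n) *s u (Suc n)" using w_eq[of "Suc n"] True by (simp add: add.commute)
      moreover have "r (int n) * s (Suc n) = s n" using r_nonzero[OF True] by (simp add: s_def)
      ultimately show ?thesis using True by simp
    next
      case False
      then show ?thesis using n by (simp add: w_def)
    qed
    moreover have "opA a (w (int n)) = theta q d a (d - n) *s w (int n) + r (int n) *s w (int n + 1)"
      using band_apply[OF bA, of "int n"] n by (simp add: r_def theta_A)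
    ultimately show ?thesis
      using n by (simp add: w_eq endo_scale[OF endoA] Aun scale_right_distrib mult.commute)
  qed
  then have "opA a = A"
    using penta_endo[OF bA] endoA by (intro endo_eqI[OF w_basis]) auto
  moreover have "opB b (w (int n)) = B (w (int n))" if n: "n \<le> d" for n
  proof -
    define l where "l n = b * (q * D * (1 - y n / (q^2 * D)) / t) + (1 - q^2 * D / y n) / b" for n
    have Bun: "B (u n) = theta q d b n *s u n + (case n of 0 \<Rightarrow> 0 | Suc m \<Rightarrow> phi_seq q a b c d n *s u m)"
    proof -
      have "B (u n) = (\<Sum>i\<le>d. (if i = n then theta q d b n *s u n else 0) + (if Suc i = n then phi_seq q a b c d n *s u i else 0))"
        using Bu n by (auto simp: represents_def upper_bidiag_def intro!: sum.cong)
      also have "\<dots> = theta q d b n *s u n + (case n of 0 \<Rightarrow> 0 | Suc m \<Rightarrow> phi_seq q a b c d n *s u m)"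
        using n by (cases n) (auto simp: sum.distrib)
      finally show ?thesis .
    qed
    \<comment> \<open>The superdiagonal entries of both forms of \<open>B\<close> agree: this is where \<open>t = a b c^-1\<close> enters.\<close>
    have phi: "phi_seq q a b c d (Suc m) = l (int (Suc m)) * r (int m)" if "n = Suc m" for m
    proof -
      define Q where "Q = q powi int (Suc m)"
      have Q: "Q \<noteq> 0" using q0 by (simp add: Q_def)
      note powi = power_int_add[OF disjI1[OF q0]] power_int_diff[OF disjI1[OF q0]] power_int_minus power_int_1_right
      have e: "q powi (int d + 1) = D * q" "q powi (- int (Suc m)) = 1 / Q"
        "q powi (int (Suc m) - int d - 1) = Q / (D * q)" "q powi (int d - int (Suc m) + 1) = D * q / Q"
        by (simp_all only: powi D_def Q_def inverse_eq_divide divide_divide_eq_left times_divide_eq_left)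
      have "y (int (Suc m)) = Q^2 / D"
        by (simp only: y_def qy_def powi mult_2 power2_eq_square D_def Q_def)
      moreover have "y (int m) = y (int (Suc m)) / q^2"
        using y_prev[of "int (Suc m)"] by simp
      ultimately have ym: "y (int (Suc m)) = Q^2 / D" "y (int m) = Q^2 / D / q^2" by simp_all
      show ?thesis
        unfolding phi_seq_def e l_def r_def ym Q_def[symmetric] t using a b c q0 D_nonzero Q
        by (simp add: field_simps eval_nat_numeral)
    qed
    have "l (int n) *s w (int n - 1) = s n *s (case n of 0 \<Rightarrow> 0 | Suc m \<Rightarrow> phi_seq q a b c d n *s u m)"
    proof (cases n)
      case 0
      then show ?thesis by (simp add: w_def)
    next
      case (Suc m)
      have "r (int m) * s (Suc m) = s m" using r_nonzero[of m] Suc n by (simp add: s_def)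
      then have "l (int n) * s m = s n * phi_seq q a b c d n"
        using phi[OF Suc] Suc by (simp add: mult_ac)
      then show ?thesis using w_eq[of m] Suc n by simp
    qed
    moreover have "opB b (w (int n)) = theta q d b n *s w (int n) + l (int n) *s w (int n - 1)"
      using band_apply[OF bB, of "int n"] by (simp add: l_def theta_B)
    ultimately show ?thesis
      using n by (simp add: w_eq endo_scale[OF endoB] Bun scale_right_distrib mult.commute)
  qed
  then have "opB b = B"
    using penta_endo[OF bB] endoB by (intro endo_eqI[OF w_basis]) auto
  ultimately have AB: "opA a = A" "opB b = B" by blast+
  show ?thesis
  proof (rule that[OF sys])
    show "A = (\<lambda>x. a *s x01 x + inverse a *s x12 x)" "B = (\<lambda>x. b *s x23 x + inverse b *s x30 x)"
      by (simp_all only: AB[symmetric] opA_def opB_def)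
    show "scalar_commutant A B"
      unfolding AB[symmetric]
      by (rule commutant_scalar[OF a b distinct[unfolded y_def] r_nonzero[unfolded r_def y_def D_def]])
  qed
qed

end

theorem corollary16p34:
  fixes scale :: "'f::alg_closed_field \<Rightarrow> 'v::ab_group_add \<Rightarrow> 'v"
    and q a b c t :: 'f
    and d :: nat
    and A B :: "'v \<Rightarrow> 'v"
  assumes "vector_space scale"
    and "q \<noteq> 0"
    and "\<And>n::nat. n \<ge> 1 \<Longrightarrow> q ^ n \<noteq> 1"
    and "d \<ge> 1"
    and "qtet_space.q_racah_leonard_pair scale q A B a b c d"
    and "t = a * b * inverse c"
  shows "(\<exists>!\<rho>. qtet_space.compatible_evaluation_module scale q t a b A B \<rho>)
    \<and> (\<forall>\<rho>. qtet_space.compatible_evaluation_module scale q t a b A B \<rho> \<longrightarrow>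
          qtet_space.Z3_symmetric_completion scale q a b c d A B (\<rho> (bold_C q a b c))
        \<and> qtet_space.dual_Z3_symmetric_completion scale q a b c d A B (\<rho> (bold_C' q a b c)))"
proof -
  interpret qtet_space scale using assms(1) by (rule qtet_space.intro)
  obtain w x01 x12 x23 x30 x31 x13 where sys: "evaluation_system scale q t d w x01 x12 x23 x30 x31 x13"
    and A: "A = (\<lambda>x. scale a (x01 x) + scale (inverse a) (x12 x))"
    and B: "B = (\<lambda>x. scale b (x23 x) + scale (inverse b) (x30 x))"
    and commutant: "scalar_commutant A B"
    by (rule racah_evaluation_system[OF assms(2) _ assms(5,6)]) (erule assms(3), rule that)
  interpret evaluation_system scale q t d w x01 x12 x23 x30 x31 x13 by (rule sys)
  have abc: "a \<noteq> 0" "b \<noteq> 0" "c \<noteq> 0"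
    using assms(5) by (auto simp: q_racah_leonard_pair_def feasible_def)
  obtain \<rho>0 where \<rho>0: "t_evaluation_module q t \<rho>0"
    and gen: "\<rho>0 (qtet_x q 0 1) = x01" "\<rho>0 (qtet_x q 1 2) = x12" "\<rho>0 (qtet_x q 2 3) = x23" "\<rho>0 (qtet_x q 3 0) = x30"
    by (rule evaluation_module_exists) (rule that)
  have mod: "qtet_module q \<rho>0" using \<rho>0 by (auto simp: t_evaluation_module_def evaluation_module_def)
  note act = qtet_module_add[OF mod] qtet_module_diff[OF mod] qtet_module_mult[OF mod] qtet_module_fscal[OF mod]
    gen[unfolded qtet_x_def]
  have comp: "compatible_evaluation_module q t a b A B \<rho>0"
    unfolding compatible_evaluation_module_def using \<rho>0 by (simp add: A B act fun_eq_iff)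
  have unique: "\<rho> = \<rho>0" if "compatible_evaluation_module q t a b A B \<rho>" for \<rho>
    by (rule compatible_unique[OF that comp commutant])
  have AB: "A = opA a" "B = opB b" by (simp_all only: A B opA_def opB_def)
  have "\<rho>0 (bold_C q a b c) = opC a b c"
    by (simp add: fun_eq_iff bold_C_def act opC_def comm_30_01_def divide_inverse)
  moreover have "\<rho>0 (bold_C' q a b c) = opC' a b c"
    by (simp add: fun_eq_iff bold_C'_def act opC'_def comm_12_23_def divide_inverse)
  ultimately have "Z3_symmetric_completion q a b c d A B (\<rho>0 (bold_C q a b c))"
    "dual_Z3_symmetric_completion q a b c d A B (\<rho>0 (bold_C' q a b c))"
    using completion[OF abc assms(6)] dual_completion[OF abc assms(6)] by (simp_all only: AB)
  then show ?thesis using comp unique by blast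
qed

end
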